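(* Let $s>0$, and let $P(\xi,\zeta)$ be a polynomial in two variables with complex coefficients of the form $$P(\xi,\zeta)=P_0+P_1(\zeta)\xi+\dots+P_p(\zeta)\xi^p=P_0(1-\xi\lambda_1(\zeta))^{m_1}\cdots(1-\xi\lambda_l(\zeta))^{m_l},$$ where $P_0\in\mathbb{C}\setminus\{0\}$ is constant and $\lambda_1(\zeta),\dots,\lambda_l(\zeta)$ are the distinct (algebraic) roots of $\lambda^pP(1/\lambda,\zeta)=0$ with multiplicities $m_1,\dots,m_l$. Let $\hat{f}(\varepsilon,z)\in\mathbb{E}[[\varepsilon]]$ and let $\hat{x}(\varepsilon,z)$ be a formal (power series in $\varepsilon$) solution of the singular perturbation problem $$P(\varepsilon,\partial_{\Gamma_s,z})\hat{x}(\varepsilon,z)=\hat{f}(\varepsilon,z).$$ Then $\hat{x}$ decomposes as $$\hat{x}(\varepsilon,z)=\sum_{\alpha=1}^l\sum_{\beta=1}^{m_\alpha}\hat{x}_{\alpha\beta}(\varepsilon,z),$$ where $\hat{x}_{\alpha\beta}(\varepsilon,z)$ is a formal power series satisfying $\hat{x}_{\alpha\beta}(\varepsilon,z)=q_{\alpha\beta}(\varepsilon,\partial_{\Gamma_s,z})\hat{f}(\varepsilon,z)$ with $$q_{\alpha\beta}(\varepsilon,\zeta)=c_{\alpha\beta}(\zeta)\sum_{n=0}^\infty\frac{n!}{(n+1-\beta)!}\lambda_\alpha^n(\zeta)\varepsilon^n .$$ Here $c_{\alpha\beta}(\zeta)$ are algebraic functions satisfying $$q_n(\zeta)=\sum_{\alpha=1}^l\sum_{\beta=1}^{m_\alpha}c_{\alpha\beta}(\zeta)\frac{n!}{(n+1-\beta)!}\lambda_\alpha^n(\zeta)\quad\text{for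 } n\in\mathbb{N}_0,$$ for the sequence of polynomials $(q_n(\zeta))_{n\ge0}$ being the unique solution of the difference equation $$P_0q_n(\zeta)+P_1(\zeta)q_{n-1}(\zeta)+\dots+P_p(\zeta)q_{n-p}(\zeta)=0\quad\text{for } n\ge1$$ with the initial conditions $q_0(\zeta)\equiv 1/P_0$ and $q_{-1}(\zeta)\equiv\dots\equiv q_{1-p}(\zeta)\equiv0$. Moreover, if $\hat{f}(\varepsilon,z)\in\mathbb{E}[[\varepsilon]]_{\tilde{s}}$ for some $\tilde{s}\ge0$, then $\hat{x}_{\alpha\beta}(\varepsilon,z)\in\mathbb{E}[[\varepsilon]]_{\max\{\tilde{s},q_\alpha s\}}$, where $q_\alpha$ is the pole order of $\lambda_\alpha(\zeta)$ at infinity.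
   Context: Conventions: $\frac{n!}{(n+1-\beta)!}=n(n-1)\cdots(n-\beta+2)$, which is $0$ when $n<\beta-1$. $P$ has degree $p$ in $\xi$. Pole order: each $\lambda_\alpha(\zeta)$ is an algebraic function, and there are a rational number $q_\alpha$ (pole order) and $a_\alpha\in\mathbb{C}\setminus\{0\}$ (leading term) with $\lim_{\zeta\to\infty}\lambda_\alpha(\zeta)/\zeta^{q_\alpha}=a_\alpha$. Spaces: $\kappa\in\mathbb{N}$ is the smallest natural number such that for some $r_0>0$ every $\lambda_\alpha$ is a holomorphic function of $\omega=\zeta^{1/\kappa}$ for $|\zeta|>r_0$ with (at most) a pole at infinity. $\mathcal{O}_{1/\kappa}(D)$ denotes the functions that are holomorphic functions of the variable $z^{1/\kappa}$ on the disc $D$ centred at $0$. $\mathbb{E}=\mathcal{O}_{1/\kappa}$ is the space of such functions on $D_r=\{|z|<r\}$, continuous on $\overline{D}_r$, for some $r>0$ (which may be decreased if necessary), with norm $\sup_{|z|\le r}|\varphi(z)|$; it contains the ordinary holomorphic functions. $\mathbb{E}[[\varepsilon]]$ is the set of formal series $\sum_{n\ge0}x_n(z)\varepsilon^n$ with $x_n\in\mathbb{E}$, and $\mathbb{E}[[\varepsilon]]_{\sigma}$ ($\sigma\in\mathbb{R}$) the subset of those of Gevrey order $\sigma$: there are $A,B<\infty$ with $\|x_n\|_{\mathbb{E}}\le AB^n(n!)^{\sigma}$ for all $n$. Moment derivative: $\Gamma_s=(\Gamma(1+sn))_{n\ge0}$, and $\partial_{\Gamma_s,z}\left(\sum_{n\ge0}\frac{a_n}{\Gamma(1+sn)}z^n\right)=\sum_{n\ge0}\frac{a_{n+1}}{\Gamma(1+sn)}z^n$.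 On functions of $z^{1/\kappa}$, $\partial_{\Gamma_s,z}\varphi(z):=\partial^\kappa_{\Gamma_{s/\kappa},w}(\varphi(w^\kappa))|_{w=z^{1/\kappa}}$. Moment pseudodifferential operators: let $k=1/s$. If $\lambda(\zeta)$ is holomorphic for $|\zeta|\ge r_0$ and of moderate (polynomial) growth at infinity, then for $\varphi\in\mathcal{O}(D_r)$ and $|z|<\epsilon<r$, $$\lambda(\partial_{\Gamma_s,z})\varphi(z):=\frac{1}{2\pi i}\oint_{|w|=\epsilon}\varphi(w)\int_{r_0}^{e^{i\theta}\infty}\lambda(\zeta)\mathbf{E}_s(z\zeta)\,k(w\zeta)^{k-1}e^{-(\zeta w)^k}\,d\zeta\,dw,$$ where $\theta\in(-\arg w-\frac{\pi}{2k},-\arg w+\frac{\pi}{2k})$, the circle is positively oriented, and $\mathbf{E}_s(z)=\sum_{n\ge0}\frac{z^n}{\Gamma(1+ns)}$. If $\lambda(\zeta)$ is a holomorphic function of $\zeta^{1/\kappa}$ for $|\zeta|\ge r_0$ of moderate growth at infinity, then for $\varphi\in\mathcal{O}_{1/\kappa}(D)$, $\lambda(\partial_{\Gamma_s,z})\varphi(z):=\lambda(\partial^\kappa_{\Gamma_{s/\kappa},w})(\varphi(w^\kappa))\big|_{w=z^{1/\kappa}}$, where the operator on the right is the one attached, by the previous formula with $s/\kappa$ in place of $s$, to the symbol $\zeta\mapsto\lambda(\zeta^\kappa)$. The expression $q_{\alpha\beta}(\varepsilon,\partial_{\Gamma_s,z})\hat{f}$ means $\sum_{n\ge0}\frac{n!}{(n+1-\beta)!}\varepsilon^n\,(c_{\alpha\beta}\lambda_\alpha^n)(\partial_{\Gamma_s,z})\hat{f}(\varepsilon,z)$,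 the operators acting on the coefficients of $\hat{f}$.
   Formalization: If κ/s is not an integer, the kernel is multivalued in w, and one turn of the circle does not even give the identity for the symbol 1, so the claim fails. The circle integral is therefore read as its mean over all turns, which is the usual integral when κ/s is an integer. *)

theory Defs
  imports "HOL-Complex_Analysis.Complex_Analysis" "HOL-Library.Landau_Symbols"
begin

(* P(xi, zeta) for P = sum_j P_j(zeta) xi^j; the outer variable of P is xi. *)
definition eval2 :: "complex poly poly \<Rightarrow> complex \<Rightarrow> complex \<Rightarrow> complex" where
  "eval2 P \<xi> \<zeta> = poly (poly P [:\<xi>:]) \<zeta>"

definition algebraic_fun :: "real \<Rightarrow> (complex \<Rightarrow> complex) \<Rightarrow> bool" where
  "algebraic_fun R g \<longleftrightarrow> (\<exists>Q. Q \<noteq> 0 \<and> (\<forall>\<zeta>. R < norm \<zeta> \<longrightarrow> eval2 Q (g \<zeta>) \<zeta> = 0))"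

(* A function of zeta that is holomorphic in omega = zeta^(1/kappa) is multivalued.  It is given
   by its principal determination g, and by G with g(zeta) = G(zeta^(1/kappa)), which is
   single-valued and determined by g (identity theorem).  Polynomial growth of the holomorphic
   function G means that it has at most a pole at infinity. *)
definition ramified_hol ::
    "nat \<Rightarrow> real \<Rightarrow> (complex \<Rightarrow> complex) \<Rightarrow> (complex \<Rightarrow> complex) \<Rightarrow> bool" where
  "ramified_hol \<kappa> R G g \<longleftrightarrow>
     G holomorphic_on {\<omega>. R < norm \<omega> ^ \<kappa>} \<and>
     (\<exists>N::nat. G \<in> O[at_infinity](\<lambda>\<omega>. \<omega> ^ N)) \<and>
     (\<forall>\<zeta>. R < norm \<zeta> \<longrightarrow> g \<zeta> = G (\<zeta> powr (1 / of_nat \<kappa>)))"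

definition pole_order :: "(complex \<Rightarrow> complex) \<Rightarrow> rat \<Rightarrow> bool" where
  "pole_order g q \<longleftrightarrow>
     (\<exists>a. a \<noteq> 0 \<and> ((\<lambda>\<zeta>. g \<zeta> / \<zeta> powr of_rat q) \<longlongrightarrow> a) at_infinity)"

(* Functions of z that are holomorphic in w = z^(1/kappa) are always represented by the
   corresponding function of w; the disc |z| < r becomes |w| < r^(1/kappa). *)
definition E_space :: "nat \<Rightarrow> real \<Rightarrow> (complex \<Rightarrow> complex) set" where
  "E_space \<kappa> r =
     {\<phi>. \<phi> holomorphic_on ball 0 (root \<kappa> r) \<and> continuous_on (cball 0 (root \<kappa> r)) \<phi>}"

definition E_norm :: "nat \<Rightarrow> real \<Rightarrow> (complex \<Rightarrow> complex) \<Rightarrow> real" where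
  "E_norm \<kappa> r \<phi> = (SUP w\<in>cball 0 (root \<kappa> r). norm (\<phi> w))"

definition E_series :: "nat \<Rightarrow> real \<Rightarrow> (nat \<Rightarrow> complex \<Rightarrow> complex) set" where
  "E_series \<kappa> r = {x. \<forall>n. x n \<in> E_space \<kappa> r}"

definition E_gevrey :: "nat \<Rightarrow> real \<Rightarrow> real \<Rightarrow> (nat \<Rightarrow> complex \<Rightarrow> complex) set" where
  "E_gevrey \<kappa> r \<sigma> =
     {x \<in> E_series \<kappa> r. \<exists>A\<ge>0. \<exists>B\<ge>0. \<forall>n. E_norm \<kappa> r (x n) \<le> A * B ^ n * fact n powr \<sigma>}"

definition Gamma_seq :: "real \<Rightarrow> nat \<Rightarrow> real" where
  "Gamma_seq s n = Gamma (1 + s * real n)"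

definition moment_deriv :: "(nat \<Rightarrow> real) \<Rightarrow> (complex \<Rightarrow> complex) \<Rightarrow> complex \<Rightarrow> complex" where
  "moment_deriv \<mu> \<phi> z =
     (let a = (\<lambda>n. of_real (\<mu> n) * fps_nth (fps_expansion \<phi> 0) n)
      in \<Sum>n. a (Suc n) / of_real (\<mu> n) * z ^ n)"

definition moment_deriv_ram ::
    "nat \<Rightarrow> real \<Rightarrow> (complex \<Rightarrow> complex) \<Rightarrow> complex \<Rightarrow> complex" where
  "moment_deriv_ram \<kappa> s = moment_deriv (Gamma_seq (s / real \<kappa>)) ^^ \<kappa>"

definition poly_moment_op ::
    "nat \<Rightarrow> real \<Rightarrow> complex poly \<Rightarrow> (complex \<Rightarrow> complex) \<Rightarrow> complex \<Rightarrow> complex" where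
  "poly_moment_op \<kappa> s Q \<phi> w =
     (\<Sum>j\<le>degree Q. coeff Q j * (moment_deriv_ram \<kappa> s ^^ j) \<phi> w)"

definition formal_solution ::
    "nat \<Rightarrow> real \<Rightarrow> real \<Rightarrow> complex poly poly \<Rightarrow>
     (nat \<Rightarrow> complex \<Rightarrow> complex) \<Rightarrow> (nat \<Rightarrow> complex \<Rightarrow> complex) \<Rightarrow> bool" where
  "formal_solution \<kappa> s r P x f \<longleftrightarrow>
     (\<forall>n. \<forall>w\<in>ball 0 (root \<kappa> r).
        (\<Sum>j\<le>min n (degree P). poly_moment_op \<kappa> s (coeff P j) (x (n - j)) w) = f n w)"

definition Mittag_Leffler :: "real \<Rightarrow> complex \<Rightarrow> complex" where
  "Mittag_Leffler s z = (\<Sum>n. z ^ n / of_real (Gamma (1 + real n * s)))"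

(* k u^(k-1) exp(-u^k) at the point u = a e^(i t) of the Riemann surface of the logarithm. *)
definition psdo_kernel :: "real \<Rightarrow> real \<Rightarrow> real \<Rightarrow> complex" where
  "psdo_kernel k a t =
     of_real (k * a powr (k - 1)) * cis ((k - 1) * t) * exp (- of_real (a powr k) * cis (k * t))"

(* The integral over zeta for w = d e^(i t), t real, along the arc from r0 to r0 e^(- i t) followed
   by the ray in direction theta = - t = - arg w.  By Cauchy's theorem the other admissible theta
   give the same value. *)
definition psdo_inner ::
    "real \<Rightarrow> real \<Rightarrow> (complex \<Rightarrow> complex) \<Rightarrow> complex \<Rightarrow> real \<Rightarrow> real \<Rightarrow> complex" where
  "psdo_inner s r0 L z d t =
     (let F = (\<lambda>\<zeta>. L \<zeta> * Mittag_Leffler s (z * \<zeta>)) in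
      (LBINT u=0..t. F (of_real r0 * cis (- u)) * psdo_kernel (1 / s) (d * r0) (t - u) *
         (- \<i> * of_real r0 * cis (- u))) +
      (LBINT a=r0..\<infinity>. F (of_real a * cis (- t)) * psdo_kernel (1 / s) (d * a) 0 * cis (- t)))"

(* 1/(2 pi i) times the integral over w, for N positive turns of the circle |w| = d starting at
   arg w = t0. *)
definition psdo_turns ::
    "real \<Rightarrow> real \<Rightarrow> real \<Rightarrow> real \<Rightarrow> nat \<Rightarrow> (complex \<Rightarrow> complex) \<Rightarrow> (complex \<Rightarrow> complex) \<Rightarrow>
     complex \<Rightarrow> complex" where
  "psdo_turns s r0 d t0 N L \<phi> z =
     1 / (2 * of_real pi * \<i>) *
       (LBINT t:{t0..t0 + 2 * pi * real N}.
          \<phi> (of_real d * cis t) * psdo_inner s r0 L z d t * (\<i> * of_real d * cis t))"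

(* The kernel u^(k-1) exp(-u^k), k = 1/s, lives on the Riemann surface of the logarithm.
   If k is an integer, then every positive turn of the circle gives the same value, and psdo is the
   integral over one turn (psdo_eq_one_turn below).  If k is not an integer, then the turns give
   different values, and none of them extends the moment derivatives: for L = 1, phi = 1, z = 0
   the integral over w is that of exp(-(r0 w)^k) / w, with mean 1 over the turns, but 1 for
   no single turn in general.  The integral over the circle is therefore the mean over the turns. *)
definition psdo ::
    "real \<Rightarrow> real \<Rightarrow> real \<Rightarrow> real \<Rightarrow> (complex \<Rightarrow> complex) \<Rightarrow> (complex \<Rightarrow> complex) \<Rightarrow>
     complex \<Rightarrow> complex" where
  "psdo s r0 d t0 L \<phi> z = lim (\<lambda>N. psdo_turns s r0 d t0 N L \<phi> z / of_nat N)"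

definition psdo_kernel_int :: "nat \<Rightarrow> complex \<Rightarrow> complex" where
  "psdo_kernel_int k u = of_nat k * u ^ (k - 1) * exp (- (u ^ k))"

lemma psdo_kernel_nat:
  assumes "k \<ge> 1" "a > 0"
  shows "psdo_kernel (real k) a t = psdo_kernel_int k (of_real a * cis t)"
proof -
  have k: "real k - 1 = real (k - 1)"
    using assms(1) by (simp add: of_nat_diff)
  have 1: "a powr (real k - 1) = a ^ (k - 1)" "a powr real k = a ^ k"
    unfolding k using assms(2) by (rule powr_realpow)+
  have 2: "cis ((real k - 1) * t) = cis t ^ (k - 1)" "cis (real k * t) = cis t ^ k"
    unfolding k by (rule Complex.DeMoivre[symmetric])+
  show ?thesis
    unfolding psdo_kernel_def psdo_kernel_int_def 1 2 by (simp add: power_mult_distrib)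
qed

lemma interval_integral_periodic:
  fixes g :: "real \<Rightarrow> complex" and a p :: real
  assumes cont: "continuous_on UNIV g" and per: "\<And>x. g (x + p) = g x"
  shows "(LBINT x=a..a + p. g x) = (LBINT x=0..p. g x)"
proof -
  define G where "G u = (LBINT x=0..u. g x)" for u :: real
  have dG: "(G has_vector_derivative g x) (at x)" for x
  proof -
    define M where "M = \<bar>x\<bar> + 1"
    have "(G has_vector_derivative g x) (at x within {-M..M})"
      unfolding G_def zero_ereal_def
      by (rule interval_integral_FTC2[of "-M" 0 M])
         (auto simp: M_def intro: continuous_on_subset[OF cont])
    moreover have "at x within {-M..M} = at x"
      by (rule at_within_interior) (auto simp: M_def)
    ultimately show ?thesis by simp
  qed
  have "((\<lambda>x. G (x + p) - G x) has_vector_derivative 0) (at x)" for x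
  proof -
    have "((G \<circ> (\<lambda>x. x + p)) has_vector_derivative (1 *\<^sub>R g (x + p))) (at x)"
      by (rule vector_diff_chain_at) (auto intro!: derivative_eq_intros dG)
    then have "((\<lambda>x. G (x + p)) has_vector_derivative g x) (at x)"
      by (simp add: o_def per)
    from has_vector_derivative_diff[OF this dG[of x]] show ?thesis by simp
  qed
  then obtain C where C: "\<And>x. G (x + p) - G x = C"
    using has_vector_derivative_zero_constant[of UNIV "\<lambda>x. G (x + p) - G x"] by auto
  have "G (a + p) - G a = G (0 + p) - G 0"
    unfolding C by (rule refl)
  moreover have "G a + (LBINT x=a..a + p. g x) = G (a + p)"
    unfolding G_def
  proof (rule interval_integral_sum)
    define m where "m = min 0 (min a (a + p))"
    define M where "M = max 0 (max a (a + p))"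
    have *: "min (0::ereal) (min (ereal a) (ereal (a + p))) = ereal m"
       "max (0::ereal) (max (ereal a) (ereal (a + p))) = ereal M"
      unfolding m_def M_def zero_ereal_def by (simp_all add: min_def max_def)
    show "interval_lebesgue_integrable lborel (min 0 (min (ereal a) (ereal (a + p))))
       (max 0 (max (ereal a) (ereal (a + p)))) g"
      unfolding * by (rule interval_integrable_continuous_on)
        (auto simp: m_def M_def intro: continuous_on_subset[OF cont])
  qed
  moreover have "G 0 = 0" "G p = (LBINT x=0..p. g x)"
    by (simp_all add: G_def flip: zero_ereal_def)
  ultimately show ?thesis by (simp add: algebra_simps)
qed

lemma interval_integral_shift_period:
  fixes g :: "real \<Rightarrow> complex" and t p :: real
  assumes cont: "continuous_on UNIV g"
  shows "(LBINT x=0..t + p. g x) = (LBINT x=0..t. g x) + (LBINT x=t..t + p. g x)"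
proof -
    define m where "m = min 0 (min t (t + p))"
    define M where "M = max 0 (max t (t + p))"
    have *: "min (0::ereal) (min (ereal t) (ereal (t + p))) = ereal m"
       "max (0::ereal) (max (ereal t) (ereal (t + p))) = ereal M"
      unfolding m_def M_def zero_ereal_def by (simp_all add: min_def max_def)
  show ?thesis
  proof (rule interval_integral_sum[symmetric])
    show "interval_lebesgue_integrable lborel (min 0 (min (ereal t) (ereal (t + p))))
       (max 0 (max (ereal t) (ereal (t + p)))) g"
      unfolding * by (rule interval_integrable_continuous_on)
        (auto simp: m_def M_def intro: continuous_on_subset[OF cont])
  qed
qed

lemma psdo_eq_one_turn:
  fixes L \<phi> :: "complex \<Rightarrow> complex" and z :: complex and s r r0 d t0 :: real and k :: nat
  assumes k: "k \<ge> 1" "s = 1 / real k" and r0: "r0 > 0" and d: "0 < d" "d < r"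
    and \<phi>: "\<phi> holomorphic_on ball 0 r"
    and F: "continuous_on (sphere 0 r0) (\<lambda>\<zeta>. L \<zeta> * Mittag_Leffler s (z * \<zeta>))"
    and I: "continuous_on UNIV (psdo_inner s r0 L z d)"
  shows "psdo s r0 d t0 L \<phi> z = psdo_turns s r0 d t0 1 L \<phi> z"
proof -
  define h where "h u = L (of_real r0 * cis (- u)) * Mittag_Leffler s (z * (of_real r0 * cis (- u)))
      * (- \<i> * of_real r0 * cis (- u))" for u :: real
  have cont_h: "continuous_on UNIV h"
  proof -
    have "continuous_on UNIV ((\<lambda>\<zeta>. L \<zeta> * Mittag_Leffler s (z * \<zeta>)) \<circ> (\<lambda>u::real. of_real r0 * cis (- u)))"
      using r0 by (intro continuous_on_compose continuous_intros continuous_on_subset[OF F])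
        (auto simp: norm_mult)
    moreover have "continuous_on UNIV (\<lambda>u. - \<i> * of_real r0 * cis (- u))"
      by (intro continuous_intros)
    ultimately show ?thesis unfolding h_def o_def by (rule continuous_on_mult)
  qed
  have per_h: "h (u + 2 * pi) = h u" for u
    by (simp add: h_def cis_conv_exp exp_add algebra_simps exp_diff exp_minus)
  define K where "K w u = psdo_kernel_int k (w * (of_real r0 * cis (- u)))" for w u
  define B where "B w = integral {0..2 * pi} (\<lambda>u. h u * K w u)" for w
  have kern: "psdo_kernel (1 / s) (d * r0) (t - u) = K (of_real d * cis t) u" for t u
    using k r0 d by (simp add: psdo_kernel_nat K_def cis_divide[symmetric] cis_inverse[symmetric]
        divide_inverse mult_ac flip: cis_inverse)
  have contK: "continuous_on UNIV (K w)" for w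
    unfolding K_def psdo_kernel_int_def by (intro continuous_intros)
  have perK: "K w (u + 2 * pi) = K w u" for w u
    by (simp add: K_def cis_conv_exp exp_add algebra_simps exp_diff exp_minus)
  have cont: "continuous_on UNIV (\<lambda>u. h u * K w u)" for w
    by (intro continuous_intros cont_h contK)
  define J where "J t = \<phi> (of_real d * cis t) * psdo_inner s r0 L z d t * (\<i> * of_real d * cis t)" for t
  have cis_per: "cis (t + 2 * pi) = cis t" for t
    by (simp add: cis_conv_exp exp_add algebra_simps)
  have cis_per': "cis (- t - 2 * pi) = cis (- t)" for t
    by (simp add: cis_conv_exp exp_add algebra_simps exp_diff)
  have inner: "psdo_inner s r0 L z d t = (LBINT u=0..t. h u * K (of_real d * cis t) u) +
      (LBINT a=r0..\<infinity>. L (of_real a * cis (- t)) * Mittag_Leffler s (z * (of_real a * cis (- t))) *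
         psdo_kernel (1 / s) (d * a) 0 * cis (- t))" for t
    unfolding psdo_inner_def Let_def kern h_def by (simp add: mult_ac)
  have step_inner: "psdo_inner s r0 L z d (t + 2 * pi) = psdo_inner s r0 L z d t + B (of_real d * cis t)" for t
  proof -
    have "(LBINT u=t..t + 2 * pi. h u * K (of_real d * cis t) u) =
       (LBINT u=0..2 * pi. h u * K (of_real d * cis t) u)"
      by (rule interval_integral_periodic[OF cont]) (simp add: per_h perK)
    also have "\<dots> = B (of_real d * cis t)"
      unfolding B_def zero_ereal_def
      by (rule interval_integral_eq_integral)
         (auto intro!: borel_integrable_atLeastAtMost' continuous_on_subset[OF cont])
    finally show ?thesis
      unfolding inner by (simp add: cis_per cis_per' interval_integral_shift_period[OF cont])
  qed
  have step_J: "J (t + 2 * pi) = J t + \<phi> (of_real d * cis t) * B (of_real d * cis t) * (\<i> * of_real d * cis t)" for t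
    unfolding J_def step_inner cis_per by (simp add: algebra_simps)
  have holB: "B holomorphic_on UNIV"
  proof -
    define K' where "K' w u = deriv (psdo_kernel_int k) (w * (of_real r0 * cis (- u))) * (of_real r0 * cis (- u))" for w and u :: real
    have nk: "psdo_kernel_int k holomorphic_on UNIV"
      unfolding psdo_kernel_int_def by (intro holomorphic_intros)
    have "(\<lambda>w. integral (cbox 0 (2 * pi)) (\<lambda>u. h u * K w u)) holomorphic_on UNIV"
    proof (rule leibniz_rule_holomorphic[where fx = "\<lambda>w u. h u * K' w u"])
      fix w :: complex and u :: real
      have "(psdo_kernel_int k has_field_derivative deriv (psdo_kernel_int k) x) (at x)" for x
        using nk by (auto intro: holomorphic_derivI)
      moreover have "((\<lambda>w. w * (of_real r0 * cis (- u))) has_field_derivative of_real r0 * cis (- u)) (at w)"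
        by (auto intro!: derivative_eq_intros)
      ultimately have "((\<lambda>w. K w u) has_field_derivative K' w u) (at w)"
        unfolding K_def K'_def by (rule DERIV_chain2)
      then show "((\<lambda>w. h u * K w u) has_field_derivative h u * K' w u) (at w within UNIV)"
        by (intro DERIV_cmult)
    next
      show "(\<lambda>u. h u * K w u) integrable_on cbox 0 (2 * pi)" for w
        by (auto intro!: integrable_continuous_interval continuous_on_subset[OF cont])
    next
      have "continuous_on UNIV (deriv (psdo_kernel_int k))"
        using nk by (intro holomorphic_on_imp_continuous_on holomorphic_deriv) auto
      note c1 = continuous_on_compose2[OF this _ subset_UNIV]
      note c2 = continuous_on_compose2[OF cont_h _ subset_UNIV]
      show "continuous_on (UNIV \<times> cbox 0 (2 * pi)) (\<lambda>(w, u). h u * K' w u)"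
        unfolding K'_def split_beta by (intro continuous_intros c1 c2)
    qed auto
    then show ?thesis unfolding B_def by simp
  qed
  have zero: "((\<lambda>t. \<phi> (of_real d * cis t) * B (of_real d * cis t) * (\<i> * of_real d * cis t)) has_integral 0)
      {a..a + 2 * pi}" for a
  proof -
    have "((\<lambda>w. \<phi> w * B w) has_contour_integral 0) (part_circlepath 0 d a (a + 2 * pi))"
    proof (rule Cauchy_theorem_convex_simple[of _ "ball 0 r"])
      show "(\<lambda>w. \<phi> w * B w) holomorphic_on ball 0 r"
        by (intro holomorphic_intros \<phi> holomorphic_on_subset[OF holB]) auto
      show "path_image (part_circlepath 0 d a (a + 2 * pi)) \<subseteq> ball 0 r"
        using path_image_part_circlepath_subset[of a "a + 2 * pi" d 0] d by auto
      show "pathfinish (part_circlepath 0 d a (a + 2 * pi)) = pathstart (part_circlepath 0 d a (a + 2 * pi))"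
        by (simp add: algebra_simps exp_add)
    qed auto
    then show ?thesis
      by (subst (asm) has_contour_integral_part_circlepath_iff) (simp_all add: mult_ac)
  qed
  have contJ: "continuous_on UNIV J"
  proof -
    have "continuous_on UNIV (\<phi> \<circ> (\<lambda>t. of_real d * cis t))"
      using d by (intro continuous_on_compose continuous_intros
          continuous_on_subset[OF holomorphic_on_imp_continuous_on[OF \<phi>]]) (auto simp: norm_mult)
    then show ?thesis unfolding J_def o_def by (intro continuous_intros I)
  qed
  have intJ: "J integrable_on {a..b}" for a b
    by (intro integrable_continuous_interval continuous_on_subset[OF contJ]) auto
  have turn: "integral {a + 2 * pi..a + 2 * pi + 2 * pi} J = integral {a..a + 2 * pi} J" for a
  proof -
    have "integral {a + 2 * pi..a + 2 * pi + 2 * pi} J = integral {a..a + 2 * pi} (\<lambda>t. J (t + 2 * pi))"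
      using integral_shift_real_ivl[where f = J and a = "a + 2 * pi" and b = "a + 2 * pi + 2 * pi" and c = "2 * pi"]
      by (simp add: add.commute)
    also have "\<dots> = integral {a..a + 2 * pi} J"
      unfolding step_J using integral_unique[OF has_integral_add[OF integrable_integral[OF intJ] zero]]
      by simp
    finally show ?thesis .
  qed
  have turn_n: "integral {t0 + 2 * pi * real n..t0 + 2 * pi * real n + 2 * pi} J = integral {t0..t0 + 2 * pi} J" for n
  proof (induction n)
    case (Suc n)
    show ?case using turn[of "t0 + 2 * pi * real n"] Suc by (simp add: algebra_simps)
  qed simp
  have turns: "integral {t0..t0 + 2 * pi * real n} J = of_nat n * integral {t0..t0 + 2 * pi} J" for n
  proof (induction n)
    case (Suc n)
    have e: "t0 + 2 * pi * real (Suc n) = t0 + 2 * pi * real n + 2 * pi"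
      by (simp add: algebra_simps)
    have "integral {t0..t0 + 2 * pi * real n} J +
        integral {t0 + 2 * pi * real n..t0 + 2 * pi * real n + 2 * pi} J =
        integral {t0..t0 + 2 * pi * real n + 2 * pi} J"
      by (rule Henstock_Kurzweil_Integration.integral_combine) (simp_all add: intJ)
    then have "integral {t0..t0 + 2 * pi * real (Suc n)} J =
        of_nat n * integral {t0..t0 + 2 * pi} J + integral {t0..t0 + 2 * pi} J"
      unfolding Suc turn_n e by (rule sym)
    then show ?case by (simp add: distrib_right)
  qed simp
  have PT: "psdo_turns s r0 d t0 n L \<phi> z = of_nat n * psdo_turns s r0 d t0 1 L \<phi> z" for n
  proof -
    have 1: "(LBINT t:{t0..t0 + 2 * pi * real n}. J t) = of_nat n * integral {t0..t0 + 2 * pi} J" for n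
    proof -
      have "set_integrable lborel {t0..t0 + 2 * pi * real n} J"
        by (rule borel_integrable_atLeastAtMost') (rule continuous_on_subset[OF contJ], simp)
      from set_borel_integral_eq_integral(2)[OF this] turns[of n] show ?thesis
        by (rule trans)
    qed
    show ?thesis
      unfolding psdo_turns_def J_def[symmetric] 1 by (simp only: of_nat_1 mult_1 mult.left_commute)
  qed
  have "eventually (\<lambda>n. psdo_turns s r0 d t0 n L \<phi> z / of_nat n = psdo_turns s r0 d t0 1 L \<phi> z) sequentially"
    using eventually_gt_at_top[of 0]
  proof eventually_elim
    case (elim n)
    then show ?case
      by (subst PT) (simp only: nonzero_mult_div_cancel_left of_nat_eq_0_iff neq0_conv simp_thms)
  qed
  then have "(\<lambda>n. psdo_turns s r0 d t0 n L \<phi> z / of_nat n) \<longlonglongrightarrow> psdo_turns s r0 d t0 1 L \<phi> z"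
    by (rule tendsto_eventually)
  then show ?thesis unfolding psdo_def by (rule limI)
qed

(* n! / (n + 1 - b)! = n (n - 1) ... (n - b + 2), which is 0 for n < b - 1. *)
definition fact_quot :: "nat \<Rightarrow> nat \<Rightarrow> complex" where
  "fact_quot n b = (\<Prod>i<b - 1. of_nat n - of_nat i)"

(* The coefficient of eps^N in q(eps, D) f for q = c * sum_n n!/(n+1-b)! lambda^n eps^n.
   Here c and lambda are given as functions G and L of omega = zeta^(1/kappa). *)
definition q_op_coeff ::
    "nat \<Rightarrow> real \<Rightarrow> real \<Rightarrow> real \<Rightarrow> real \<Rightarrow> (complex \<Rightarrow> complex) \<Rightarrow> (complex \<Rightarrow> complex) \<Rightarrow> nat \<Rightarrow>
     (nat \<Rightarrow> complex \<Rightarrow> complex) \<Rightarrow> nat \<Rightarrow> complex \<Rightarrow> complex" where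
  "q_op_coeff \<kappa> s r0 d t0 G L b f N w =
     (\<Sum>n\<le>N. fact_quot n b * psdo (s / real \<kappa>) r0 d t0 (\<lambda>\<omega>. G \<omega> * L \<omega> ^ n) (f (N - n)) w)"

definition difference_solution :: "complex poly poly \<Rightarrow> complex \<Rightarrow> (int \<Rightarrow> complex poly) \<Rightarrow> bool" where
  "difference_solution P P0 Q \<longleftrightarrow>
     Q 0 = [:1 / P0:] \<and>
     (\<forall>n\<in>{1 - int (degree P)..-1}. Q n = 0) \<and>
     (\<forall>n\<ge>1. (\<Sum>j\<le>degree P. coeff P j * Q (n - int j)) = 0)"

end

(* The operators attached to symbols are expanded into those attached to monomials.  For the symbol
   zeta^a acting on w^n the inner integral is, up to the factor w^(-1-a), the sum of a constant and
   the integral of an absolutely convergent sum of exponentials, and the mean over the turns keeps the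
   frequency 0 only.  For a >= 0 the result is Gamma(1 + n s) if a = n and 0 otherwise; for a < 0
   there can be a resonance whose contribution depends on the base point of the circle, but the mean
   exists and is bounded.  Hence the operators depend linearly on the symbol, coincide with the moment
   derivatives for polynomial symbols, and a symbol with a pole of order N at infinity costs a factor
   A B^N Gamma(1 + N s) in norm.

   The coefficients of the power series 1/P in xi are the polynomials q_n, and the formal solution is
   x_n = sum_k q_k(D) f_(n-k).  The partial fraction decomposition of 1/P in xi writes q_n as the sum
   of the c n!/(n+1-beta)! lambda^n, whose pole order is at most a constant plus n max(0, q). *)
theory Submission
  imports Defs "HOL-Real_Asymp.Real_Asymp" "Jordan_Normal_Form.Char_Poly"
begin

section \<open>Estimates for the Gamma function\<close>

text \<open>The operators on negative powers are never evaluated. Every operator is an absolutely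
  convergent triple series whose terms contain \<open>monomial_op\<close> at one fixed base point
  and are linear in the symbol. When the symbols \<open>c \<lambda>^n\<close> add up to the
  polynomial \<open>q_n\<close>, their negative powers cancel in the expansion at infinity, and so
  do the resonant contributions, whatever their values are. Two exchanges of limits shape the
  estimates. The mean over the turns passes through the series by Tannery's theorem, which needs
  bounds on the monomials that are uniform in the number of turns: off the diagonal they come from
  an integration by parts, on the diagonal from the absence of resonance. The series itself
  converges because Gamma(1 + x + y) is at most 2 * 4^(x + y) Gamma(1 + x) Gamma(1 + y); this crude
  inequality is the origin of the condition \<open>4 powr s * norm z < d\<close> and of the smaller
  disc in the conclusion. The given solution is identified through its Taylor coefficients at 0
  only, so the discs on which single moment derivatives converge do not matter.\<close>

lemma Gamma_set_integral:
  fixes x :: real assumes "x > -1"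
  shows "set_integrable lborel {0<..} (\<lambda>u. u powr x * exp (- u))"
    and "(LINT u:{0<..}|lborel. u powr x * exp (- u)) = Gamma (1 + x)"
proof -
  have "((\<lambda>u. u powr x * exp (- u)) has_integral Gamma (1 + x)) {0..}"
    using Gamma_integral_real[of "1 + x"] assms by (simp add: exp_minus divide_inverse)
  then have *: "((\<lambda>u. u powr x * exp (- u)) has_integral Gamma (1 + x)) {0<..}"
    by (subst (asm) has_integral_spike_set_eq[where T = "{0<..}"]) (rule negligible_subset[of "{0::real}"]; auto)+
  show i: "set_integrable lborel {0<..} (\<lambda>u. u powr x * exp (- u))"
  proof -
    have "(\<lambda>u. u powr x * exp (- u)) absolutely_integrable_on {0<..}"
      using * by (intro nonnegative_absolutely_integrable_1) auto
    then show ?thesis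
      unfolding set_integrable_def
      by (subst (asm) integrable_completion) auto
  qed
  show "(LINT u:{0<..}|lborel. u powr x * exp (- u)) = Gamma (1 + x)"
    using set_borel_integral_eq_integral(2)[OF i] * by (simp add: integral_unique)
qed

lemma Gamma_1_plus_pos: "x \<ge> 0 \<Longrightarrow> Gamma (1 + x :: real) > 0"
  by (rule Gamma_real_pos) simp

lemma exp_minus_set_integral:
  fixes c M :: real assumes "c > 0"
  shows "set_integrable lborel {M<..} (\<lambda>u. exp (- (c * u)))"
    and "(LINT u:{M<..}|lborel. exp (- (c * u))) = exp (- (c * M)) / c"
proof -
  have "((\<lambda>u. exp (- c * u)) has_integral exp (- c * M) / c) {M..}"
    by (rule has_integral_exp_minus_to_infinity) fact
  then have *: "((\<lambda>u. exp (- (c * u))) has_integral exp (- (c * M)) / c) {M<..}"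
    by (subst (asm) has_integral_spike_set_eq[where T = "{M<..}"]) ((rule negligible_subset[of "{M}"]; auto)+, simp)
  show i: "set_integrable lborel {M<..} (\<lambda>u. exp (- (c * u)))"
  proof -
    have "(\<lambda>u. exp (- (c * u))) absolutely_integrable_on {M<..}"
      using * by (intro nonnegative_absolutely_integrable_1) auto
    then show ?thesis
      unfolding set_integrable_def
      by (subst (asm) integrable_completion) auto
  qed
  show "(LINT u:{M<..}|lborel. exp (- (c * u))) = exp (- (c * M)) / c"
    using set_borel_integral_eq_integral(2)[OF i] * by (simp add: integral_unique)
qed

text \<open>For \<open>u > M\<close> the integrand of the Gamma integral dominates
  \<open>M powr x * exp (- u)\<close>, and this integrates over that half-line to the left-hand
  side.\<close>

lemma powr_exp_le_Gamma:
  fixes x M :: real assumes "x \<ge> 0" "M \<ge> 0"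
  shows "M powr x * exp (- M) \<le> Gamma (1 + x)"
proof -
  have "(LINT u:{M<..}|lborel. M powr x * exp (- (1 * u))) \<le> (LINT u:{0<..}|lborel. u powr x * exp (- u))"
    unfolding set_lebesgue_integral_def
  proof (rule integral_mono)
    show "integrable lborel (\<lambda>u. indicator {M<..} u *\<^sub>R (M powr x * exp (- (1 * u))))"
      using exp_minus_set_integral(1)[of 1 M] unfolding set_integrable_def by (simp add: mult.left_commute)
    show "integrable lborel (\<lambda>u. indicator {0<..} u *\<^sub>R (u powr x * exp (- u)))"
      using Gamma_set_integral(1)[of x] assms unfolding set_integrable_def by simp
  qed (use assms in \<open>auto simp: indicator_def intro: powr_mono2\<close>)
  then show ?thesis
    using Gamma_set_integral(2)[of x] assms exp_minus_set_integral(2)[of 1 M] by simp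
qed

lemma powr_exp_quarter_le:
  fixes x u :: real assumes "x \<ge> 0" "u \<ge> 0"
  shows "u powr x * exp (- (u / 4)) \<le> 4 powr x * Gamma (1 + x)"
proof -
  have "u powr x = 4 powr x * (u / 4) powr x" using assms by (simp add: powr_divide)
  moreover have "(u / 4) powr x * exp (- (u / 4)) \<le> Gamma (1 + x)"
    by (rule powr_exp_le_Gamma) (use assms in auto)
  ultimately show ?thesis by (simp add: mult.assoc)
qed

text \<open>The factor \<open>exp (- u)\<close> is split into two equal halves: one is spent on the
  pointwise bound, the other integrates to 2.\<close>

lemma Gamma_le_of_bound:
  fixes x C :: real assumes "x \<ge> 0" and b: "\<And>u. u > 0 \<Longrightarrow> u powr x * exp (- (u / 2)) \<le> C"
  shows "Gamma (1 + x) \<le> 2 * C"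
proof -
  have "(LINT u:{0<..}|lborel. u powr x * exp (- u)) \<le> (LINT u:{0<..}|lborel. C * exp (- (1/2 * u)))"
    unfolding set_lebesgue_integral_def
  proof (rule integral_mono)
    show "integrable lborel (\<lambda>u. indicator {0<..} u *\<^sub>R (u powr x * exp (- u)))"
      using Gamma_set_integral(1)[of x] assms unfolding set_integrable_def by simp
    show "integrable lborel (\<lambda>u. indicator {0<..} u *\<^sub>R (C * exp (- (1/2 * u))))"
      using exp_minus_set_integral(1)[of "1/2" 0] unfolding set_integrable_def by (simp add: mult.left_commute)
    fix u :: real
    have "u powr x * exp (- u) \<le> C * exp (- (1/2 * u))" if "u > 0"
    proof -
      have "exp (-u) = exp (-(u/2)) * exp (-(1/2 * u))" by (simp flip: exp_add)
      then show ?thesis using mult_right_mono[OF b[OF that], of "exp (-(1/2 * u))"] by (simp add: mult.assoc)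
    qed
    then show "indicator {0<..} u *\<^sub>R (u powr x * exp (- u)) \<le> indicator {0<..} u *\<^sub>R (C * exp (- (1/2 * u)))"
      by (auto simp: indicator_def)
  qed
  then show ?thesis
    using Gamma_set_integral(2)[of x] assms exp_minus_set_integral(2)[of "1/2" 0] by simp
qed

text \<open>The half of \<open>exp (- u)\<close> left by \<open>Gamma_le_of_bound\<close> is shared
  between the two powers, a quarter each. The factor \<open>4 powr (x + y)\<close> is the price and
  determines later how far discs shrink.\<close>

lemma Gamma_1_add_le:
  fixes x y :: real assumes "x \<ge> 0" "y \<ge> 0"
  shows "Gamma (1 + (x + y)) \<le> 2 * (4 powr (x + y) * Gamma (1 + x) * Gamma (1 + y))"
proof (rule Gamma_le_of_bound)
  fix u :: real assume "u > 0"
  have "u powr (x + y) * exp (- (u / 2)) = (u powr x * exp (- (u / 4))) * (u powr y * exp (- (u / 4)))"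
    by (simp add: powr_add mult_ac flip: exp_add)
  also have "\<dots> \<le> (4 powr x * Gamma (1 + x)) * (4 powr y * Gamma (1 + y))"
    using assms \<open>u > 0\<close> Gamma_1_plus_pos[of x] by (intro mult_mono powr_exp_quarter_le) auto
  finally show "u powr (x + y) * exp (- (u / 2)) \<le> 4 powr (x + y) * Gamma (1 + x) * Gamma (1 + y)"
    by (simp add: powr_add mult_ac)
qed (use assms in auto)

text \<open>Converts Gamma growth into the powers of factorials of the Gevrey norms. The maximum
  with 1 covers \<open>\<sigma> = 0\<close>, where \<open>0 powr 0\<close> is 0.\<close>

lemma Gamma_1_le_fact_powr:
  fixes \<sigma> :: real assumes "\<sigma> \<ge> 0"
  shows "Gamma (1 + \<sigma> * real n) \<le> 2 * max 1 ((2 * \<sigma>) powr \<sigma>) ^ n * fact n powr \<sigma>"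
proof (cases "\<sigma> = 0")
  case False
  with assms have s: "\<sigma> > 0" by simp
  have "Gamma (1 + \<sigma> * real n) \<le> 2 * (((2 * \<sigma>) powr \<sigma>) ^ n * fact n powr \<sigma>)"
  proof (rule Gamma_le_of_bound)
    fix u :: real assume u: "u > 0"
    \<comment> \<open>Scaled so that \<open>exp v powr \<sigma>\<close> is
      \<open>exp (u / 2)\<close>; the elementary bound \<open>v ^ n \<le> fact n * exp v\<close> is
      then raised to the power \<open>\<sigma>\<close>.\<close>
    define v where "v = u / (2 * \<sigma>)"
    have v: "v > 0" "u = 2 * \<sigma> * v" using u s by (auto simp: v_def)
    have "v ^ n \<le> fact n * exp v"
    proof -
      have "v ^ n /\<^sub>R fact n = (\<Sum>i\<in>{n}. v ^ i /\<^sub>R fact i)" by simp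
      also have "\<dots> \<le> exp v"
        unfolding exp_def using v by (intro sum_le_suminf summable_exp_generic) auto
      finally show ?thesis by (simp add: field_simps)
    qed
    then have "(v ^ n) powr \<sigma> \<le> (fact n * exp v) powr \<sigma>"
      using v s by (intro powr_mono2) auto
    also have "\<dots> = fact n powr \<sigma> * exp (u / 2)"
      using s v by (simp add: powr_mult exp_powr_real mult.commute)
    finally have *: "(v ^ n) powr \<sigma> \<le> fact n powr \<sigma> * exp (u / 2)" .
    have "u powr (\<sigma> * real n) = (2 * \<sigma>) powr (\<sigma> * real n) * v powr (\<sigma> * real n)"
      using v s by (simp add: powr_mult)
    also have "v powr (\<sigma> * real n) = (v ^ n) powr \<sigma>"
      using v by (simp add: powr_powr mult.commute flip: powr_realpow)
    also have "(2 * \<sigma>) powr (\<sigma> * real n) = ((2 * \<sigma>) powr \<sigma>) ^ n"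
      using s by (simp add: powr_powr flip: powr_realpow)
    finally have "u powr (\<sigma> * real n) * exp (-(u/2)) \<le> ((2 * \<sigma>) powr \<sigma>) ^ n * (fact n powr \<sigma> * exp (u / 2)) * exp (-(u/2))"
      by (simp only:) (intro mult_right_mono mult_left_mono *; simp)
    also have "\<dots> = ((2 * \<sigma>) powr \<sigma>) ^ n * fact n powr \<sigma>"
      by (simp add: mult.assoc flip: exp_add)
    finally show "u powr (\<sigma> * real n) * exp (-(u/2)) \<le> ((2 * \<sigma>) powr \<sigma>) ^ n * fact n powr \<sigma>" .
  qed (use s in auto)
  also have "\<dots> \<le> 2 * (max 1 ((2 * \<sigma>) powr \<sigma>) ^ n * fact n powr \<sigma>)"
    by (intro mult_left_mono mult_right_mono power_mono) auto
  finally show ?thesis by (simp add: mult.assoc)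
qed simp

lemma summable_power_div_Gamma:
  fixes s x :: real assumes "s > 0" "x \<ge> 0"
  shows "summable (\<lambda>m. x ^ m / Gamma (1 + real m * s))"
proof -
  \<comment> \<open>With \<open>M powr s = 2 * x + 1\<close> the lower bound
    \<open>powr_exp_le_Gamma\<close> makes the denominators grow faster than
    \<open>(2 * x) ^ m\<close>, which leaves a geometric majorant of ratio 1/2.\<close>
  define M where "M = (2 * x + 1) powr (1 / s)"
  have M: "M > 0" "M powr s = 2 * x + 1" using assms by (auto simp: M_def powr_powr)
  have "x ^ m / Gamma (1 + real m * s) \<le> exp M * (1/2) ^ m" for m
  proof -
    have "(2 * x + 1) ^ m * exp (- M) \<le> Gamma (1 + real m * s)"
      using powr_exp_le_Gamma[of "real m * s" M] assms M
      by (simp add: powr_powr[symmetric] mult.commute[of "real m"] powr_realpow)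
    moreover have "(2 * x) ^ m \<le> (2 * x + 1) ^ m" using assms by (intro power_mono) auto
    ultimately have "(2 * x) ^ m * exp (- M) \<le> Gamma (1 + real m * s)"
      by (meson exp_ge_zero mult_right_mono order_trans)
    then have "x ^ m \<le> exp M * (1/2) ^ m * Gamma (1 + real m * s)"
      by (simp add: exp_minus field_simps)
    then show ?thesis using Gamma_1_plus_pos[of "real m * s"] assms by (simp add: divide_le_eq)
  qed
  then have "norm (x ^ m / Gamma (1 + real m * s)) \<le> exp M * (1/2) ^ m" for m
    using assms Gamma_1_plus_pos[of "real m * s"] by simp
  moreover have "summable (\<lambda>m. exp M * (1/2) ^ m)"
    by (intro summable_mult summable_geometric) simp
  ultimately show ?thesis
    by - (rule summable_comparison_test'[where N = 0])
qed

text \<open>The substitution \<open>x = u powr s / d\<close>, that is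
  \<open>u = (d * x) powr k\<close>, produces the Gamma integral. The ray is taken down to 0 here;
  the part below \<open>\<rho>\<close> is accounted for in
  \<open>ray_moment_complement\<close>.\<close>

lemma ray_substitution:
  fixes s d :: real and a :: nat
  assumes "s > 0" "d > 0"
  defines "k \<equiv> 1 / s"
  shows "set_integrable lborel {0<..} (\<lambda>x. x ^ a * (k * (d * x) powr (k - 1) * exp (- ((d * x) powr k))))"
    and "(LINT x:{0<..}|lborel. x ^ a * (k * (d * x) powr (k - 1) * exp (- ((d * x) powr k)))) =
      Gamma (1 + real a * s) / d ^ Suc a"
proof -
  have k: "k > 0" "s * k = 1" "k * s = 1" "s \<noteq> 0" "d \<noteq> 0"
    using assms(1,2) by (auto simp: k_def)
  have as: "real a * s > -1"
  proof -
    have "0 \<le> real a * s" using assms(1) by simp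
    then show ?thesis by linarith
  qed
  define g where "g u = u powr s / d" for u
  define g' where "g' u = s * u powr (s - 1) / d" for u
  define f where "f x = x ^ a * (k * (d * x) powr (k - 1) * exp (- ((d * x) powr k)))" for x
  have e0: "einterval 0 \<infinity> = {0<..}" by (auto simp: einterval_def)
  have pos: "x > 0" if "0 < ereal x" for x :: real using that by simp
  have eq: "f (g u) * g' u = (1 / d ^ Suc a) * (u powr (real a * s) * exp (- u))" if "u > 0" for u
  proof -
    have 1: "d * g u = u powr s" using k by (simp add: g_def)
    have 2: "(u powr s) powr k = u" "(u powr s) powr (k - 1) = u powr (1 - s)"
      using that k by (simp_all add: powr_powr right_diff_distrib)
    have 3: "g u ^ a = u powr (real a * s) / d ^ a"
      using that by (simp add: g_def power_divide powr_powr mult.commute flip: powr_realpow)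
    have 4: "u powr (1 - s) * u powr (s - 1) = 1" using that by (simp flip: powr_add)
    have "f (g u) * g' u = g u ^ a * exp (- u) * (k * s) * (u powr (1 - s) * u powr (s - 1)) / d"
      unfolding f_def g'_def 1 2 by (simp add: mult_ac)
    then show ?thesis unfolding 4 k 3 by simp
  qed
  have "set_integrable lborel {0<..} (\<lambda>u. (1 / d ^ Suc a) * (u powr (real a * s) * exp (- u)))"
    by (intro set_integrable_mult_right impI Gamma_set_integral) (rule as)
  then have int: "set_integrable lborel (einterval 0 \<infinity>) (\<lambda>u. f (g u) * g' u)"
    unfolding e0 by (subst set_integrable_cong[OF refl refl eq]) auto
  have dg: "(g has_field_derivative g' x) (at x)" if "x > 0" for x
    unfolding g_def g'_def using that k by (auto intro!: derivative_eq_intros)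
  have gpos: "g x > 0" if "x > 0" for x using that assms by (simp add: g_def)
  have cf: "isCont f (g x)" "0 \<le> f (g x)" if "x > 0" for x
    unfolding f_def using assms k gpos[OF that] by (auto intro!: continuous_intros)
  have cg': "isCont g' x" if "x > 0" for x
    unfolding g'_def using that k by (auto intro!: continuous_intros)
  have g'0: "0 \<le> g' x" for x using assms by (simp add: g'_def)
  have lim0: "((ereal \<circ> g \<circ> real_of_ereal) \<longlongrightarrow> 0) (at_right 0)"
  proof -
    have "(g \<longlongrightarrow> 0) (at_right 0)"
      unfolding g_def using k assms by real_asymp
    then show ?thesis by (simp add: zero_ereal_def ereal_tendsto_simps o_assoc[symmetric])
  qed
  have limi: "((ereal \<circ> g \<circ> real_of_ereal) \<longlongrightarrow> \<infinity>) (at_left \<infinity>)"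
  proof -
    have "filterlim g at_top at_top"
      unfolding g_def using assms by real_asymp
    then show ?thesis by (simp add: ereal_tendsto_simps)
  qed
  note S = interval_integral_substitution_nonneg[where g = g and g' = g' and a = 0 and b = \<infinity> and f = f,
      OF _ dg[OF pos] cf(1)[OF pos] cg'[OF pos] cf(2)[OF pos] g'0 lim0 limi int, simplified]
  show "set_integrable lborel {0<..} (\<lambda>x. x ^ a * (k * (d * x) powr (k - 1) * exp (- ((d * x) powr k))))"
    using S(1) unfolding e0 f_def .
  have "(LINT x:{0<..}|lborel. f x) = (LINT u:{0<..}|lborel. f (g u) * g' u)"
    using S(2) by (simp add: interval_lebesgue_integral_0_infty)
  also have "\<dots> = (LINT u:{0<..}|lborel. (1 / d ^ Suc a) * (u powr (real a * s) * exp (- u)))"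
    by (rule set_lebesgue_integral_cong) (use eq in auto)
  also have "\<dots> = Gamma (1 + real a * s) / d ^ Suc a"
    using Gamma_set_integral(2)[OF as] by (subst set_integral_mult_right) simp
  finally show "(LINT x:{0<..}|lborel. x ^ a * (k * (d * x) powr (k - 1) * exp (- ((d * x) powr k)))) =
      Gamma (1 + real a * s) / d ^ Suc a" unfolding f_def .
qed

section \<open>Averages over many turns\<close>

lemma set_integral_suminf:
  fixes f :: "nat \<Rightarrow> real \<Rightarrow> complex"
  assumes ab: "a \<le> b" and cont: "\<And>p. continuous_on {a..b} (f p)"
    and bound: "\<And>p t. t \<in> {a..b} \<Longrightarrow> norm (f p t) \<le> M p" and M: "summable M"
  shows "set_integrable lborel {a..b} (\<lambda>t. \<Sum>p. f p t)"
    and "(\<lambda>p. LINT t:{a..b}|lborel. f p t) sums (LINT t:{a..b}|lborel. (\<Sum>p. f p t))"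
proof -
  define g where "g p t = indicator {a..b} t *\<^sub>R f p t" for p t
  have gi: "integrable lborel (g p)" for p
    using borel_integrable_atLeastAtMost'[OF cont, of p] unfolding set_integrable_def g_def .
  have gb: "norm (g p t) \<le> M p * indicator {a..b} t" for p t
    using bound[of t p] by (auto simp: g_def indicator_def)
  have sM: "summable (\<lambda>p. norm (g p t))" for t
    by (rule summable_comparison_test'[OF summable_mult2[OF M, of "indicator {a..b} t"], of 0]) (use gb in simp)
  have I: "(\<integral>t. norm (g p t) \<partial>lborel) \<le> M p * \<bar>b - a\<bar>" for p
  proof -
    have "(\<integral>t. norm (g p t) \<partial>lborel) \<le> (\<integral>t. M p * indicator {a..b} t \<partial>lborel)"

    proof (rule integral_mono)
      show "integrable lborel (\<lambda>t. M p * indicator {a..b} t)"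
        by (intro integrable_mult_right impI integrable_real_indicator) (auto simp: emeasure_lborel_Icc_eq)
    qed (use gi gb in auto)
    also have "\<dots> \<le> M p * \<bar>b - a\<bar>" using ab by simp
    finally show ?thesis .
  qed
  have sI: "summable (\<lambda>p. \<integral>t. norm (g p t) \<partial>lborel)"
    by (rule summable_comparison_test'[OF summable_mult2[OF M, of "\<bar>b - a\<bar>"], of 0])
      (use I in \<open>simp add: integral_nonneg_AE\<close>)
  have eq: "(\<Sum>p. g p t) = indicator {a..b} t *\<^sub>R (\<Sum>p. f p t)" for t
    by (auto simp: g_def indicator_def)
  show "set_integrable lborel {a..b} (\<lambda>t. \<Sum>p. f p t)"
    unfolding set_integrable_def eq[symmetric] by (rule integrable_suminf) (use gi sM sI in auto)
  show "(\<lambda>p. LINT t:{a..b}|lborel. f p t) sums (LINT t:{a..b}|lborel. (\<Sum>p. f p t))"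
    using sums_integral[of lborel g] gi sM sI
    unfolding eq set_lebesgue_integral_def g_def[symmetric, abs_def] by blast
qed

lemma interval_integral_sums:
  fixes f :: "nat \<Rightarrow> real \<Rightarrow> complex" and a b :: real
  assumes cont: "\<And>p. continuous_on UNIV (f p)"
    and bound: "\<And>p t. norm (f p t) \<le> M p" and M: "summable M"
  shows "(\<lambda>p. LBINT t=a..b. f p t) sums (LBINT t=a..b. (\<Sum>p. f p t))"
proof -
  have *: "(\<lambda>p. LBINT t=x..y. f p t) sums (LBINT t=x..y. (\<Sum>p. f p t))" if "x \<le> y" for x y :: real
    using set_integral_suminf(2)[of x y f M] that assms
    by (simp add: interval_integral_Icc continuous_on_subset[OF cont])
  show ?thesis
  proof (cases "a \<le> b")
    case False
    then show ?thesis
      using sums_minus[OF *[of b a]] by (subst (1 2) interval_integral_endpoints_reverse) simp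
  qed (rule *)
qed

lemma turns_integral_cis:
  fixes t0 \<nu> :: real
  assumes "\<nu> \<noteq> 0" "a \<le> b"
  shows "(LINT t:{a..b}|lborel. cis (\<nu> * t)) = (cis (\<nu> * b) - cis (\<nu> * a)) / (\<i> * \<nu>)"
proof -
  have d: "((\<lambda>t. cis (\<nu> * t) / (\<i> * \<nu>)) has_vector_derivative cis (\<nu> * t)) (at t within A)" for t A
    unfolding cis_conv_exp using assms
    by (auto intro!: derivative_eq_intros has_vector_derivative_real_field simp: field_simps)
  have "(LBINT t=a..b. cis (\<nu> * t)) = cis (\<nu> * b) / (\<i> * \<nu>) - cis (\<nu> * a) / (\<i> * \<nu>)"
    by (rule interval_integral_FTC_finite[OF _ d]) (intro continuous_intros)
  then show ?thesis using assms by (simp add: interval_integral_Icc diff_divide_distrib)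
qed

lemma set_integral_const_Icc:
  fixes c :: "'a::{banach, second_countable_topology}"
  shows "a \<le> b \<Longrightarrow> (LINT t:{a..b}|lborel. c) = (b - a) *\<^sub>R c"
  by (subst set_integral_const) (auto simp: emeasure_lborel_Icc_eq)

lemma norm_set_integral_le:
  fixes f :: "real \<Rightarrow> complex"
  assumes "a \<le> b" "set_integrable lborel {a..b} f" "\<And>t. t \<in> {a..b} \<Longrightarrow> norm (f t) \<le> M"
  shows "norm (LINT t:{a..b}|lborel. f t) \<le> M * (b - a)"
proof -
  have "norm (LINT t:{a..b}|lborel. f t) \<le> (LINT t:{a..b}|lborel. norm (f t))"
    using set_integral_norm_bound[OF assms(2)] by simp
  also have "\<dots> \<le> (LINT t:{a..b}|lborel. M)"
    by (rule set_integral_mono) (use assms in \<open>auto intro: set_integrable_norm borel_integrable_atLeastAtMost'\<close>)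
  also have "\<dots> = M * (b - a)" using assms by (simp add: set_integral_const_Icc)
  finally show ?thesis .
qed

text \<open>An exponential of nonzero frequency has a bounded primitive, so its mean tends to
  0.\<close>

lemma avg_cis:
  fixes t0 \<nu> :: real
  shows "(\<lambda>N. (LINT t:{t0..t0 + 2 * pi * real N}|lborel. cis (\<nu> * t)) / of_nat N)
    \<longlonglongrightarrow> (if \<nu> = 0 then 2 * pi else 0)"
proof (cases "\<nu> = 0")
  case True
  have "(\<lambda>N. (LINT t:{t0..t0 + 2 * pi * real N}|lborel. cis (\<nu> * t)) / of_nat N) \<longlonglongrightarrow> 2 * pi"
  proof (rule tendsto_eventually)
    show "\<forall>\<^sub>F N in sequentially. (LINT t:{t0..t0 + 2 * pi * real N}|lborel. cis (\<nu> * t)) / of_nat N = 2 * pi"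
      using eventually_gt_at_top[of 0] by eventually_elim (simp add: True scaleR_conv_of_real set_integral_const_Icc)
  qed
  then show ?thesis using True by simp
next
  case False
  have "(\<lambda>N. (LINT t:{t0..t0 + 2 * pi * real N}|lborel. cis (\<nu> * t)) / of_nat N) \<longlonglongrightarrow> 0"
  proof (rule Lim_null_comparison)
    have "norm ((LINT t:{t0..t0 + 2 * pi * real N}|lborel. cis (\<nu> * t)) / of_nat N) \<le> (2 / \<bar>\<nu>\<bar>) / real N" for N
    proof -
      have "norm (LINT t:{t0..t0 + 2 * pi * real N}|lborel. cis (\<nu> * t)) \<le> 2 / \<bar>\<nu>\<bar>"
        using False norm_triangle_ineq4[of "cis (\<nu> * (t0 + 2 * pi * real N))" "cis (\<nu> * t0)"]
        by (subst turns_integral_cis) (auto simp: norm_divide norm_mult intro!: divide_right_mono)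
      then show ?thesis unfolding norm_divide norm_of_nat by (rule divide_right_mono) simp
    qed
    then show "\<forall>\<^sub>F N in sequentially. norm ((LINT t:{t0..t0 + 2 * pi * real N}|lborel. cis (\<nu> * t)) / of_nat N)
        \<le> (2 / \<bar>\<nu>\<bar>) / real N" by simp
    show "(\<lambda>N. (2 / \<bar>\<nu>\<bar>) / real N) \<longlonglongrightarrow> 0" by (rule lim_const_over_n)
  qed
  then show ?thesis using False by simp
qed

text \<open>The mean of every exponential is at most \<open>2 * pi\<close> in norm for all
  \<open>N\<close>; Tannery's theorem therefore takes the limit termwise, also where the frequencies
  accumulate at 0.\<close>

lemma quasi_periodic_avg:
  fixes b :: "nat \<Rightarrow> complex" and \<nu> :: "nat \<Rightarrow> real" and t0 :: real
  assumes b: "summable (\<lambda>i. norm (b i))"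
  shows "(\<lambda>N. (LINT t:{t0..t0 + 2 * pi * real N}|lborel. (\<Sum>i. b i * cis (\<nu> i * t))) / of_nat N)
    \<longlonglongrightarrow> (\<Sum>i. b i * (if \<nu> i = 0 then 2 * pi else 0))"
proof -
  define a where "a i N = b i * ((LINT t:{t0..t0 + 2 * pi * real N}|lborel. cis (\<nu> i * t)) / of_nat N)" for i N
  have si: "set_integrable lborel {t0..t0 + 2 * pi * real N} (\<lambda>t. cis (\<nu> i * t))" for i N
    by (intro borel_integrable_atLeastAtMost' continuous_intros)
  have nb: "norm (a i N) \<le> norm (b i) * (2 * pi)" for i N
  proof -
    have "norm (LINT t:{t0..t0 + 2 * pi * real N}|lborel. cis (\<nu> i * t)) \<le> 1 * (t0 + 2 * pi * real N - t0)"
      by (rule norm_set_integral_le[OF _ si]) auto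
    then have "norm ((LINT t:{t0..t0 + 2 * pi * real N}|lborel. cis (\<nu> i * t)) / of_nat N) \<le> 2 * pi"
      by (cases "N = 0") (auto simp: norm_divide field_simps)
    then show ?thesis unfolding a_def norm_mult by (intro mult_left_mono) auto
  qed
  have lim: "((\<lambda>N. a i N) \<longlongrightarrow> b i * complex_of_real (if \<nu> i = 0 then 2 * pi else 0)) sequentially" for i
    unfolding a_def by (intro tendsto_mult_left avg_cis)
  have "((\<lambda>N. suminf (\<lambda>i. a i N)) \<longlongrightarrow> (\<Sum>i. b i * complex_of_real (if \<nu> i = 0 then 2 * pi else 0))) sequentially"
    using tannerys_theorem[of a, OF lim, of "\<lambda>i. norm (b i) * (2 * pi)", OF always_eventually] nb
      summable_mult2[OF b, of "2 * pi"] by auto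
  moreover have "suminf (\<lambda>i. a i N) = (LINT t:{t0..t0 + 2 * pi * real N}|lborel. (\<Sum>i. b i * cis (\<nu> i * t))) / of_nat N" for N
  proof -
    have "(\<lambda>i. LINT t:{t0..t0 + 2 * pi * real N}|lborel. b i * cis (\<nu> i * t)) sums
       (LINT t:{t0..t0 + 2 * pi * real N}|lborel. (\<Sum>i. b i * cis (\<nu> i * t)))"
      by (rule set_integral_suminf(2)[OF _ _ _, where M = "\<lambda>i. norm (b i)"])
        (use b in \<open>auto intro!: continuous_intros simp: norm_mult\<close>)
    then have "(\<lambda>i. b i * (LINT t:{t0..t0 + 2 * pi * real N}|lborel. cis (\<nu> i * t))) sums
       (LINT t:{t0..t0 + 2 * pi * real N}|lborel. (\<Sum>i. b i * cis (\<nu> i * t)))" by simp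
    from sums_divide[OF this, of "of_nat N"] show ?thesis
      unfolding a_def by (simp add: sums_iff)
  qed
  ultimately show ?thesis by simp
qed

lemma continuous_antiderivative:
  fixes g :: "real \<Rightarrow> complex"
  assumes "continuous_on UNIV g"
  shows "((\<lambda>u. LBINT v=0..u. g v) has_vector_derivative g x) (at x within A)"
proof -
  define M where "M = \<bar>x\<bar> + 1"
  have "((\<lambda>u. LBINT v=0..u. g v) has_vector_derivative g x) (at x within {-M..M})"
    unfolding zero_ereal_def
    by (rule interval_integral_FTC2[of "-M" 0 M])
       (auto simp: M_def intro: continuous_on_subset[OF assms])
  moreover have "at x within {-M..M} = at x"
    by (rule at_within_interior) (auto simp: M_def)
  ultimately show ?thesis by (metis has_vector_derivative_at_within)
qed

section \<open>The operators on monomials\<close>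

text \<open>The kernel on the ray, where \<open>\<zeta> w\<close> is positive and the kernel is
  real.\<close>

definition ray_weight :: "real \<Rightarrow> real \<Rightarrow> real \<Rightarrow> real" where
  "ray_weight s d x = 1 / s * (d * x) powr (1 / s - 1) * exp (- ((d * x) powr (1 / s)))"

definition ray_moment :: "real \<Rightarrow> real \<Rightarrow> real \<Rightarrow> int \<Rightarrow> real" where
  "ray_moment s \<rho> d a = (LINT x:{\<rho><..}|lborel. x powi a * ray_weight s d x)"

definition kernel_coeff :: "real \<Rightarrow> real \<Rightarrow> nat \<Rightarrow> real" where
  "kernel_coeff s c i = 1 / s * c powr (1 / s - 1) * ((- (c powr (1 / s))) ^ i / fact i)"

text \<open>The sum of the norms of the \<open>kernel_coeff s c i\<close>, hence a bound for the
  kernel at every angle.\<close>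

definition kernel_bound :: "real \<Rightarrow> real \<Rightarrow> real" where
  "kernel_bound s c = 1 / s * c powr (1 / s - 1) * exp (c powr (1 / s))"

text \<open>On the arc \<open>\<zeta>^a d\<zeta>\<close> contributes the phase
  \<open>cis (- (a + 1) * u)\<close>. With \<open>v = t - u\<close> it splits into a factor
  depending on \<open>t\<close> alone and the phase written here.\<close>

definition rotated_kernel :: "real \<Rightarrow> real \<Rightarrow> int \<Rightarrow> real \<Rightarrow> complex" where
  "rotated_kernel s c a v = cis ((of_int a + 1) * v) * psdo_kernel (1 / s) c v"

text \<open>The rotated kernel is the sum of the exponentials with these frequencies and the coefficients
  \<^const>\<open>kernel_coeff\<close>; frequency 0 is the resonance and occurs for negative $a$ only.\<close>

definition kernel_freq :: "real \<Rightarrow> int \<Rightarrow> nat \<Rightarrow> real" where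
  "kernel_freq s a i = of_int a + (real i + 1) / s"

definition rotated_kernel_int :: "real \<Rightarrow> real \<Rightarrow> int \<Rightarrow> real \<Rightarrow> complex" where
  "rotated_kernel_int s c a t = (LBINT v=0..t. rotated_kernel s c a v)"

text \<open>At \<open>z = 0\<close> the factor \<open>Mittag_Leffler\<close> is 1. Other
  \<open>z\<close> are recovered by expanding that factor, since its powers of
  \<open>\<zeta>\<close> merge with those of the symbol.\<close>

definition monomial_op :: "real \<Rightarrow> real \<Rightarrow> real \<Rightarrow> real \<Rightarrow> int \<Rightarrow> nat \<Rightarrow> complex" where
  "monomial_op s \<rho> d t0 a n = psdo s \<rho> d t0 (\<lambda>\<zeta>. \<zeta> powi a) (\<lambda>w. w ^ n) 0"

lemma Mittag_Leffler_0 [simp]: "Mittag_Leffler s 0 = 1"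
proof -
  have "(\<lambda>n. 0 ^ n / of_real (Gamma (1 + real n * s)) :: complex) = (\<lambda>n. if n = 0 then 1 else 0)"
    by auto
  then show ?thesis unfolding Mittag_Leffler_def by (simp add: sums_unique[OF sums_single, symmetric])
qed

lemma ray_weight_nonneg: "s > 0 \<Longrightarrow> ray_weight s d x \<ge> 0"
  by (simp add: ray_weight_def)

section \<open>The exponential series of the kernel\<close>

lemma psdo_kernel_0: "psdo_kernel (1 / s) (d * x) 0 = of_real (ray_weight s d x)"
  by (simp add: psdo_kernel_def ray_weight_def exp_of_real flip: of_real_minus)

lemma continuous_psdo_kernel: "continuous_on A (psdo_kernel k c)"
  unfolding psdo_kernel_def[abs_def] by (intro continuous_intros)

lemma norm_psdo_kernel_le: "s > 0 \<Longrightarrow> norm (psdo_kernel (1 / s) c t) \<le> kernel_bound s c"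
proof -
  assume "s > 0"
  have "norm (exp (- of_real (c powr (1/s)) * cis (1/s * t))) \<le> exp (norm (- of_real (c powr (1/s)) * cis (1/s * t)))"
    by (rule norm_exp)
  then show ?thesis
    using \<open>s > 0\<close> unfolding psdo_kernel_def kernel_bound_def norm_mult norm_of_real norm_cis
    by (simp add: norm_mult norm_divide mult_left_mono divide_right_mono)
qed

lemma continuous_rotated_kernel: "continuous_on A (rotated_kernel s c a)"
  unfolding rotated_kernel_def[abs_def] by (intro continuous_intros continuous_psdo_kernel)

lemma norm_rotated_kernel_le: "s > 0 \<Longrightarrow> norm (rotated_kernel s c a t) \<le> kernel_bound s c"
  using norm_psdo_kernel_le[of s c t] by (simp add: rotated_kernel_def norm_mult)

lemma summable_kernel_coeff: "summable (\<lambda>i. norm (kernel_coeff s c i))"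
proof -
  have "summable (\<lambda>i. norm (1 / s * c powr (1 / s - 1)) * norm ((- (c powr (1 / s))) ^ i / fact i))"
    using summable_norm_exp[of "- (c powr (1 / s))"]
    by (intro summable_mult) (simp add: divide_inverse mult.commute)
  then show ?thesis by (simp add: kernel_coeff_def abs_mult power_abs)
qed

lemma suminf_norm_kernel_coeff: "s > 0 \<Longrightarrow> (\<Sum>i. norm (kernel_coeff s c i)) = kernel_bound s c"
proof -
  assume s: "s > 0"
  have "(\<lambda>i. 1 / s * c powr (1 / s - 1) * ((c powr (1 / s)) ^ i /\<^sub>R fact i)) sums
      (1 / s * c powr (1 / s - 1) * exp (c powr (1 / s)))"
    by (intro sums_mult exp_converges)
  moreover have "norm (kernel_coeff s c i) = 1 / s * c powr (1 / s - 1) * ((c powr (1 / s)) ^ i /\<^sub>R fact i)" for i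
    using s by (simp add: kernel_coeff_def abs_mult power_abs divide_inverse mult_ac)
  ultimately show ?thesis by (simp add: sums_iff kernel_bound_def)
qed

text \<open>The series of \<open>exp\<close> with its powers rewritten by de Moivre; with
  \<open>k = 1 / s\<close> the phases add up to \<open>(a + 1) + (k - 1) + i * k\<close>, which is
  \<open>kernel_freq\<close>.\<close>

lemma rotated_kernel_sums:
  "(\<lambda>i. kernel_coeff s c i * cis (kernel_freq s a i * v)) sums rotated_kernel s c a v"
proof -
  define k where "k = 1 / s"
  define z where "z = - of_real (c powr k) * cis (k * v)"
  have "(\<lambda>i. (cis ((of_int a + 1) * v) * (of_real (k * c powr (k - 1)) * cis ((k - 1) * v))) * (z ^ i /\<^sub>R fact i)) sums
     ((cis ((of_int a + 1) * v) * (of_real (k * c powr (k - 1)) * cis ((k - 1) * v))) * exp z)"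
    by (intro sums_mult exp_converges)
  moreover have "(cis ((of_int a + 1) * v) * (of_real (k * c powr (k - 1)) * cis ((k - 1) * v))) * exp z = rotated_kernel s c a v"
    by (simp add: rotated_kernel_def psdo_kernel_def z_def k_def)
  moreover have "(cis ((of_int a + 1) * v) * (of_real (k * c powr (k - 1)) * cis ((k - 1) * v))) * (z ^ i /\<^sub>R fact i) =
     kernel_coeff s c i * cis (kernel_freq s a i * v)" for i
  proof -
    have "z ^ i = (- of_real (c powr k)) ^ i * cis (real i * (k * v))"
      unfolding z_def power_mult_distrib Complex.DeMoivre ..
    moreover have "kernel_freq s a i * v = ((of_int a + 1) * v + (k - 1) * v) + real i * (k * v)"
      by (simp add: kernel_freq_def k_def algebra_simps add_divide_distrib)
    then have "cis (kernel_freq s a i * v) = cis ((of_int a + 1) * v) * cis ((k - 1) * v) * cis (real i * (k * v))"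
      by (simp only: cis_mult)
    ultimately show ?thesis
      by (simp add: kernel_coeff_def k_def scaleR_conv_of_real divide_inverse mult_ac)
  qed
  ultimately show ?thesis by simp
qed

lemma rotated_kernel_int_deriv:
  "(rotated_kernel_int s c a has_vector_derivative rotated_kernel s c a t) (at t within A)"
  unfolding rotated_kernel_int_def[abs_def]
  by (rule continuous_antiderivative[OF continuous_rotated_kernel])

text \<open>Termwise integration. The hypothesis excludes a resonant term, which would integrate to
  a multiple of \<open>t\<close>.\<close>

lemma rotated_kernel_int_sums:
  assumes fr: "\<And>i. kernel_freq s a i \<noteq> 0"
  shows "(\<lambda>i. kernel_coeff s c i * ((cis (kernel_freq s a i * t) - 1) / (\<i> * kernel_freq s a i)))
    sums rotated_kernel_int s c a t"
proof -
  have "(\<lambda>i. LBINT v=0..t. kernel_coeff s c i * cis (kernel_freq s a i * v)) sums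
      (LBINT v=0..t. (\<Sum>i. kernel_coeff s c i * cis (kernel_freq s a i * v)))"
    unfolding zero_ereal_def
    by (rule interval_integral_sums[OF _ _ summable_kernel_coeff[of s c]])
      (auto intro!: continuous_intros simp: norm_mult)
  moreover have "(LBINT v=0..t. kernel_coeff s c i * cis (kernel_freq s a i * v)) =
      kernel_coeff s c i * ((cis (kernel_freq s a i * t) - 1) / (\<i> * kernel_freq s a i))" for i
  proof -
    let ?\<nu> = "kernel_freq s a i"
    have d: "((\<lambda>t. cis (?\<nu> * t) / (\<i> * ?\<nu>)) has_vector_derivative cis (?\<nu> * t)) (at t within A)" for t A
      unfolding cis_conv_exp using fr[of i]
      by (auto intro!: derivative_eq_intros has_vector_derivative_real_field simp: field_simps)
    have "(LBINT v=ereal 0..t. cis (?\<nu> * v)) = cis (?\<nu> * t) / (\<i> * ?\<nu>) - cis (?\<nu> * 0) / (\<i> * ?\<nu>)"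
      by (rule interval_integral_FTC_finite[OF _ d]) (intro continuous_intros)
    then show ?thesis by (simp add: zero_ereal_def diff_divide_distrib)
  qed
  ultimately show ?thesis
    using rotated_kernel_sums[of s c a] by (simp add: sums_iff rotated_kernel_int_def)
qed

lemma powr_set_integral:
  fixes a c :: real assumes "a > -1" "c \<ge> 0"
  shows "set_integrable lborel {0..c} (\<lambda>x. x powr a)"
    and "(LINT x:{0..c}|lborel. x powr a) = c powr (a + 1) / (a + 1)"
proof -
  have *: "((\<lambda>x. x powr a) has_integral c powr (a + 1) / (a + 1)) {0..c}"
    by (rule has_integral_powr_from_0[OF assms])
  show i: "set_integrable lborel {0..c} (\<lambda>x. x powr a)"
  proof -
    have "(\<lambda>x. x powr a) absolutely_integrable_on {0..c}"
      using * by (intro nonnegative_absolutely_integrable_1) auto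
    then show ?thesis
      unfolding set_integrable_def by (subst (asm) integrable_completion) auto
  qed
  show "(LINT x:{0..c}|lborel. x powr a) = c powr (a + 1) / (a + 1)"
    using set_borel_integral_eq_integral(2)[OF i] * by (simp add: integral_unique)
qed

context
  fixes s \<rho> d :: real
  assumes s: "s > 0" and \<rho>: "\<rho> > 0" and d: "d > 0"
begin

lemma ray_power_integrable: "set_integrable lborel {\<rho><..} (\<lambda>x. x ^ n * ray_weight s d x)"
  by (rule set_integrable_subset[OF ray_substitution(1)[OF s d, of n, folded ray_weight_def]])
    (use \<rho> in auto)

text \<open>Beyond \<open>\<rho>\<close> a negative power is at most its value at
  \<open>\<rho>\<close>. This reduces integer exponents to natural ones, for which the Gamma
  integral is available.\<close>

lemma powi_diff_le: "x > \<rho> \<Longrightarrow> x powi (int n - int i) \<le> \<rho> powi (- int i) * x ^ n"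
proof -
  assume x: "x > \<rho>"
  have "x powi (int n - int i) = x ^ n * inverse x ^ i"
    using x \<rho> by (simp add: power_int_diff divide_inverse power_inverse)
  also have "\<dots> \<le> x ^ n * inverse \<rho> ^ i"
    using x \<rho> by (intro mult_left_mono power_mono) auto
  finally show ?thesis by (simp add: power_int_minus power_inverse mult.commute)
qed

lemma ray_integrable: "set_integrable lborel {\<rho><..} (\<lambda>x. x powi a * ray_weight s d x)"
proof -
  obtain n i where a: "a = int n - int i" by (metis int_diff_cases)
  have m: "set_borel_measurable lborel {\<rho><..} (\<lambda>x. x powi a * ray_weight s d x)"
    unfolding set_borel_measurable_def power_int_def ray_weight_def by measurable
  have i: "set_integrable lborel {\<rho><..} (\<lambda>x. \<rho> powi (- int i) * (x ^ n * ray_weight s d x))"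
    by (intro set_integrable_mult_right ray_power_integrable)
  show ?thesis
    by (rule set_integrable_bound[OF i m])
      (use \<rho> powi_diff_le[of _ n i] ray_weight_nonneg[OF s] in
        \<open>auto intro!: AE_I2 mult_right_mono simp: abs_mult a power_int_abs simp flip: mult.assoc\<close>)
qed

lemma ray_moment_nonneg: "ray_moment s \<rho> d a \<ge> 0"
  unfolding ray_moment_def set_lebesgue_integral_def
  by (rule integral_nonneg_AE) (use \<rho> ray_weight_nonneg[OF s] in \<open>auto simp: indicator_def\<close>)

text \<open>After the negative power has been estimated at \<open>\<rho>\<close>, the integral is
  enlarged to the whole half-line, where it is an exact Gamma value.\<close>

lemma ray_moment_le:
  "ray_moment s \<rho> d (int n - int i) \<le> \<rho> powi (- int i) * (Gamma (1 + real n * s) / d ^ Suc n)"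
proof -
  have "ray_moment s \<rho> d (int n - int i) \<le> (LINT x:{\<rho><..}|lborel. \<rho> powi (- int i) * (x ^ n * ray_weight s d x))"
    unfolding ray_moment_def
    by (intro set_integral_mono ray_integrable set_integrable_mult_right ray_power_integrable)
     (use powi_diff_le[of _ n i] ray_weight_nonneg[OF s] in \<open>auto simp flip: mult.assoc intro!: mult_right_mono\<close>)
  also have "\<dots> = \<rho> powi (- int i) * (LINT x:{\<rho><..}|lborel. x ^ n * ray_weight s d x)" by simp
  also have "\<dots> \<le> \<rho> powi (- int i) * (LINT x:{0<..}|lborel. x ^ n * ray_weight s d x)"
    unfolding set_lebesgue_integral_def
    using ray_power_integrable[of n] ray_substitution(1)[OF s d, of n, folded ray_weight_def]
    by (intro mult_left_mono integral_mono)
      (use \<rho> ray_weight_nonneg[OF s] in \<open>auto simp: set_integrable_def indicator_def\<close>)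
  also have "(LINT x:{0<..}|lborel. x ^ n * ray_weight s d x) = Gamma (1 + real n * s) / d ^ Suc n"
    by (rule ray_substitution(2)[OF s d, of n, folded ray_weight_def])
  finally show ?thesis .
qed

text \<open>With \<open>v = t - u\<close> for the argument of \<open>\<zeta> w\<close> along the
  arc, the arc gives \<open>rotated_kernel_int\<close>. Along the ray this argument is 0, so the ray
  depends on \<open>t\<close> only through the common phase.\<close>

lemma psdo_inner_monomial:
  "psdo_inner s \<rho> (\<lambda>\<zeta>. \<zeta> powi a) 0 d t = cis (- (of_int a + 1) * t) *
     (of_real (ray_moment s \<rho> d a) - \<i> * of_real (\<rho> powi (a + 1)) * rotated_kernel_int s (d * \<rho>) a t)"
proof -
  let ?e = "cis (- (of_int a + 1) * t)"
  have pw: "(of_real x * cis v) powi a = of_real (x powi a) * cis (of_int a * v)" for x v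
    by (simp add: power_int_mult_distrib cis_power_int)
  have 1: "(of_real \<rho> * cis (- u)) powi a * psdo_kernel (1 / s) (d * \<rho>) (t - u) * (- \<i> * of_real \<rho> * cis (- u))
      = (- \<i> * of_real (\<rho> powi (a + 1)) * ?e) * rotated_kernel s (d * \<rho>) a (t - u)" for u
  proof -
    have "cis (of_int a * (- u)) * cis (- u) = ?e * cis ((of_int a + 1) * (t - u))"
      unfolding cis_mult by (rule arg_cong[of _ _ cis]) (simp add: algebra_simps)
    then show ?thesis
      using \<rho> unfolding pw rotated_kernel_def by (simp add: power_int_add mult_ac)
  qed
  have 2: "(LBINT u=0..t. rotated_kernel s (d * \<rho>) a (t - u)) = rotated_kernel_int s (d * \<rho>) a t"
  proof -
    have D: "((\<lambda>u. - rotated_kernel_int s (d * \<rho>) a (t - u)) has_vector_derivative rotated_kernel s (d * \<rho>) a (t - u)) (at u within A)" for u A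
    proof -
      have "(((rotated_kernel_int s (d * \<rho>) a) \<circ> (\<lambda>u. t - u)) has_vector_derivative ((-1) *\<^sub>R rotated_kernel s (d * \<rho>) a (t - u))) (at u within A)"
        by (intro vector_diff_chain_within rotated_kernel_int_deriv) (auto intro!: derivative_eq_intros)
      from has_vector_derivative_minus[OF this] show ?thesis by (simp add: o_def)
    qed
    have "(LBINT u=ereal 0..t. rotated_kernel s (d * \<rho>) a (t - u)) =
        - rotated_kernel_int s (d * \<rho>) a (t - t) - - rotated_kernel_int s (d * \<rho>) a (t - 0)"
      by (rule interval_integral_FTC_finite[OF _ D])
        (intro continuous_on_compose2[OF continuous_rotated_kernel[of UNIV]] continuous_intros; simp)
    then show ?thesis by (simp add: zero_ereal_def rotated_kernel_int_def)
  qed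
  have 3: "(of_real x * cis (- t)) powi a * psdo_kernel (1 / s) (d * x) 0 * cis (- t) =
      ?e * complex_of_real (x powi a * ray_weight s d x)" for x :: real
  proof -
    have "cis (of_int a * (- t)) * cis (- t) = ?e"
      unfolding cis_mult by (rule arg_cong[of _ _ cis]) (simp add: algebra_simps)
    then show ?thesis unfolding pw psdo_kernel_0 by (simp add: mult_ac)
  qed
  have 4: "(LBINT x=\<rho>..\<infinity>. complex_of_real (x powi a * ray_weight s d x)) = of_real (ray_moment s \<rho> d a)"
    unfolding interval_lebesgue_integral_of_real ray_moment_def
      interval_integral_to_infinity_eq ..
  show ?thesis
    unfolding psdo_inner_def Let_def mult_zero_left Mittag_Leffler_0 mult_1_right 1 3
      interval_lebesgue_integral_mult_right 2 4
    by (simp add: algebra_simps)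
qed


lemma psdo_turns_monomial:
  "psdo_turns s \<rho> d t0 N (\<lambda>\<zeta>. \<zeta> powi a) (\<lambda>w. w ^ n) 0 = of_real (d ^ Suc n / (2 * pi)) *
     (LINT t:{t0..t0 + 2 * pi * real N}|lborel. cis ((real n - of_int a) * t) *
       (of_real (ray_moment s \<rho> d a) - \<i> * of_real (\<rho> powi (a + 1)) * rotated_kernel_int s (d * \<rho>) a t))"
proof -
  have "(of_real d * cis t) ^ n * psdo_inner s \<rho> (\<lambda>\<zeta>. \<zeta> powi a) 0 d t * (\<i> * of_real d * cis t) =
     (\<i> * of_real (d ^ Suc n)) * (cis ((real n - of_int a) * t) *
       (of_real (ray_moment s \<rho> d a) - \<i> * of_real (\<rho> powi (a + 1)) * rotated_kernel_int s (d * \<rho>) a t))" for t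
  proof -
    have "cis (real n * t) * cis (- (of_int a + 1) * t) * cis t = cis ((real n - of_int a) * t)"
      unfolding cis_mult by (rule arg_cong[of _ _ cis]) (simp add: algebra_simps)
    then show ?thesis
      unfolding psdo_inner_monomial power_mult_distrib Complex.DeMoivre by (simp add: mult_ac)
  qed
  then show ?thesis unfolding psdo_turns_def by (simp only: set_integral_mult_right) simp
qed

lemma rotated_kernel_set_integrable [intro]:
  "set_integrable lborel {a..b} (\<lambda>t. cis (c * t) * rotated_kernel s (d * \<rho>) j t)"
  "set_integrable lborel {a..b} (rotated_kernel s (d * \<rho>) j)"
  by (intro borel_integrable_atLeastAtMost' continuous_intros continuous_rotated_kernel)+

lemma rotated_kernel_avg_tendsto:
  "(\<lambda>N. (LINT t:{t0..t0 + 2 * pi * real N}|lborel. cis (c * t) * rotated_kernel s (d * \<rho>) a t) / of_nat N)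
     \<longlonglongrightarrow> (\<Sum>i. complex_of_real (kernel_coeff s (d * \<rho>) i) * complex_of_real (if c + kernel_freq s a i = 0 then 2 * pi else 0))"
proof -
  have "(\<Sum>i. of_real (kernel_coeff s (d * \<rho>) i) * cis ((c + kernel_freq s a i) * t)) =
     cis (c * t) * rotated_kernel s (d * \<rho>) a t" for t
    using sums_mult[OF rotated_kernel_sums[of s "d * \<rho>" a t], of "cis (c * t)"]
    by (simp add: sums_iff mult.left_commute cis_mult[symmetric] distrib_right)
  then show ?thesis
    using quasi_periodic_avg[of "\<lambda>i. of_real (kernel_coeff s (d * \<rho>) i)" t0 "\<lambda>i. c + kernel_freq s a i"]
      summable_kernel_coeff[of s "d * \<rho>"] by simp
qed

text \<open>Off the diagonal, an integration by parts removes the contribution of the ray.\<close>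

lemma psdo_turns_monomial_off_diag:
  fixes t0 :: real and N :: nat
  assumes na: "int n \<noteq> a"
  defines "c \<equiv> real n - of_int a"
  defines "T \<equiv> {t0..t0 + 2 * pi * real N}"
  shows "psdo_turns s \<rho> d t0 N (\<lambda>\<zeta>. \<zeta> powi a) (\<lambda>w. w ^ n) 0 =
    of_real (- (d ^ Suc n * \<rho> powi (a + 1) / (2 * pi * c))) *
      (cis (c * t0) * (LINT t:T|lborel. rotated_kernel s (d * \<rho>) a t) -
        (LINT t:T|lborel. cis (c * t) * rotated_kernel s (d * \<rho>) a t))"
proof -
  define R where "R = complex_of_real (\<rho> powi (a + 1))"
  define g where "g t = of_real (ray_moment s \<rho> d a) - \<i> * R * rotated_kernel_int s (d * \<rho>) a t" for t
  define y where "y = rotated_kernel s (d * \<rho>) a"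
  have c: "c \<noteq> 0" using na unfolding c_def by (metis eq_iff_diff_eq_0 of_int_eq_iff of_int_of_nat_eq)
  define K where "K = - (R / c)"
  define b where "b = t0 + 2 * pi * real N"
  have ab: "t0 \<le> b" by (simp add: b_def)
  have dg: "(g has_vector_derivative (- (\<i> * R * y t))) (at t within A)" for t A
    unfolding g_def y_def by (auto intro!: derivative_eq_intros rotated_kernel_int_deriv)
  have dc: "((\<lambda>t. cis (c * t) / (\<i> * c)) has_vector_derivative cis (c * t)) (at t within A)" for t A
    unfolding cis_conv_exp using c
    by (auto intro!: derivative_eq_intros has_vector_derivative_real_field simp: field_simps)
  have contg: "continuous_on A g" for A
    using dg by (meson continuous_on_vector_derivative)
  have conty: "continuous_on A y" for A unfolding y_def by (rule continuous_rotated_kernel)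
  have F1: "(LBINT t=t0..b. - (\<i> * R * y t)) = g b - g t0"
    by (rule interval_integral_FTC_finite[OF _ dg]) (intro continuous_intros conty)
  have "(LBINT t=t0..b. cis (c * t) / (\<i> * c) * (- (\<i> * R * y t)) + cis (c * t) * g t) =
      cis (c * b) / (\<i> * c) * g b - cis (c * t0) / (\<i> * c) * g t0"
    by (rule interval_integral_FTC_finite[OF _ has_vector_derivative_mult[OF dc dg]])
      (use c in \<open>auto intro!: continuous_intros conty contg\<close>)
  also have "(LBINT t=t0..b. cis (c * t) / (\<i> * c) * (- (\<i> * R * y t)) + cis (c * t) * g t) =
      (LBINT t=t0..b. K * (cis (c * t) * y t) + cis (c * t) * g t)"
    using c by (intro interval_integral_cong) (simp add: K_def)
  also have "\<dots> = K * (LBINT t=t0..b. cis (c * t) * y t) + (LBINT t=t0..b. cis (c * t) * g t)"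
    by (subst interval_lebesgue_integral_add)
      (auto intro!: interval_integrable_continuous_on[OF ab] continuous_intros conty contg simp del: interval_lebesgue_integrable_mult_right)
  \<comment> \<open>\<open>c\<close> is an integer, so its exponential returns to its initial value
    after \<open>N\<close> turns. The boundary term is then a multiple of \<open>g b - g t0\<close>,
    from which the constant \<open>ray_moment\<close> drops out.\<close>
  also have "cis (c * b) = cis (c * t0)"
  proof -
    have "c * b = c * t0 + 2 * pi * of_int ((int n - a) * int N)" by (simp add: c_def b_def algebra_simps)
    then show ?thesis by (simp add: cis_mult[symmetric] cis_multiple_2pi)
  qed
  also have "cis (c * t0) / (\<i> * c) * g b - cis (c * t0) / (\<i> * c) * g t0 = cis (c * t0) / (\<i> * c) * (LBINT t=t0..b. - (\<i> * R * y t))"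
    unfolding F1 by (simp add: algebra_simps diff_divide_distrib)
  also have "\<dots> = K * (cis (c * t0) * (LBINT t=t0..b. y t))"

    unfolding interval_lebesgue_integral_uminus mult.assoc interval_lebesgue_integral_mult_right
    using c by (simp add: K_def)
  finally have "(LBINT t=t0..b. cis (c * t) * g t) =
     K * (cis (c * t0) * (LBINT t=t0..b. y t) - (LBINT t=t0..b. cis (c * t) * y t))"
    by (simp add: algebra_simps)
  then have "(LINT t:T|lborel. cis (c * t) * g t) =
     K * (cis (c * t0) * (LINT t:T|lborel. y t) - (LINT t:T|lborel. cis (c * t) * y t))"
    using ab by (simp add: interval_integral_Icc T_def b_def)
  then show ?thesis
    unfolding psdo_turns_monomial c_def[symmetric] R_def[symmetric] g_def[symmetric] T_def[symmetric] y_def[symmetric]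
    using c by (simp add: R_def K_def)
qed


text \<open>For natural exponents there is no resonance, and dividing by a frequency costs at most a
  factor \<open>s\<close>.\<close>

lemma kernel_freq_ge: "kernel_freq s (int n) i \<ge> 1 / s"
  using s by (simp add: kernel_freq_def add_divide_distrib)

lemma kernel_freq_pos: "kernel_freq s (int n) i > 0"
  using kernel_freq_ge[of n i] s by (meson less_le_trans zero_less_divide_1_iff)

lemma summable_kernel_coeff_div_freq:
  "summable (\<lambda>i. norm (kernel_coeff s (d * \<rho>) i / kernel_freq s (int n) i))"
  "norm (kernel_coeff s (d * \<rho>) i / kernel_freq s (int n) i) \<le> norm (kernel_coeff s (d * \<rho>) i) * s"
proof -
  show *: "norm (kernel_coeff s (d * \<rho>) i / kernel_freq s (int n) i) \<le> norm (kernel_coeff s (d * \<rho>) i) * s" for i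
  proof -
    have "1 / kernel_freq s (int n) i \<le> 1 / (1 / s)"
      using kernel_freq_ge[of n i] kernel_freq_pos[of n i] s by (intro divide_left_mono) auto
    then show ?thesis
      using kernel_freq_pos[of n i] mult_left_mono[of "1 / kernel_freq s (int n) i" s "\<bar>kernel_coeff s (d * \<rho>) i\<bar>"]
      by (simp add: abs_divide)
  qed
  show "summable (\<lambda>i. norm (kernel_coeff s (d * \<rho>) i / kernel_freq s (int n) i))"
    by (rule summable_comparison_test'[OF summable_mult2[OF summable_kernel_coeff[of s "d * \<rho>"], of s], of 0])
      (use * in simp)
qed

text \<open>Without resonance each exponential has a primitive of size at most 2 over its frequency,
  hence at most \<open>2 * s\<close>. The bound is uniform in \<open>t\<close>, which the diagonal
  case requires because no integration by parts is possible there.\<close>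

lemma norm_rotated_kernel_int_le: "norm (rotated_kernel_int s (d * \<rho>) (int n) t) \<le> 2 * s * kernel_bound s (d * \<rho>)"
proof -
  let ?\<nu> = "kernel_freq s (int n)"
  let ?f = "\<lambda>i. of_real (kernel_coeff s (d * \<rho>) i) * ((cis (?\<nu> i * t) - 1) / (\<i> * ?\<nu> i))"
  have "?f sums rotated_kernel_int s (d * \<rho>) (int n) t"
    by (rule rotated_kernel_int_sums) (use kernel_freq_pos[of n] in \<open>simp add: less_imp_neq[symmetric]\<close>)
  moreover have le: "norm (?f i) \<le> norm (kernel_coeff s (d * \<rho>) i) * (2 * s)" for i
  proof -
    have "norm (cis (?\<nu> i * t) - 1) \<le> 2" using norm_triangle_ineq4[of "cis (?\<nu> i * t)" 1] by simp
    then have "norm (kernel_coeff s (d * \<rho>) i / ?\<nu> i) * norm (cis (?\<nu> i * t) - 1) \<le> (norm (kernel_coeff s (d * \<rho>) i) * s) * 2"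
      using summable_kernel_coeff_div_freq(2)[where i = i and n = n] s by (intro mult_mono) auto
    then show ?thesis by (simp add: norm_mult norm_divide mult_ac)
  qed
  moreover have S: "(\<lambda>i. norm (kernel_coeff s (d * \<rho>) i) * (2 * s)) sums (kernel_bound s (d * \<rho>) * (2 * s))"
    using suminf_norm_kernel_coeff[OF s] summable_kernel_coeff by (intro sums_mult2) (metis summable_sums)
  ultimately have "norm (rotated_kernel_int s (d * \<rho>) (int n) t) \<le> kernel_bound s (d * \<rho>) * (2 * s)"
    by (metis (no_types, lifting) norm_suminf_le sums_iff)
  then show ?thesis by (simp add: mult_ac)
qed

text \<open>The majorant for Tannery's theorem, uniform in the number of turns. Off the diagonal the
  integrated form with \<open>\<bar>c\<bar> \<ge> 1\<close> produces the constant
  \<open>2 * \<rho> * kernel_bound\<close>; on the diagonal \<open>a\<close> is natural and the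
  bounded primitive produces \<open>2 * \<rho> * s * kernel_bound\<close>. The stated constant
  covers both.\<close>

lemma psdo_turns_monomial_bound:
  "norm (psdo_turns s \<rho> d t0 N (\<lambda>\<zeta>. \<zeta> powi a) (\<lambda>w. w ^ n) 0 / of_nat N) \<le>
    d * (1 + 2 * \<rho> * (1 + s) * kernel_bound s (d * \<rho>)) * (d ^ n * (\<rho> powi a + ray_moment s \<rho> d a))"
proof (cases "N = 0")
  case True
  then show ?thesis
    using s d \<rho> ray_moment_nonneg[of a] by (simp add: kernel_bound_def)
next
  case N: False
  let ?K = "kernel_bound s (d * \<rho>)" and ?T = "{t0..t0 + 2 * pi * real N}"
  have K: "?K \<ge> 0" using s by (simp add: kernel_bound_def)
  have rm: "ray_moment s \<rho> d a \<ge> 0" by (rule ray_moment_nonneg)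
  have ra: "\<rho> powi a > 0" using \<rho> by simp
  have rs: "\<rho> powi (a + 1) = \<rho> * \<rho> powi a" using \<rho> by (simp add: power_int_add)
  have "norm (psdo_turns s \<rho> d t0 N (\<lambda>\<zeta>. \<zeta> powi a) (\<lambda>w. w ^ n) 0) \<le>
      real N * (d * (1 + 2 * \<rho> * (1 + s) * ?K) * (d ^ n * (\<rho> powi a + ray_moment s \<rho> d a)))"
  proof (cases "int n = a")
    case False
    define c where "c = real n - of_int a"
    have "\<bar>int n - a\<bar> \<ge> 1" using False by simp
    then have c: "\<bar>c\<bar> \<ge> 1" unfolding c_def by linarith
    have 1: "norm (LINT t:?T|lborel. rotated_kernel s (d * \<rho>) a t) \<le> ?K * (t0 + 2 * pi * real N - t0)"
      by (intro norm_set_integral_le) (auto intro: norm_rotated_kernel_le[OF s])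
    have 2: "norm (LINT t:?T|lborel. cis (c * t) * rotated_kernel s (d * \<rho>) a t) \<le> ?K * (t0 + 2 * pi * real N - t0)"
      by (intro norm_set_integral_le) (auto intro: norm_rotated_kernel_le[OF s] simp: norm_mult)
    have "norm (cis (c * t0) * (LINT t:?T|lborel. rotated_kernel s (d * \<rho>) a t) -
        (LINT t:?T|lborel. cis (c * t) * rotated_kernel s (d * \<rho>) a t)) \<le> 2 * (?K * (2 * pi * real N))"
      by (rule order_trans[OF norm_triangle_ineq4]) (use 1 2 in \<open>simp add: norm_mult\<close>)
    then have "norm (psdo_turns s \<rho> d t0 N (\<lambda>\<zeta>. \<zeta> powi a) (\<lambda>w. w ^ n) 0) \<le>
        \<bar>d ^ Suc n * \<rho> powi (a + 1) / (2 * pi * c)\<bar> * (2 * (?K * (2 * pi * real N)))"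
      unfolding psdo_turns_monomial_off_diag[OF False] c_def[symmetric] norm_mult norm_of_real abs_minus_cancel
      by (intro mult_left_mono) auto
    also have "\<dots> = (d ^ Suc n * (\<rho> * \<rho> powi a)) * (2 * ?K * real N) * (1 / \<bar>c\<bar>)"
      using d \<rho> unfolding rs by (simp add: abs_mult field_simps)
    also have "\<dots> \<le> (d ^ Suc n * (\<rho> * \<rho> powi a)) * (2 * ?K * real N) * 1"
      using c d \<rho> K by (intro mult_left_mono mult_nonneg_nonneg) (auto simp: divide_le_eq)
    also have "\<dots> = real N * (d * (2 * \<rho> * ?K) * (d ^ n * \<rho> powi a))" by (simp add: mult_ac)
    also have "\<dots> \<le> real N * (d * (1 + 2 * \<rho> * (1 + s) * ?K) * (d ^ n * (\<rho> powi a + ray_moment s \<rho> d a)))"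
      using d \<rho> K s rm ra by (intro mult_left_mono mult_mono) (auto simp: algebra_simps)
    finally show ?thesis .
  next
    case True
    let ?g = "\<lambda>t. of_real (ray_moment s \<rho> d a) - \<i> * of_real (\<rho> powi (a + 1)) * rotated_kernel_int s (d * \<rho>) a t"
    have cont: "continuous_on A (rotated_kernel_int s (d * \<rho>) a)" for A
      using rotated_kernel_int_deriv by (meson continuous_on_vector_derivative)
    have "norm (LINT t:?T|lborel. cis ((real n - of_int a) * t) * ?g t) \<le>
        (ray_moment s \<rho> d a + \<rho> powi (a + 1) * (2 * s * ?K)) * (t0 + 2 * pi * real N - t0)"
    proof (rule norm_set_integral_le)
      show "set_integrable lborel ?T (\<lambda>t. cis ((real n - of_int a) * t) * ?g t)"
        by (intro borel_integrable_atLeastAtMost' continuous_intros cont)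
      show "norm (cis ((real n - of_int a) * t) * ?g t) \<le> ray_moment s \<rho> d a + \<rho> powi (a + 1) * (2 * s * ?K)" for t
        unfolding norm_mult norm_cis mult_1_left
        by (rule order_trans[OF norm_triangle_ineq4])
          (use rm \<rho> norm_rotated_kernel_int_le[of n t] True in \<open>auto simp: norm_mult norm_power_int intro!: mult_left_mono\<close>)
    qed simp
    then have "norm (psdo_turns s \<rho> d t0 N (\<lambda>\<zeta>. \<zeta> powi a) (\<lambda>w. w ^ n) 0) \<le>
        d ^ Suc n / (2 * pi) * ((ray_moment s \<rho> d a + \<rho> powi (a + 1) * (2 * s * ?K)) * (2 * pi * real N))"
      unfolding psdo_turns_monomial norm_mult norm_of_real using d by (intro mult_mono) auto
    also have "\<dots> = real N * (d * d ^ n * (ray_moment s \<rho> d a + 2 * \<rho> * s * ?K * \<rho> powi a))"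
      unfolding rs by (simp add: field_simps)
    also have "\<dots> \<le> real N * (d * d ^ n * ((1 + 2 * \<rho> * (1 + s) * ?K) * (\<rho> powi a + ray_moment s \<rho> d a)))"
      using d \<rho> K s rm ra by (intro mult_left_mono) (auto simp: algebra_simps intro!: add_nonneg_nonneg)
    finally show ?thesis by (simp add: mult_ac)
  qed
  then show ?thesis using N by (simp add: norm_divide divide_le_eq mult_ac)
qed

section \<open>The diagonal value: completing the ray moment to a Gamma value\<close>

lemma kernel_coeff_power:
  assumes "x \<ge> 0"
  shows "kernel_coeff s (d * x) i * x ^ n = kernel_coeff s d i * x powr (kernel_freq s (int n) i - 1)"
proof (cases "x = 0")
  case False
  with assms have x: "x > 0" by simp
  have "x powr (1 / s - 1) * (x powr (1 / s)) ^ i * x ^ n = x powr (1 / s - 1) * x powr (1 / s * real i) * x powr real n"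
    using x powr_realpow[of "x powr (1 / s)" i] by (simp add: powr_realpow powr_powr)
  also have "\<dots> = x powr (kernel_freq s (int n) i - 1)"
    unfolding powr_add[symmetric] by (rule arg_cong[of _ _ "\<lambda>y. x powr y"]) (simp add: kernel_freq_def add_divide_distrib)
  finally have "x powr (1 / s - 1) * (x powr (1 / s)) ^ i * x ^ n = x powr (kernel_freq s (int n) i - 1)" .
  moreover have "(- ((d * x) powr (1 / s))) ^ i = (- (d powr (1 / s))) ^ i * (x powr (1 / s)) ^ i"
    using x d by (simp add: powr_mult flip: power_mult_distrib)
  ultimately show ?thesis
    using x d by (simp add: kernel_coeff_def powr_mult mult_ac)
qed (simp add: kernel_coeff_def)

lemma ray_weight_sums: "(\<lambda>i. kernel_coeff s (d * x) i) sums ray_weight s d x"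
proof -
  have "(\<lambda>i. 1 / s * (d * x) powr (1 / s - 1) * ((- ((d * x) powr (1 / s))) ^ i /\<^sub>R fact i)) sums ray_weight s d x"
    unfolding ray_weight_def by (intro sums_mult exp_converges)
  then show ?thesis by (simp add: kernel_coeff_def divide_inverse mult_ac)
qed

text \<open>The second summand is the Gamma integral over the missing interval from 0 to
  \<open>\<rho>\<close>: the weight is expanded there, each term is a power of \<open>x\<close> with
  exponent \<open>kernel_freq - 1\<close>, and integration brings the frequency into the
  denominator. The same quotients are the constant terms of the arc integral.\<close>

lemma ray_moment_complement:
  "ray_moment s \<rho> d (int n) + \<rho> ^ Suc n * (\<Sum>i. kernel_coeff s (d * \<rho>) i / kernel_freq s (int n) i) =
    Gamma (1 + real n * s) / d ^ Suc n"
proof -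
  let ?\<nu> = "kernel_freq s (int n)"
  define f where "f i x = kernel_coeff s d i * x powr (?\<nu> i - 1)" for i x
  have fr: "?\<nu> i > 0" for i by (rule kernel_freq_pos)
  have fi: "set_integrable lborel {0..\<rho>} (f i)" for i
    unfolding f_def using fr[of i] \<rho> by (intro set_integrable_mult_right powr_set_integral) auto
  have val: "kernel_coeff s d i * (\<rho> powr ?\<nu> i / ?\<nu> i) = \<rho> ^ Suc n * (kernel_coeff s (d * \<rho>) i / ?\<nu> i)" for i
    using kernel_coeff_power[of \<rho> i n] \<rho> by (simp add: powr_diff mult_ac)
  have int: "(LINT x:{0..\<rho>}|lborel. f i x) = \<rho> ^ Suc n * (kernel_coeff s (d * \<rho>) i / ?\<nu> i)" for i
    unfolding f_def val[symmetric] using fr[of i] \<rho> by (simp add: powr_set_integral)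
  have nint: "(\<integral>x. norm (indicator {0..\<rho>} x *\<^sub>R f i x) \<partial>lborel) = \<rho> ^ Suc n * norm (kernel_coeff s (d * \<rho>) i / ?\<nu> i)" for i
  proof -
    have "(\<integral>x. norm (indicator {0..\<rho>} x *\<^sub>R f i x) \<partial>lborel) = (LINT x:{0..\<rho>}|lborel. \<bar>kernel_coeff s d i\<bar> * x powr (?\<nu> i - 1))"
      unfolding set_lebesgue_integral_def by (simp add: f_def abs_mult)
    also have "\<dots> = \<bar>kernel_coeff s d i\<bar> * (\<rho> powr ?\<nu> i / ?\<nu> i)"
      using fr[of i] \<rho> by (simp add: powr_set_integral)
    also have "\<dots> = \<bar>kernel_coeff s d i * (\<rho> powr ?\<nu> i / ?\<nu> i)\<bar>" using fr[of i] by (simp add: abs_mult)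
    finally show ?thesis unfolding val using \<rho> by (simp add: abs_mult)
  qed
  have sf: "(\<lambda>i. f i x) sums (x ^ n * ray_weight s d x)" if "x \<ge> 0" for x
    using sums_mult[OF ray_weight_sums, of "x ^ n" x] kernel_coeff_power[OF that, of _ n]
    by (simp add: f_def mult.commute)
  have sn: "summable (\<lambda>i. norm (f i x))" if "x \<ge> 0" for x
    using summable_mult2[OF summable_kernel_coeff[of s "d * x"], of "x ^ n"] that
    by (simp add: f_def abs_mult flip: kernel_coeff_power)
  have "(\<lambda>i. \<integral>x. indicator {0..\<rho>} x *\<^sub>R f i x \<partial>lborel) sums (\<integral>x. (\<Sum>i. indicator {0..\<rho>} x *\<^sub>R f i x) \<partial>lborel)"
  proof (rule sums_integral)
    show "integrable lborel (\<lambda>x. indicator {0..\<rho>} x *\<^sub>R f i x)" for i using fi[of i] by (simp add: set_integrable_def)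
    show "AE x in lborel. summable (\<lambda>i. norm (indicator {0..\<rho>} x *\<^sub>R f i x))"
      using sn by (auto simp: indicator_def)
    show "summable (\<lambda>i. \<integral>x. norm (indicator {0..\<rho>} x *\<^sub>R f i x) \<partial>lborel)"
      unfolding nint by (intro summable_mult summable_kernel_coeff_div_freq)
  qed
  \<comment> \<open>The endpoint 0 may be dropped because both sides vanish there:
    \<open>ray_weight s d 0 = 0\<close> by the convention \<open>0 powr y = 0\<close>.\<close>
  moreover have "(\<Sum>i. indicator {0..\<rho>} x *\<^sub>R f i x) = indicator {0<..\<rho>} x *\<^sub>R (x ^ n * ray_weight s d x)" for x
    using sf[of x] by (auto simp: indicator_def sums_iff ray_weight_def)
  ultimately have "(\<lambda>i. \<rho> ^ Suc n * (kernel_coeff s (d * \<rho>) i / ?\<nu> i)) sums (LINT x:{0<..\<rho>}|lborel. x ^ n * ray_weight s d x)"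
    using int by (simp add: set_lebesgue_integral_def)
  then have low: "\<rho> ^ Suc n * (\<Sum>i. kernel_coeff s (d * \<rho>) i / ?\<nu> i) = (LINT x:{0<..\<rho>}|lborel. x ^ n * ray_weight s d x)"
    using summable_norm_cancel[OF summable_kernel_coeff_div_freq(1)] by (subst suminf_mult[symmetric]) (auto simp: sums_iff)
  have ip: "set_integrable lborel {0<..} (\<lambda>x. x ^ n * ray_weight s d x)"
    by (rule ray_substitution(1)[OF s d, of n, folded ray_weight_def])
  have "(LINT x:{0<..\<rho>} \<union> {\<rho><..}|lborel. x ^ n * ray_weight s d x) =
      (LINT x:{0<..\<rho>}|lborel. x ^ n * ray_weight s d x) + (LINT x:{\<rho><..}|lborel. x ^ n * ray_weight s d x)"
    using \<rho> by (intro set_integral_Un set_integrable_subset[OF ip]) auto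
  moreover have "{0<..\<rho>} \<union> {\<rho><..} = {0<..}" using \<rho> by auto
  ultimately show ?thesis
    using ray_substitution(2)[OF s d, of n, folded ray_weight_def] low by (simp add: ray_moment_def)
qed

text \<open>The constants of the arc series add to \<open>ray_moment\<close> exactly what it lacks
  to the full Gamma integral. What remains has nonzero frequencies and mean 0.\<close>

lemma psdo_turns_monomial_diag_tendsto:
  "(\<lambda>N. psdo_turns s \<rho> d t0 N (\<lambda>\<zeta>. \<zeta> powi int n) (\<lambda>w. w ^ n) 0 / of_nat N)
    \<longlonglongrightarrow> of_real (Gamma (1 + real n * s))"
proof -
  let ?\<nu> = "kernel_freq s (int n)"
  \<comment> \<open>Each \<open>e i\<close> enters the arc integral twice: with its exponential, and
    with the opposite sign as a constant.\<close>
  define e where "e i = - (\<rho> ^ Suc n * (kernel_coeff s (d * \<rho>) i / ?\<nu> i))" for i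
  define G where "G = Gamma (1 + real n * s) / d ^ Suc n"
  have fr: "?\<nu> i \<noteq> 0" for i using kernel_freq_pos[of n i] by simp
  have se: "summable (\<lambda>i. norm (e i))"
    using summable_mult[OF summable_kernel_coeff_div_freq(1), of "\<rho> ^ Suc n" n] \<rho> by (simp add: e_def abs_mult)
  have sc: "summable (\<lambda>i. complex_of_real (e i) * cis (?\<nu> i * t))" for t
    by (rule summable_norm_cancel) (use se in \<open>simp add: norm_mult\<close>)
  have g: "cis ((real n - of_int (int n)) * t) * (of_real (ray_moment s \<rho> d (int n)) -
      \<i> * of_real (\<rho> powi (int n + 1)) * rotated_kernel_int s (d * \<rho>) (int n) t) =
      of_real G + (\<Sum>i. of_real (e i) * cis (?\<nu> i * t))" for t
  proof -
    have "(\<lambda>i. - \<i> * of_real (\<rho> ^ Suc n) * (kernel_coeff s (d * \<rho>) i * ((cis (?\<nu> i * t) - 1) / (\<i> * ?\<nu> i)))) sums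
      (- \<i> * of_real (\<rho> ^ Suc n) * rotated_kernel_int s (d * \<rho>) (int n) t)"
      by (intro sums_mult rotated_kernel_int_sums fr)
    also have "(\<lambda>i. - \<i> * of_real (\<rho> ^ Suc n) * (kernel_coeff s (d * \<rho>) i * ((cis (?\<nu> i * t) - 1) / (\<i> * ?\<nu> i)))) =
      (\<lambda>i. of_real (e i) * cis (?\<nu> i * t) - of_real (e i))"
      using fr by (simp add: e_def fun_eq_iff field_simps)
    finally have *: "(\<lambda>i. of_real (e i) * cis (?\<nu> i * t) - of_real (e i)) sums
        (- \<i> * of_real (\<rho> ^ Suc n) * rotated_kernel_int s (d * \<rho>) (int n) t)" .
    have "(\<lambda>i. complex_of_real (e i)) sums of_real (suminf e)"
      using se by (intro sums_of_real summable_sums) (rule summable_norm_cancel)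
    from sums_add[OF * this] have "(\<lambda>i. of_real (e i) * cis (?\<nu> i * t)) sums
        (- \<i> * of_real (\<rho> ^ Suc n) * rotated_kernel_int s (d * \<rho>) (int n) t + of_real (suminf e))" by simp
    then have 1: "- \<i> * of_real (\<rho> ^ Suc n) * rotated_kernel_int s (d * \<rho>) (int n) t =
        (\<Sum>i. of_real (e i) * cis (?\<nu> i * t)) - of_real (suminf e)" by (simp add: sums_iff)
    have 2: "suminf e = - (\<rho> ^ Suc n * (\<Sum>i. kernel_coeff s (d * \<rho>) i / ?\<nu> i))"
      unfolding e_def using summable_norm_cancel[OF summable_kernel_coeff_div_freq(1), of n]
      by (simp only: suminf_minus[OF summable_mult] suminf_mult)
    have 3: "ray_moment s \<rho> d (int n) = G + suminf e"
      unfolding G_def ray_moment_complement[symmetric] 2 by simp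
    have 4: "\<rho> powi (int n + 1) = \<rho> ^ Suc n"
      by (metis add.commute of_nat_Suc power_int_of_nat)
    have "of_real (ray_moment s \<rho> d (int n)) -
      \<i> * of_real (\<rho> powi (int n + 1)) * rotated_kernel_int s (d * \<rho>) (int n) t =
      of_real (ray_moment s \<rho> d (int n)) + - \<i> * of_real (\<rho> ^ Suc n) * rotated_kernel_int s (d * \<rho>) (int n) t"
      unfolding 4 by simp
    also have "\<dots> = of_real G + (\<Sum>i. of_real (e i) * cis (?\<nu> i * t))"
      unfolding 1 3 by simp
    finally show ?thesis by simp
  qed
  have int: "set_integrable lborel {a..b} (\<lambda>t. \<Sum>i. of_real (e i) * cis (?\<nu> i * t))" if "a \<le> b" for a b
    by (rule set_integral_suminf(1)[OF that _ _ se]) (auto intro!: continuous_intros simp: norm_mult)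
  have split: "psdo_turns s \<rho> d t0 N (\<lambda>\<zeta>. \<zeta> powi int n) (\<lambda>w. w ^ n) 0 / of_nat N =
     of_real (d ^ Suc n / (2 * pi)) * (of_real G * ((LINT t:{t0..t0 + 2 * pi * real N}|lborel. cis (0 * t)) / of_nat N) +
        (LINT t:{t0..t0 + 2 * pi * real N}|lborel. (\<Sum>i. of_real (e i) * cis (?\<nu> i * t))) / of_nat N)" for N
  proof -
    have "(LINT t:{t0..t0 + 2 * pi * real N}|lborel. of_real G + (\<Sum>i. of_real (e i) * cis (?\<nu> i * t))) =
      of_real G * (LINT t:{t0..t0 + 2 * pi * real N}|lborel. cis (0 * t)) +
        (LINT t:{t0..t0 + 2 * pi * real N}|lborel. (\<Sum>i. of_real (e i) * cis (?\<nu> i * t)))"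
      by (subst set_integral_add(2)[OF _ int])
        (auto intro!: borel_integrable_atLeastAtMost' simp: set_integral_const_Icc scaleR_conv_of_real)
    then show ?thesis unfolding psdo_turns_monomial g by (simp only: times_divide_eq_right add_divide_distrib[symmetric])
  qed
  have lim: "(\<lambda>N. (LINT t:{t0..t0 + 2 * pi * real N}|lborel. (\<Sum>i. of_real (e i) * cis (?\<nu> i * t))) / of_nat N) \<longlonglongrightarrow> 0"
    using quasi_periodic_avg[of "\<lambda>i. complex_of_real (e i)" t0 ?\<nu>] se fr by simp
  have "(\<lambda>N. psdo_turns s \<rho> d t0 N (\<lambda>\<zeta>. \<zeta> powi int n) (\<lambda>w. w ^ n) 0 / of_nat N) \<longlonglongrightarrow>
     of_real (d ^ Suc n / (2 * pi)) * (of_real G * of_real (if (0::real) = 0 then 2 * pi else 0) + 0)"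
    unfolding split by (intro tendsto_intros avg_cis lim)
  then show ?thesis using d by (simp add: G_def)
qed

text \<open>Off the diagonal the integrated form contains only means of
  \<open>rotated_kernel\<close>, which converge in every case. A resonance contributes a nonzero
  mean there, although it makes the primitive \<open>rotated_kernel_int\<close> grow
  linearly.\<close>

lemma monomial_op_tendsto:
  "(\<lambda>N. psdo_turns s \<rho> d t0 N (\<lambda>\<zeta>. \<zeta> powi a) (\<lambda>w. w ^ n) 0 / of_nat N) \<longlonglongrightarrow> monomial_op s \<rho> d t0 a n"
proof -
  have "convergent (\<lambda>N. psdo_turns s \<rho> d t0 N (\<lambda>\<zeta>. \<zeta> powi a) (\<lambda>w. w ^ n) 0 / of_nat N)"
  proof (cases "int n = a")
    case True
    then show ?thesis using psdo_turns_monomial_diag_tendsto[of t0 n] by (auto simp: convergent_def)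
  next
    case False
    then show ?thesis
      unfolding psdo_turns_monomial_off_diag[OF False] times_divide_eq_right[symmetric] diff_divide_distrib
      using rotated_kernel_avg_tendsto[of t0 0 a] rotated_kernel_avg_tendsto[of t0 "real n - of_int a" a]
      by (intro convergent_mult convergent_const convergent_diff) (auto simp: convergent_def)
  qed
  then show ?thesis unfolding monomial_op_def psdo_def by (simp add: convergent_LIMSEQ_iff)
qed

lemma monomial_op_nonneg:
  "monomial_op s \<rho> d t0 (int j) n = (if j = n then of_real (Gamma (1 + real n * s)) else 0)"
proof (cases "j = n")
  case True
  then show ?thesis
    using LIMSEQ_unique[OF monomial_op_tendsto psdo_turns_monomial_diag_tendsto[of t0 n]] by simp
next
  case False
  then have F: "int n \<noteq> int j" by simp
  define c where "c = real n - of_int (int j)"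
  \<comment> \<open>The sum is \<open>kernel_freq s (int n) i\<close>, a frequency that belongs to a
    natural exponent and hence is positive. Thus both means vanish off the diagonal.\<close>
  have nz: "c + kernel_freq s (int j) i \<noteq> 0" for i
    using kernel_freq_pos[of n i] by (simp add: c_def kernel_freq_def)
  have nz': "0 + kernel_freq s (int j) i \<noteq> 0" for i
    using kernel_freq_pos[of j i] by simp
  have "(\<lambda>N. psdo_turns s \<rho> d t0 N (\<lambda>\<zeta>. \<zeta> powi int j) (\<lambda>w. w ^ n) 0 / of_nat N) \<longlonglongrightarrow>
      of_real (- (d ^ Suc n * \<rho> powi (int j + 1) / (2 * pi * c))) * (cis (c * t0) * 0 - 0)"
    unfolding psdo_turns_monomial_off_diag[OF F] times_divide_eq_right[symmetric] diff_divide_distrib c_def[symmetric]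
    using rotated_kernel_avg_tendsto[of t0 0 "int j"] rotated_kernel_avg_tendsto[of t0 c "int j"]
    unfolding if_not_P[OF nz] if_not_P[OF nz'] by (intro tendsto_mult tendsto_const tendsto_diff) simp_all
  from LIMSEQ_unique[OF monomial_op_tendsto this] show ?thesis using False by simp
qed

end

section \<open>Series expansion of the operators\<close>

lemma norm_summable_on_prod:
  fixes f :: "'a \<Rightarrow> 'c :: {banach, real_normed_div_algebra}" and g :: "'b \<Rightarrow> 'c"
  assumes "(\<lambda>x. norm (f x)) summable_on A" "(\<lambda>y. norm (g y)) summable_on B"
  shows "(\<lambda>p. norm (f (fst p) * g (snd p))) summable_on A \<times> B"
  using assms
  by (intro Infinite_Sum.abs_summable_on_Sigma_iff[THEN iffD2])
    (simp add: norm_mult summable_on_cmult_right infsum_cmult_right' summable_on_cmult_left infsum_nonneg)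

lemma has_sum_prod:
  fixes f :: "'a \<Rightarrow> 'c :: {banach, real_normed_div_algebra}" and g :: "'b \<Rightarrow> 'c"
  assumes "(\<lambda>x. norm (f x)) summable_on A" "(\<lambda>y. norm (g y)) summable_on B" "(f has_sum S) A" "(g has_sum T) B"
  shows "((\<lambda>p. f (fst p) * g (snd p)) has_sum (S * T)) (A \<times> B)"
proof -
  have sm: "(\<lambda>p. f (fst p) * g (snd p)) summable_on A \<times> B"
    by (rule abs_summable_summable[OF norm_summable_on_prod[OF assms(1,2)]])
  have "infsum (\<lambda>p. f (fst p) * g (snd p)) (A \<times> B) = infsum (\<lambda>x. f x * T) A"
    using infsum_Sigma_banach[OF sm] assms(4) by (simp add: infsum_cmult_right' infsumI)
  also have "\<dots> = S * T" using assms(3) by (simp add: infsum_cmult_left' infsumI)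
  finally show ?thesis using sm by (metis has_sum_infsum)
qed

lemma has_sum_imp_sums_bij:
  fixes f :: "'i \<Rightarrow> 'c :: banach"
  assumes "bij (g :: nat \<Rightarrow> 'i)" "(f has_sum S) UNIV"
  shows "(\<lambda>p. f (g p)) sums S"
  using assms has_sum_reindex_bij_betw[of g UNIV UNIV f S] has_sum_imp_sums by metis

lemma abs_summable_imp_summable_bij:
  assumes "bij (g :: nat \<Rightarrow> 'i)" "(\<lambda>x. norm (f x)) summable_on UNIV"
  shows "summable (\<lambda>p. norm (f (g p)))"
  using assms summable_on_reindex_bij_betw[of g UNIV UNIV "\<lambda>x. norm (f x)"] summable_on_imp_summable by metis

lemma norm_interval_integral_le:
  fixes f :: "real \<Rightarrow> complex" and a b :: real
  assumes cont: "continuous_on UNIV f" and le: "\<And>t. norm (f t) \<le> M"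
  shows "norm (LBINT t=a..b. f t) \<le> M * \<bar>b - a\<bar>"
proof -
  have *: "norm (LBINT t=x..y. f t) \<le> M * (y - x)" if "x \<le> y" for x y :: real
    unfolding interval_integral_Icc[OF that]
    by (intro norm_set_integral_le borel_integrable_atLeastAtMost' continuous_on_subset[OF cont] that le) auto
  show ?thesis
  proof (cases "a \<le> b")
    case False
    then show ?thesis using *[of b a] by (subst interval_integral_endpoints_reverse) simp
  qed (use *[of a b] in simp)
qed

context
  fixes s \<rho> d :: real
  assumes s: "s > 0" and \<rho>: "\<rho> > 0" and d: "d > 0"
begin

text \<open>This bound grows with \<open>\<bar>t\<bar>\<close> but holds for negative exponents as
  well. It serves only to integrate series termwise over a fixed number of turns.\<close>

lemma norm_psdo_inner_monomial_le:
  "norm (psdo_inner s \<rho> (\<lambda>\<zeta>. \<zeta> powi a) 0 d t) \<le>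
    (1 + \<rho> * \<bar>t\<bar> * kernel_bound s (d * \<rho>)) * (\<rho> powi a + ray_moment s \<rho> d a)"
proof -
  let ?K = "kernel_bound s (d * \<rho>)"
  have K: "?K \<ge> 0" using s by (simp add: kernel_bound_def)
  have rm: "ray_moment s \<rho> d a \<ge> 0" by (rule ray_moment_nonneg[OF s \<rho> d])
  have ra: "\<rho> powi a > 0" using \<rho> by simp
  have Y: "norm (rotated_kernel_int s (d * \<rho>) a t) \<le> ?K * \<bar>t\<bar>"
    using norm_interval_integral_le[OF continuous_rotated_kernel[of UNIV s "d * \<rho>" a] norm_rotated_kernel_le[OF s], of 0 t]
    unfolding rotated_kernel_int_def zero_ereal_def by simp
  have "norm (psdo_inner s \<rho> (\<lambda>\<zeta>. \<zeta> powi a) 0 d t) \<le> ray_moment s \<rho> d a + \<rho> powi (a + 1) * norm (rotated_kernel_int s (d * \<rho>) a t)"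
    unfolding psdo_inner_monomial[OF s \<rho> d] norm_mult norm_cis mult_1_left
    by (rule order_trans[OF norm_triangle_ineq4]) (use rm \<rho> in \<open>simp add: norm_mult norm_power_int\<close>)
  also have "\<dots> \<le> ray_moment s \<rho> d a + \<rho> powi (a + 1) * (?K * \<bar>t\<bar>)"
    using \<rho> Y by (intro add_left_mono mult_left_mono) auto
  also have "\<dots> \<le> (1 + \<rho> * \<bar>t\<bar> * ?K) * (\<rho> powi a + ray_moment s \<rho> d a)"
    using \<rho> K rm ra by (simp add: power_int_add algebra_simps add_nonneg_nonneg)
  finally show ?thesis .
qed

lemma continuous_psdo_inner_monomial: "continuous_on A (psdo_inner s \<rho> (\<lambda>\<zeta>. \<zeta> powi a) 0 d)"
proof -
  have "continuous_on A (rotated_kernel_int s (d * \<rho>) a)"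
    using rotated_kernel_int_deriv by (meson continuous_on_vector_derivative)
  then show ?thesis
    unfolding psdo_inner_monomial[OF s \<rho> d, abs_def] by (intro continuous_intros)
qed

text \<open>Two majorants are at work: the first hypothesis bounds the integrals of the norms along
  the ray, the second gives absolute convergence on the arc, at \<open>x = \<rho>\<close>, and
  pointwise on the ray.\<close>

lemma psdo_inner_sums:
  fixes e :: "nat \<Rightarrow> complex" and a :: "nat \<Rightarrow> int"
  assumes e: "summable (\<lambda>q. norm (e q) * (\<rho> powi (a q) + ray_moment s \<rho> d (a q)))"
    and ab: "\<And>x. x \<ge> \<rho> \<Longrightarrow> summable (\<lambda>q. norm (e q) * x powi (a q))"
    and F: "\<And>\<zeta>. norm \<zeta> \<ge> \<rho> \<Longrightarrow> (\<lambda>q. e q * \<zeta> powi (a q)) sums (L \<zeta> * Mittag_Leffler s (z * \<zeta>))"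
  shows "(\<lambda>q. e q * psdo_inner s \<rho> (\<lambda>\<zeta>. \<zeta> powi (a q)) 0 d t) sums psdo_inner s \<rho> L z d t"
proof -
  let ?F = "\<lambda>\<zeta>. L \<zeta> * Mittag_Leffler s (z * \<zeta>)"
  define k1 where "k1 u = psdo_kernel (1 / s) (d * \<rho>) (t - u) * (- \<i> * of_real \<rho> * cis (- u))" for u
  define k2 where "k2 x = psdo_kernel (1 / s) (d * x) 0 * cis (- t)" for x
  have ck1: "continuous_on A k1" for A
    unfolding k1_def by (intro continuous_intros continuous_on_compose2[OF continuous_psdo_kernel[of UNIV]]) auto
  have nk1: "norm (k1 u) \<le> kernel_bound s (d * \<rho>) * \<rho>" for u
    using norm_psdo_kernel_le[OF s, of "d * \<rho>" "t - u"] \<rho> by (simp add: k1_def norm_mult mult_right_mono)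
  have "(\<lambda>q. LBINT u=0..t. e q * (of_real \<rho> * cis (- u)) powi (a q) * k1 u) sums
      (LBINT u=0..t. (\<Sum>q. e q * (of_real \<rho> * cis (- u)) powi (a q) * k1 u))"
    unfolding zero_ereal_def
  proof (rule interval_integral_sums)
    show "continuous_on UNIV (\<lambda>u. e q * (of_real \<rho> * cis (- u)) powi (a q) * k1 u)" for q
      using \<rho> by (intro continuous_intros ck1) auto
    show "norm (e q * (of_real \<rho> * cis (- u)) powi (a q) * k1 u) \<le> norm (e q) * \<rho> powi (a q) * (kernel_bound s (d * \<rho>) * \<rho>)" for q u
      using nk1[of u] \<rho> by (simp add: norm_mult norm_power_int mult_left_mono)
    show "summable (\<lambda>q. norm (e q) * \<rho> powi (a q) * (kernel_bound s (d * \<rho>) * \<rho>))"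
      by (intro summable_mult2 ab) simp
  qed
  moreover have "(\<Sum>q. e q * (of_real \<rho> * cis (- u)) powi (a q) * k1 u) = ?F (of_real \<rho> * cis (- u)) * k1 u" for u
    using sums_mult2[OF F[of "of_real \<rho> * cis (- u)"], of "k1 u"] \<rho> by (simp add: sums_iff norm_mult)
  ultimately have 1: "(\<lambda>q. e q * (LBINT u=0..t. (of_real \<rho> * cis (- u)) powi (a q) * k1 u)) sums
      (LBINT u=0..t. ?F (of_real \<rho> * cis (- u)) * k1 u)"
    by (simp add: mult.assoc)
  define f where "f q x = indicator {\<rho><..} x *\<^sub>R (e q * (of_real x * cis (- t)) powi (a q) * k2 x)" for q x
  have f_eq: "f q x = (e q * cis (of_int (a q) * (- t)) * cis (- t)) * of_real (indicator {\<rho><..} x *\<^sub>R (x powi (a q) * ray_weight s d x))" for q x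
    by (simp add: f_def k2_def psdo_kernel_0 power_int_mult_distrib cis_power_int scaleR_conv_of_real mult_ac)
  have fi: "integrable lborel (f q)" for q
    unfolding f_eq using ray_integrable[OF s \<rho> d, of "a q"] unfolding set_integrable_def
    by (intro integrable_mult_right integrable_of_real) auto
  have nf: "norm (f q x) = norm (e q) * (indicator {\<rho><..} x *\<^sub>R (x powi (a q) * ray_weight s d x))" for q x
    using \<rho> ray_weight_nonneg[OF s, of d x] by (auto simp: f_eq norm_mult norm_power_int indicator_def)
  have nfi: "(\<integral>x. norm (f q x) \<partial>lborel) = norm (e q) * ray_moment s \<rho> d (a q)" for q
    unfolding nf by (simp add: ray_moment_def set_lebesgue_integral_def)
  have "(\<lambda>q. integral\<^sup>L lborel (f q)) sums (\<integral>x. (\<Sum>q. f q x) \<partial>lborel)"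
  proof (rule sums_integral[OF fi])
    show "AE x in lborel. summable (\<lambda>q. norm (f q x))"
    proof (rule AE_I2)
      fix x show "summable (\<lambda>q. norm (f q x))"
        using summable_mult2[OF ab[of x], of "ray_weight s d x"] unfolding nf by (auto simp: indicator_def mult.assoc)
    qed
    show "summable (\<lambda>q. \<integral>x. norm (f q x) \<partial>lborel)"
      unfolding nfi
      by (rule summable_comparison_test'[OF e, of 0])
        (use ray_moment_nonneg[OF s \<rho> d] \<rho> in \<open>auto simp: abs_mult intro!: mult_left_mono\<close>)
  qed
  moreover have "(\<Sum>q. f q x) = indicator {\<rho><..} x *\<^sub>R (?F (of_real x * cis (- t)) * k2 x)" for x
    using sums_mult2[OF F[of "of_real x * cis (- t)"], of "k2 x"] \<rho> by (auto simp: f_def sums_iff norm_mult indicator_def)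
  moreover have "integral\<^sup>L lborel (f q) = e q * (LBINT x=\<rho>..\<infinity>. (of_real x * cis (- t)) powi (a q) * k2 x)" for q
    unfolding interval_integral_to_infinity_eq set_lebesgue_integral_def f_def
    by (subst integral_mult_right_zero[symmetric]) (intro Bochner_Integration.integral_cong; simp add: mult.assoc)
  ultimately have 2: "(\<lambda>q. e q * (LBINT x=\<rho>..\<infinity>. (of_real x * cis (- t)) powi (a q) * k2 x)) sums
      (LBINT x=\<rho>..\<infinity>. ?F (of_real x * cis (- t)) * k2 x)"
    by (simp only: interval_integral_to_infinity_eq set_lebesgue_integral_def)
  show ?thesis
    using sums_add[OF 1 2]
    unfolding psdo_inner_def Let_def k1_def k2_def mult_zero_left Mittag_Leffler_0 mult_1_right
    by (simp add: mult.assoc distrib_left)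
qed

text \<open>Two exchanges: for a fixed \<open>N\<close> the series is integrated termwise with a
  majorant depending on \<open>N\<close>, and then the limit of the means is taken termwise with the
  majorant of \<open>psdo_turns_monomial_bound\<close>.\<close>

lemma psdo_sums:
  fixes c :: "nat \<Rightarrow> complex" and a :: "nat \<Rightarrow> int" and n :: "nat \<Rightarrow> nat"
  assumes c: "summable (\<lambda>p. norm (c p) * (d ^ n p * (\<rho> powi (a p) + ray_moment s \<rho> d (a p))))"
    and F: "\<And>t. (\<lambda>p. c p * ((of_real d * cis t) ^ n p * psdo_inner s \<rho> (\<lambda>\<zeta>. \<zeta> powi (a p)) 0 d t))
      sums (\<phi> (of_real d * cis t) * psdo_inner s \<rho> L z d t)"
  shows "(\<lambda>p. c p * monomial_op s \<rho> d t0 (a p) (n p)) sums psdo s \<rho> d t0 L \<phi> z"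
proof -
  define m where "m p N = psdo_turns s \<rho> d t0 N (\<lambda>\<zeta>. \<zeta> powi a p) (\<lambda>w. w ^ n p) 0 / of_nat N" for p N
  define C where "C = d * (1 + 2 * \<rho> * (1 + s) * kernel_bound s (d * \<rho>))"
  define M where "M p = norm (c p) * (C * (d ^ n p * (\<rho> powi (a p) + ray_moment s \<rho> d (a p))))" for p
  have M: "summable M" unfolding M_def using summable_mult[OF c, of C] by (simp add: mult_ac)
  have b: "norm (c p * m p N) \<le> M p" for p N
    unfolding M_def m_def norm_mult C_def
    by (intro mult_left_mono psdo_turns_monomial_bound[OF s \<rho> d]) simp
  have lim: "((\<lambda>N. c p * m p N) \<longlongrightarrow> c p * monomial_op s \<rho> d t0 (a p) (n p)) sequentially" for p
    unfolding m_def by (intro tendsto_mult_left monomial_op_tendsto[OF s \<rho> d])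
  have T: "summable (\<lambda>p. norm (c p * monomial_op s \<rho> d t0 (a p) (n p)))"
    "((\<lambda>N. \<Sum>p. c p * m p N) \<longlongrightarrow> (\<Sum>p. c p * monomial_op s \<rho> d t0 (a p) (n p))) sequentially"
    using tannerys_theorem[of "\<lambda>p N. c p * m p N", OF lim always_eventually M] b by auto
  have sums: "(\<lambda>p. c p * m p N) sums (psdo_turns s \<rho> d t0 N L \<phi> z / of_nat N)" for N
  proof -
    define b where "b = t0 + 2 * pi * real N"
    have tb: "t0 \<le> b" by (simp add: b_def)
    \<comment> \<open>Absorbs the growth in \<open>\<bar>t\<bar>\<close>, which is at most
      \<open>\<bar>t0\<bar> + \<bar>b\<bar>\<close> on the interval of integration.\<close>
    define D where "D = d * (1 + \<rho> * (\<bar>t0\<bar> + \<bar>b\<bar>) * kernel_bound s (d * \<rho>))"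
    define f where "f p t = c p * ((of_real d * cis t) ^ n p * psdo_inner s \<rho> (\<lambda>\<zeta>. \<zeta> powi (a p)) 0 d t) * (\<i> * of_real d * cis t)" for p t
    have K: "kernel_bound s (d * \<rho>) \<ge> 0" using s by (simp add: kernel_bound_def)
    have S: "(\<lambda>p. LINT t:{t0..b}|lborel. f p t) sums (LINT t:{t0..b}|lborel. (\<Sum>p. f p t))"
    proof (rule set_integral_suminf(2)[OF tb])
      show "continuous_on {t0..b} (f p)" for p
        unfolding f_def by (intro continuous_intros continuous_psdo_inner_monomial)
      show "norm (f p t) \<le> norm (c p) * (D * (d ^ n p * (\<rho> powi (a p) + ray_moment s \<rho> d (a p))))" if "t \<in> {t0..b}" for p t
      proof -
        have t: "\<bar>t\<bar> \<le> \<bar>t0\<bar> + \<bar>b\<bar>" using that by auto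
        have "norm (psdo_inner s \<rho> (\<lambda>\<zeta>. \<zeta> powi (a p)) 0 d t) \<le>
          (1 + \<rho> * \<bar>t\<bar> * kernel_bound s (d * \<rho>)) * (\<rho> powi a p + ray_moment s \<rho> d (a p))"
          by (rule norm_psdo_inner_monomial_le)
        also have "\<dots> \<le> (1 + \<rho> * (\<bar>t0\<bar> + \<bar>b\<bar>) * kernel_bound s (d * \<rho>)) * (\<rho> powi a p + ray_moment s \<rho> d (a p))"
          using t \<rho> K ray_moment_nonneg[OF s \<rho> d, of "a p"] by (intro mult_right_mono add_left_mono mult_left_mono) auto
        finally have "norm (c p) * d ^ n p * d * norm (psdo_inner s \<rho> (\<lambda>\<zeta>. \<zeta> powi (a p)) 0 d t) \<le> norm (c p) * d ^ n p * d * ..."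
          using d by (intro mult_left_mono) auto
        then show ?thesis using d by (simp add: f_def norm_mult norm_power D_def mult_ac)
      qed
      show "summable (\<lambda>p. norm (c p) * (D * (d ^ n p * (\<rho> powi (a p) + ray_moment s \<rho> d (a p)))))"
        using summable_mult[OF c, of D] by (simp add: mult_ac)
    qed
    moreover have "(\<Sum>p. f p t) = \<phi> (of_real d * cis t) * psdo_inner s \<rho> L z d t * (\<i> * of_real d * cis t)" for t
      using sums_mult2[OF F[of t], of "\<i> * of_real d * cis t"] by (simp add: f_def sums_iff)
    ultimately have "(\<lambda>p. LINT t:{t0..b}|lborel. f p t) sums
        (LINT t:{t0..b}|lborel. \<phi> (of_real d * cis t) * psdo_inner s \<rho> L z d t * (\<i> * of_real d * cis t))" by simp
    then have "(\<lambda>p. 1 / (2 * of_real pi * \<i>) * (LINT t:{t0..b}|lborel. f p t)) sums psdo_turns s \<rho> d t0 N L \<phi> z"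
      unfolding psdo_turns_def b_def[symmetric] by (rule sums_mult)
    moreover have "1 / (2 * of_real pi * \<i>) * (LINT t:{t0..b}|lborel. f p t) = c p * psdo_turns s \<rho> d t0 N (\<lambda>\<zeta>. \<zeta> powi a p) (\<lambda>w. w ^ n p) 0" for p
      unfolding f_def psdo_turns_def b_def mult.assoc set_integral_mult_right by (simp only: mult_ac)
    ultimately show ?thesis
      unfolding m_def times_divide_eq_right by (intro sums_divide) simp
  qed
  have "psdo s \<rho> d t0 L \<phi> z = (\<Sum>p. c p * monomial_op s \<rho> d t0 (a p) (n p))"
    unfolding psdo_def using T(2) sums by (intro limI) (simp add: sums_iff)
  then show ?thesis using summable_sums[OF summable_norm_cancel[OF T(1)]] by simp
qed


text \<open>Here \<open>n\<close> indexes the Taylor series of the function, \<open>m\<close> the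
  series \<open>Mittag_Leffler\<close>, and \<open>i\<close> the expansion of the symbol in powers
  falling from \<open>N\<close>. The last two exponents merge into \<open>N + m - i\<close>.\<close>

definition psdo_term :: "(nat \<Rightarrow> complex) \<Rightarrow> (nat \<Rightarrow> complex) \<Rightarrow> nat \<Rightarrow> real \<Rightarrow> complex \<Rightarrow> nat \<times> nat \<times> nat \<Rightarrow> complex" where
  "psdo_term ph H N t0 z = (\<lambda>(n, m, i). ph n * (z ^ m / of_real (Gamma (1 + real m * s)) * H i) *
     monomial_op s \<rho> d t0 (int (N + m) - int i) n)"

text \<open>The \<open>m\<close>-th term of \<open>Mittag_Leffler\<close> times the majorant from
  \<open>ray_moment_le\<close> of the weight at the exponent \<open>N + m\<close>.\<close>

definition shift_factor :: "nat \<Rightarrow> real \<Rightarrow> nat \<Rightarrow> real" where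
  "shift_factor N x m = x ^ m / Gamma (1 + real m * s) * (\<rho> ^ (N + m) + Gamma (1 + real (N + m) * s) / d ^ Suc (N + m))"

lemma Gamma_pos: "Gamma (1 + real m * s) > 0"
  by (rule Gamma_1_plus_pos) (use s in simp)

lemma shift_factor_nonneg: "x \<ge> 0 \<Longrightarrow> shift_factor N x m \<ge> 0"
  using Gamma_pos[of m] Gamma_pos[of "N + m"] \<rho> d by (simp add: shift_factor_def)

text \<open>By \<open>Gamma_1_add_le\<close> the quotient of the two Gamma values grows only
  geometrically in \<open>m\<close>, with ratio \<open>4 powr s\<close>, while \<open>N\<close>
  costs the factor Gamma(1 + N s). The geometric part converges exactly under the condition
  \<open>4 powr s * x < d\<close>.\<close>

lemma shift_factor_le:
  assumes "x \<ge> 0"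
  shows "shift_factor N x m \<le> \<rho> ^ N * ((\<rho> * x) ^ m / Gamma (1 + real m * s)) +
     2 * Gamma (1 + real N * s) * (4 powr s / d) ^ N / d * (4 powr s * x / d) ^ m"
proof -
  have "Gamma (1 + (real N * s + real m * s)) \<le> 2 * (4 powr (real N * s + real m * s) * Gamma (1 + real N * s) * Gamma (1 + real m * s))"
    using s by (intro Gamma_1_add_le) auto
  also have "4 powr (real N * s + real m * s) = (4 powr s) ^ N * (4 powr s) ^ m"
    by (simp add: powr_add mult.commute[of _ s] powr_powr[symmetric] powr_realpow)
  finally have "Gamma (1 + real (N + m) * s) / Gamma (1 + real m * s) \<le> 2 * Gamma (1 + real N * s) * ((4 powr s) ^ N * (4 powr s) ^ m)"
    using Gamma_pos[of m] by (simp add: divide_le_eq algebra_simps)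
  then have "x ^ m / d ^ Suc (N + m) * (Gamma (1 + real (N + m) * s) / Gamma (1 + real m * s)) \<le>
     x ^ m / d ^ Suc (N + m) * (2 * Gamma (1 + real N * s) * ((4 powr s) ^ N * (4 powr s) ^ m))"
    using assms d by (intro mult_left_mono) auto
  also have "\<dots> = 2 * Gamma (1 + real N * s) * (4 powr s / d) ^ N / d * (4 powr s * x / d) ^ m"
    using d by (simp add: power_add power_mult_distrib power_divide mult_ac)
  finally show ?thesis
    by (simp add: shift_factor_def distrib_left power_add power_mult_distrib mult_ac)
qed

context
  fixes x :: real
  assumes x: "x \<ge> 0" "4 powr s * x < d"
begin

lemma shift_bound_sums:
  "(\<lambda>m. \<rho> ^ N * ((\<rho> * x) ^ m / Gamma (1 + real m * s)) + 2 * Gamma (1 + real N * s) * (4 powr s / d) ^ N / d * (4 powr s * x / d) ^ m)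
    sums (\<rho> ^ N * (\<Sum>m. (\<rho> * x) ^ m / Gamma (1 + real m * s)) + 2 * Gamma (1 + real N * s) * (4 powr s / d) ^ N / d * (1 / (1 - 4 powr s * x / d)))"
  using x \<rho> d s
  by (intro sums_add sums_mult geometric_sums summable_sums summable_power_div_Gamma) auto

lemma summable_shift_factor: "summable (shift_factor N x)"
  by (rule summable_comparison_test'[OF sums_summable[OF shift_bound_sums], of 0])
    (use shift_factor_nonneg[OF x(1)] shift_factor_le[OF x(1)] in auto)

lemma suminf_shift_factor_le:
  "suminf (shift_factor N x) \<le> \<rho> ^ N * (\<Sum>m. (\<rho> * x) ^ m / Gamma (1 + real m * s)) +
    2 * Gamma (1 + real N * s) * (4 powr s / d) ^ N / d * (1 / (1 - 4 powr s * x / d))"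
  unfolding sums_unique[OF shift_bound_sums]
  by (intro suminf_le summable_shift_factor sums_summable[OF shift_bound_sums] shift_factor_le x)

end

text \<open>Each step down in the expansion of the symbol costs a factor
  \<open>inverse \<rho>\<close>. This separates \<open>i\<close> from \<open>m\<close> and turns the
  majorant of the triple series into a product.\<close>

lemma weight_shift_le:
  fixes z h :: complex
  assumes "norm z = x"
  shows "norm (z ^ m / of_real (Gamma (1 + real m * s)) * h) *
      (\<rho> powi (int (N + m) - int i) + ray_moment s \<rho> d (int (N + m) - int i)) \<le> shift_factor N x m * (norm h * inverse \<rho> ^ i)"
proof -
  have "\<rho> powi (int (N + m) - int i) + ray_moment s \<rho> d (int (N + m) - int i) \<le>
     inverse \<rho> ^ i * (\<rho> ^ (N + m) + Gamma (1 + real (N + m) * s) / d ^ Suc (N + m))"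
    using ray_moment_le[OF s \<rho> d, of "N + m" i] \<rho>
    by (simp add: power_int_diff power_int_minus divide_inverse power_inverse distrib_left mult.commute power_int_add power_add)
  then have "norm (z ^ m / of_real (Gamma (1 + real m * s)) * h) *
      (\<rho> powi (int (N + m) - int i) + ray_moment s \<rho> d (int (N + m) - int i)) \<le>
      norm (z ^ m / of_real (Gamma (1 + real m * s)) * h) * (inverse \<rho> ^ i * (\<rho> ^ (N + m) + Gamma (1 + real (N + m) * s) / d ^ Suc (N + m)))"
    by (intro mult_left_mono) auto
  also have "\<dots> = shift_factor N x m * (norm h * inverse \<rho> ^ i)"
    using Gamma_pos[of m] by (simp add: shift_factor_def norm_mult norm_divide norm_power assms mult_ac)
  finally show ?thesis .
qed

text \<open>The majorant is a product of three series, one for each index; this yields absolute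
  summability and the norm bound together. The inner integral is expanded over \<open>(m, i)\<close>
  first and multiplied with the Taylor series on the circle afterwards.\<close>

lemma psdo_series:
  fixes L \<phi> :: "complex \<Rightarrow> complex" and H ph :: "nat \<Rightarrow> complex" and N :: nat
  assumes H: "summable (\<lambda>i. norm (H i) * inverse \<rho> ^ i)"
    and L: "\<And>\<zeta>. norm \<zeta> \<ge> \<rho> \<Longrightarrow> (\<lambda>i. H i * \<zeta> powi (int N - int i)) sums L \<zeta>"
    and ph: "summable (\<lambda>n. norm (ph n) * d ^ n)"
    and \<phi>: "\<And>w. norm w = d \<Longrightarrow> (\<lambda>n. ph n * w ^ n) sums \<phi> w"
    and z: "4 powr s * norm z < d"
  defines "C \<equiv> d * (1 + 2 * \<rho> * (1 + s) * kernel_bound s (d * \<rho>))"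
  shows "(\<lambda>p. norm (psdo_term ph H N t0 z p)) summable_on UNIV"
    and "(psdo_term ph H N t0 z has_sum psdo s \<rho> d t0 L \<phi> z) UNIV"
    and "norm (psdo s \<rho> d t0 L \<phi> z) \<le>
      C * ((\<Sum>n. norm (ph n) * d ^ n) * (suminf (shift_factor N (norm z)) * (\<Sum>i. norm (H i) * inverse \<rho> ^ i)))"
proof -
  \<comment> \<open>Enumerates the triples, because \<open>psdo_inner_sums\<close> and
    \<open>psdo_sums\<close> are about sequences.\<close>
  define dec where "dec = (\<lambda>p. (fst (prod_decode p), prod_decode (snd (prod_decode p))))"
  have bd: "bij dec"
    unfolding dec_def by (rule bijI', auto simp: prod_eq_iff) (metis prod_decode_inverse prod_encode_inverse prod.collapse fst_conv snd_conv)+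
  have bp: "bij prod_decode" by (rule bij_prod_decode)
  define g where "g m = z ^ m / of_real (Gamma (1 + real m * s))" for m
  define e where "e q = g (fst q) * H (snd q)" for q
  define a where "a q = int (N + fst q) - int (snd q)" for q :: "nat \<times> nat"
  define W where "W b = \<rho> powi b + ray_moment s \<rho> d b" for b
  have W: "W b \<ge> 0" for b using \<rho> ray_moment_nonneg[OF s \<rho> d, of b] by (simp add: W_def)
  have sf: "summable (shift_factor N (norm z))" by (rule summable_shift_factor) (use z in auto)
  have P1: "(\<lambda>q. norm (shift_factor N (norm z) (fst q) * (norm (H (snd q)) * inverse \<rho> ^ snd q))) summable_on UNIV \<times> UNIV"
    using sf H \<rho> shift_factor_nonneg[of "norm z" N]
    by (intro norm_summable_on_prod) (auto simp: abs_mult summable_on_UNIV_nonneg_real_iff)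
  have hs1: "((\<lambda>q. shift_factor N (norm z) (fst q) * (norm (H (snd q)) * inverse \<rho> ^ snd q)) has_sum
      (suminf (shift_factor N (norm z)) * (\<Sum>i. norm (H i) * inverse \<rho> ^ i))) UNIV"
    unfolding UNIV_Times_UNIV[symmetric] using sf H \<rho> shift_factor_nonneg[of "norm z" N]
    by (intro has_sum_prod) (auto simp: abs_mult summable_on_UNIV_nonneg_real_iff intro!: norm_summable_imp_has_sum summable_sums)
  have eW: "norm (e q) * W (a q) \<le> shift_factor N (norm z) (fst q) * (norm (H (snd q)) * inverse \<rho> ^ snd q)" for q
    unfolding e_def a_def g_def W_def by (rule weight_shift_le) simp
  have P2: "(\<lambda>q. norm (norm (e q) * W (a q))) summable_on UNIV"
    by (rule Infinite_Sum.abs_summable_on_comparison_test[OF P1[unfolded UNIV_Times_UNIV]])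
      (use eW W \<rho> shift_factor_nonneg[of "norm z" N] in \<open>auto simp: abs_mult\<close>)
  have inner: "(\<lambda>q. e (prod_decode q) * psdo_inner s \<rho> (\<lambda>\<zeta>. \<zeta> powi a (prod_decode q)) 0 d t) sums psdo_inner s \<rho> L z d t" for t
  proof (rule psdo_inner_sums)
    show "summable (\<lambda>q. norm (e (prod_decode q)) * (\<rho> powi a (prod_decode q) + ray_moment s \<rho> d (a (prod_decode q))))"
      using abs_summable_imp_summable_bij[OF bp P2] W by (simp add: W_def abs_mult abs_of_nonneg)
  next
    have absg: "summable (\<lambda>m. norm (g m) * x ^ m)" if "x \<ge> 0" for x
      using summable_power_div_Gamma[OF s, of "x * norm z"] that Gamma_pos
      by (simp add: g_def norm_divide norm_power power_mult_distrib mult_ac abs_of_pos)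
    have absH: "summable (\<lambda>i. norm (H i) * x powi (int N - int i))" if "x \<ge> \<rho>" for x
    proof (rule summable_comparison_test'[OF summable_mult[OF H, of "x ^ N"], of 0])
      fix i
      have "inverse x ^ i \<le> inverse \<rho> ^ i" using that \<rho> by (intro power_mono) auto
      then show "norm (norm (H i) * x powi (int N - int i)) \<le> x ^ N * (norm (H i) * inverse \<rho> ^ i)"
        using that \<rho> by (simp add: power_int_diff divide_inverse power_inverse mult.left_commute mult_left_mono)
    qed
    have absgx: "(\<lambda>m. norm (g m * \<zeta> ^ m)) summable_on UNIV" for \<zeta>
      using absg[of "norm \<zeta>"] by (simp add: summable_on_UNIV_nonneg_real_iff norm_mult norm_power)
    have absHx: "(\<lambda>i. norm (H i * \<zeta> powi (int N - int i))) summable_on UNIV" if "norm \<zeta> \<ge> \<rho>" for \<zeta>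
      using absH[OF that] by (simp add: summable_on_UNIV_nonneg_real_iff norm_mult norm_power_int)
    have tm: "e q * \<zeta> powi a q = (g (fst q) * \<zeta> ^ fst q) * (H (snd q) * \<zeta> powi (int N - int (snd q)))" if "norm \<zeta> \<ge> \<rho>" for \<zeta> q
    proof -
      have "\<zeta> \<noteq> 0" using that \<rho> by auto
      then show ?thesis by (simp add: e_def a_def power_int_diff power_int_add power_add mult_ac)
    qed
    show "summable (\<lambda>q. norm (e (prod_decode q)) * x powi a (prod_decode q))" if "x \<ge> \<rho>" for x
    proof -
      have x: "norm (complex_of_real x) \<ge> \<rho>" "x > 0" using that \<rho> by auto
      have "(\<lambda>q. norm (e q * of_real x powi a q)) summable_on UNIV"
        unfolding tm[OF x(1)] using norm_summable_on_prod[OF absgx absHx[OF x(1)]] by simp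
      from abs_summable_imp_summable_bij[OF bp this] show ?thesis using x by (simp add: norm_mult norm_power_int)
    qed
    fix \<zeta> :: complex assume \<zeta>: "norm \<zeta> \<ge> \<rho>"
    have "(\<lambda>m. g m * \<zeta> ^ m) sums Mittag_Leffler s (z * \<zeta>)"
      unfolding Mittag_Leffler_def using summable_on_imp_summable[OF absgx[of \<zeta>]]
      by (auto simp: g_def power_mult_distrib intro!: summable_sums dest!: summable_norm_cancel)
    then have 1: "((\<lambda>m. g m * \<zeta> ^ m) has_sum Mittag_Leffler s (z * \<zeta>)) UNIV"
      using summable_on_imp_summable[OF absgx] by (rule norm_summable_imp_has_sum[rotated])
    have 2: "((\<lambda>i. H i * \<zeta> powi (int N - int i)) has_sum L \<zeta>) UNIV"
      using summable_on_imp_summable[OF absHx[OF \<zeta>]] L[OF \<zeta>] by (rule norm_summable_imp_has_sum)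
    have "((\<lambda>q. e q * \<zeta> powi a q) has_sum (L \<zeta> * Mittag_Leffler s (z * \<zeta>))) UNIV"
      unfolding tm[OF \<zeta>] using has_sum_prod[OF absgx absHx[OF \<zeta>] 1 2] by (simp add: mult.commute)
    then show "(\<lambda>q. e (prod_decode q) * \<zeta> powi a (prod_decode q)) sums (L \<zeta> * Mittag_Leffler s (z * \<zeta>))"
      by (rule has_sum_imp_sums_bij[OF bp])
  qed
  define c where "c p = ph (fst p) * e (snd p)" for p
  define B where "B p = (norm (ph (fst p)) * d ^ fst p) * (shift_factor N (norm z) (fst (snd p)) * (norm (H (snd (snd p))) * inverse \<rho> ^ snd (snd p)))" for p
  have ph': "(\<lambda>n. norm (norm (ph n) * d ^ n)) summable_on UNIV"
    using ph d by (simp add: summable_on_UNIV_nonneg_real_iff abs_mult)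
  have B: "(\<lambda>p. norm (B p)) summable_on UNIV"
    unfolding B_def using norm_summable_on_prod[OF ph' P1] by simp
  have hsB: "(B has_sum ((\<Sum>n. norm (ph n) * d ^ n) * (suminf (shift_factor N (norm z)) * (\<Sum>i. norm (H i) * inverse \<rho> ^ i)))) UNIV"
  proof -
    have "((\<lambda>n. norm (ph n) * d ^ n) has_sum (\<Sum>n. norm (ph n) * d ^ n)) UNIV"
      using ph d by (intro norm_summable_imp_has_sum summable_sums) (auto simp: abs_mult)
    from has_sum_prod[OF ph' P1[unfolded UNIV_Times_UNIV] this hs1]
    show ?thesis unfolding B_def UNIV_Times_UNIV .
  qed
  have B0: "B p \<ge> 0" for p unfolding B_def using d \<rho> shift_factor_nonneg[of "norm z" N] by auto
  have cW: "norm (c p) * (d ^ fst p * W (a (snd p))) \<le> B p" for p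
  proof -
    have "norm (c p) * (d ^ fst p * W (a (snd p))) = (norm (ph (fst p)) * d ^ fst p) * (norm (e (snd p)) * W (a (snd p)))"
      by (simp add: c_def norm_mult mult_ac)
    also have "\<dots> \<le> B p" unfolding B_def using eW d by (intro mult_left_mono) auto
    finally show ?thesis .
  qed
  have term_eq: "psdo_term ph H N t0 z p = c p * monomial_op s \<rho> d t0 (a (snd p)) (fst p)" for p
    by (simp add: psdo_term_def c_def e_def g_def a_def case_prod_unfold mult_ac)
  have C: "C \<ge> 0" using s \<rho> d by (simp add: C_def kernel_bound_def)
  \<comment> \<open>The bound that is uniform in the number of turns passes to the limit.\<close>
  have mb: "norm (monomial_op s \<rho> d t0 b n) \<le> C * (d ^ n * W b)" for b n
    by (rule tendsto_le[OF _ tendsto_const tendsto_norm[OF monomial_op_tendsto[OF s \<rho> d]]])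
      (use psdo_turns_monomial_bound[OF s \<rho> d] in \<open>auto simp: C_def W_def\<close>)
  have tb: "norm (psdo_term ph H N t0 z p) \<le> C * B p" for p
  proof -
    have "norm (psdo_term ph H N t0 z p) \<le> norm (c p) * (C * (d ^ fst p * W (a (snd p))))"
      unfolding term_eq norm_mult by (intro mult_left_mono mb) auto
    also have "\<dots> \<le> C * B p" using mult_left_mono[OF cW[of p] C] by (simp add: mult_ac)
    finally show ?thesis .
  qed
  have CB: "(\<lambda>p. norm (C * B p)) summable_on UNIV"
    using B C by (simp add: abs_mult summable_on_cmult_right)
  show abs: "(\<lambda>p. norm (psdo_term ph H N t0 z p)) summable_on UNIV"
    by (rule Infinite_Sum.abs_summable_on_comparison_test[OF CB]) (use tb B0 C in \<open>auto simp: abs_mult\<close>)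
  have "(\<lambda>p. c (dec p) * monomial_op s \<rho> d t0 (a (snd (dec p))) (fst (dec p))) sums psdo s \<rho> d t0 L \<phi> z"
  proof (rule psdo_sums)
    have "(\<lambda>p. norm (norm (c p) * (d ^ fst p * W (a (snd p))))) summable_on UNIV"
      by (rule Infinite_Sum.abs_summable_on_comparison_test[OF B]) (use cW B0 d W in \<open>auto simp: abs_mult\<close>)
    from abs_summable_imp_summable_bij[OF bd this]
    show "summable (\<lambda>p. norm (c (dec p)) * (d ^ fst (dec p) * (\<rho> powi a (snd (dec p)) + ray_moment s \<rho> d (a (snd (dec p))))))"
      using d W by (simp add: W_def abs_mult)
    fix t
    define y where "y q = e q * psdo_inner s \<rho> (\<lambda>\<zeta>. \<zeta> powi a q) 0 d t" for q
    define w where "w = complex_of_real d * cis t"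
    have w: "norm w = d" using d by (simp add: w_def norm_mult)
    define D where "D = 1 + \<rho> * \<bar>t\<bar> * kernel_bound s (d * \<rho>)"
    have D: "D \<ge> 0" using \<rho> s by (simp add: D_def kernel_bound_def)
    have "(\<lambda>q. norm (D * (norm (e q) * W (a q)))) summable_on UNIV"
      using P2 D by (simp add: abs_mult summable_on_cmult_right)
    moreover have yb: "norm (y q) \<le> norm (D * (norm (e q) * W (a q)))" for q
    proof -
      have "norm (y q) \<le> norm (e q) * (D * W (a q))"
        unfolding y_def norm_mult D_def W_def by (intro mult_left_mono norm_psdo_inner_monomial_le) auto
      also have "\<dots> \<le> norm (D * (norm (e q) * W (a q)))" using D W by (simp add: abs_mult mult_ac)
      finally show ?thesis .
    qed
    ultimately have ys: "(\<lambda>q. norm (y q)) summable_on UNIV"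
      by (rule Infinite_Sum.abs_summable_on_comparison_test)
    have ysum: "(y has_sum psdo_inner s \<rho> L z d t) UNIV"
    proof -
      have "((\<lambda>q. y (prod_decode q)) has_sum psdo_inner s \<rho> L z d t) UNIV"
        using abs_summable_imp_summable_bij[OF bp ys] inner[of t] unfolding y_def by (rule norm_summable_imp_has_sum)
      then show ?thesis using has_sum_reindex_bij_betw[OF bp] by metis
    qed
    have phw: "summable (\<lambda>n. norm (ph n * w ^ n))" using ph by (simp add: norm_mult norm_power w)
    have "((\<lambda>p. (ph (fst p) * w ^ fst p) * y (snd p)) has_sum (\<phi> w * psdo_inner s \<rho> L z d t)) (UNIV \<times> UNIV)"
      using phw ys ysum \<phi>[OF w]
      by (intro has_sum_prod norm_summable_imp_has_sum) (auto simp: summable_on_UNIV_nonneg_real_iff)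
    then have "((\<lambda>p. c p * (w ^ fst p * psdo_inner s \<rho> (\<lambda>\<zeta>. \<zeta> powi a (snd p)) 0 d t)) has_sum (\<phi> w * psdo_inner s \<rho> L z d t)) UNIV"
      by (simp add: c_def y_def mult_ac)
    from has_sum_imp_sums_bij[OF bd this]
    show "(\<lambda>p. c (dec p) * ((of_real d * cis t) ^ fst (dec p) * psdo_inner s \<rho> (\<lambda>\<zeta>. \<zeta> powi a (snd (dec p))) 0 d t)) sums
       (\<phi> (of_real d * cis t) * psdo_inner s \<rho> L z d t)" unfolding w_def .
  qed
  then have "(\<lambda>p. psdo_term ph H N t0 z (dec p)) sums psdo s \<rho> d t0 L \<phi> z" by (simp only: term_eq)
  with abs_summable_imp_summable_bij[OF bd abs] have "((\<lambda>p. psdo_term ph H N t0 z (dec p)) has_sum psdo s \<rho> d t0 L \<phi> z) UNIV"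
    by (rule norm_summable_imp_has_sum)
  then show hs: "(psdo_term ph H N t0 z has_sum psdo s \<rho> d t0 L \<phi> z) UNIV"
    using has_sum_reindex_bij_betw[OF bd] by metis
  show "norm (psdo s \<rho> d t0 L \<phi> z) \<le>
      C * ((\<Sum>n. norm (ph n) * d ^ n) * (suminf (shift_factor N (norm z)) * (\<Sum>i. norm (H i) * inverse \<rho> ^ i)))"
  proof -
    have "((\<lambda>p. norm (psdo_term ph H N t0 z p)) has_sum infsum (\<lambda>p. norm (psdo_term ph H N t0 z p)) UNIV) UNIV"
      using abs by simp
    moreover have "((\<lambda>p. C * B p) has_sum (C * ((\<Sum>n. norm (ph n) * d ^ n) * (suminf (shift_factor N (norm z)) * (\<Sum>i. norm (H i) * inverse \<rho> ^ i))))) UNIV"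
      by (intro has_sum_cmult_right hsB)
    ultimately show ?thesis using norm_has_sum_bound[OF _ hs] has_sum_mono tb by (meson order_trans UNIV_I)
  qed
qed

end

section \<open>Expansions at infinity\<close>

definition taylor :: "(complex \<Rightarrow> complex) \<Rightarrow> nat \<Rightarrow> complex" where
  "taylor h i = fps_nth (fps_expansion h 0) i"

lemma taylor_sums:
  assumes "h holomorphic_on ball 0 r" "norm v < r"
  shows "(\<lambda>i. taylor h i * v ^ i) sums h v"
  using holomorphic_power_series[OF assms(1), of v] assms(2) by (simp add: taylor_def fps_expansion_def)

lemma taylor_unique:
  assumes r: "r > 0" and a: "\<And>v. norm v < r \<Longrightarrow> (\<lambda>i. a i * v ^ i) sums h v"
  shows "taylor h i = a i"
proof -
  have "fps_conv_radius (Abs_fps a) \<ge> ereal r"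
    unfolding fps_conv_radius_def
    by (rule conv_radius_geI_ex') (use a in \<open>auto simp: sums_iff norm_of_real\<close>)
  then have "fps_conv_radius (Abs_fps a) > 0"
    by (rule less_le_trans[rotated]) (use r in simp)
  moreover have "eval_fps (Abs_fps a) v = h v" if "norm v < r" for v
    using a[OF that] by (simp add: eval_fps_def sums_iff)
  then have "eventually (\<lambda>v. eval_fps (Abs_fps a) v = h v) (nhds 0)"
    unfolding eventually_nhds_metric using r by (intro exI[of _ r]) simp
  ultimately have "h has_fps_expansion Abs_fps a"
    unfolding has_fps_expansion_def by blast
  from fps_nth_fps_expansion[OF this, of i] show ?thesis by (simp add: taylor_def fps_expansion_def)
qed

lemma norm_taylor_le:
  assumes "h holomorphic_on ball 0 r" "continuous_on (cball 0 r) h" "r > 0" "\<And>v. norm v \<le> r \<Longrightarrow> norm (h v) \<le> B"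
  shows "norm (taylor h i) \<le> B / r ^ i"
proof -
  have "norm ((deriv ^^ i) h 0) \<le> fact i * B / r ^ i"
    by (rule Cauchy_inequality) (use assms in auto)
  then show ?thesis by (simp add: taylor_def fps_expansion_def norm_divide field_simps)
qed

lemma taylor_abs_summable:
  assumes "h holomorphic_on ball 0 r" "continuous_on (cball 0 r) h" "\<And>v. norm v \<le> r \<Longrightarrow> norm (h v) \<le> B"
    and x: "0 \<le> x" "x < r"
  shows "summable (\<lambda>i. norm (taylor h i) * x ^ i)"
    and "(\<Sum>i. norm (taylor h i) * x ^ i) \<le> B * (1 / (1 - x / r))"
proof -
  have r: "r > 0" using x by simp
  have le: "norm (taylor h i) * x ^ i \<le> B * (x / r) ^ i" for i
    using mult_right_mono[OF norm_taylor_le[OF assms(1,2) r assms(3), of i], of "x ^ i"] x by (simp add: power_divide)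
  have s: "(\<lambda>i. B * (x / r) ^ i) sums (B * (1 / (1 - x / r)))"
    using x r by (intro sums_mult geometric_sums) simp
  show sm: "summable (\<lambda>i. norm (taylor h i) * x ^ i)"
    by (rule summable_comparison_test'[OF sums_summable[OF s], of 0]) (use le x in auto)
  show "(\<Sum>i. norm (taylor h i) * x ^ i) \<le> B * (1 / (1 - x / r))"
    unfolding sums_unique[OF s] by (rule suminf_le[OF le sm sums_summable[OF s]])
qed

text \<open>In the coordinate \<open>v = 1 / \<omega>\<close> the point at infinity becomes 0, and
  the Taylor coefficients of \<open>h\<close> are the expansion coefficients of \<open>L\<close> in
  falling powers. \<open>N\<close> is only an upper bound for the order of the pole.\<close>

definition inf_rep :: "real \<Rightarrow> nat \<Rightarrow> (complex \<Rightarrow> complex) \<Rightarrow> (complex \<Rightarrow> complex) \<Rightarrow> bool" where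
  "inf_rep T N h L \<longleftrightarrow> h holomorphic_on ball 0 (1 / T) \<and> (\<forall>\<omega>. T < norm \<omega> \<longrightarrow> L \<omega> = \<omega> ^ N * h (1 / \<omega>))"

lemma inf_repD:
  assumes "inf_rep T N h L"
  shows "h holomorphic_on ball 0 (1 / T)" "T < norm \<omega> \<Longrightarrow> L \<omega> = \<omega> ^ N * h (1 / \<omega>)"
  using assms by (auto simp: inf_rep_def)

lemma inf_rep_mono:
  assumes "inf_rep T N h L" "0 < T" "T \<le> T'"
  shows "inf_rep T' N h L"
proof -
  have "ball 0 (1 / T') \<subseteq> ball (0::complex) (1 / T)" using frac_le[of 1 1 T T'] assms by auto
  then show ?thesis using assms unfolding inf_rep_def by (auto intro: holomorphic_on_subset)
qed

lemma inverse_in_ball: "0 < T \<Longrightarrow> T < norm \<omega> \<Longrightarrow> 1 / \<omega> \<in> ball 0 (1 / T)" for \<omega> :: complex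
  by (auto simp: norm_divide frac_less2)

lemma open_outside: "open {\<omega> :: complex. T < norm \<omega>}"
  by (intro open_Collect_less continuous_intros)

lemma connected_outside: "connected {\<omega> :: complex. T < norm \<omega>}"
proof -
  have "{\<omega> :: complex. T < norm \<omega>} = - cball 0 T" by auto
  then show ?thesis by (simp only:) (rule connected_complement_bounded_convex, auto)
qed

text \<open>The identity theorem on the connected exterior of a disc. Identities in
  \<open>\<zeta>\<close> reach the variable \<open>\<omega>\<close> this way, since the principal
  root inverts the \<open>\<kappa>\<close>-th power on the positive half-line.\<close>

lemma eq_outside_if_eq_on_reals:
  assumes f: "f holomorphic_on {\<omega>. T < norm \<omega>}" and g: "g holomorphic_on {\<omega>. T < norm \<omega>}"
    and T: "T > 0" and eq: "\<And>x. x > T \<Longrightarrow> f (of_real x) = g (of_real x)" and \<omega>: "T < norm \<omega>"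
  shows "f \<omega> = g \<omega>"
proof -
  have "f \<omega> - g \<omega> = 0"
  proof (rule analytic_continuation[of "\<lambda>w. f w - g w" "{\<omega>. T < norm \<omega>}" "of_real ` {T<..}" "of_real (T + 1)"])
    show "(\<lambda>w. f w - g w) holomorphic_on {\<omega>. T < norm \<omega>}" by (intro holomorphic_intros f g)
    show "complex_of_real (T + 1) islimpt complex_of_real ` {T<..}"
      unfolding islimpt_approachable
    proof (intro allI impI)
      fix e :: real assume e: "e > 0"
      show "\<exists>x'\<in>complex_of_real ` {T<..}. x' \<noteq> of_real (T + 1) \<and> dist x' (of_real (T + 1)) < e"
      proof (rule bexI[of _ "of_real (T + 1 + e / 2)"])
        show "complex_of_real (T + 1 + e / 2) \<in> complex_of_real ` {T<..}" using e by (intro imageI) simp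
      qed (use e in \<open>simp add: dist_of_real dist_real_def del: of_real_add\<close>)
    qed
  qed (use T eq \<omega> open_outside connected_outside in auto)
  then show ?thesis by simp
qed

lemma holomorphic_ball_isCont: "h holomorphic_on ball 0 r \<Longrightarrow> r > 0 \<Longrightarrow> isCont h 0"
  by (auto dest!: holomorphic_on_imp_continuous_on simp: continuous_on_eq_continuous_at)

text \<open>Polynomial growth makes \<open>v ^ N * L (1 / v)\<close> bounded near 0, so the
  singularity is removable.\<close>

lemma inf_rep_exists:
  assumes L: "L holomorphic_on {\<omega>. T < norm \<omega>}" and O: "L \<in> O[at_infinity](\<lambda>\<omega>. \<omega> ^ N)" and T: "T > 0"
  shows "\<exists>h. inf_rep T N h L"
proof -
  define f where "f v = v ^ N * L (1 / v)" for v
  obtain c where c: "eventually (\<lambda>\<omega>. norm (L \<omega>) \<le> c * norm (\<omega> ^ N)) at_infinity"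
    using O by (elim landau_o.bigE) auto
  have "eventually (\<lambda>v. norm (L (inverse v)) \<le> c * norm (inverse v ^ N)) (at 0)"
    by (rule eventually_compose_filterlim[OF c filterlim_inverse_at_infinity])
  moreover have "eventually (\<lambda>v::complex. v \<noteq> 0) (at 0)" by (simp add: eventually_at_filter)
  ultimately have "eventually (\<lambda>v. norm (f v) \<le> c) (at 0)"
  proof eventually_elim
    case (elim v)
    then have "norm (v ^ N) * norm (L (inverse v)) \<le> norm (v ^ N) * (c * norm (inverse v ^ N))"
      by (intro mult_left_mono) auto
    also have "\<dots> = c * norm (v ^ N * inverse v ^ N)" by (simp only: norm_mult mult_ac)
    also have "\<dots> = c" using elim by (simp flip: power_mult_distrib)
    finally show ?case by (simp add: f_def norm_mult inverse_eq_divide)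
  qed
  moreover have "f holomorphic_on ball 0 (1 / T) - {0}"
    unfolding f_def
  proof (intro holomorphic_intros holomorphic_on_compose_gen[OF _ L, unfolded o_def])
    show "(\<lambda>v::complex. 1 / v) ` (ball 0 (1 / T) - {0}) \<subseteq> {\<omega>. T < norm \<omega>}"
      using T by (auto simp: norm_divide field_simps)
  qed auto
  ultimately obtain h where h: "h holomorphic_on ball 0 (1 / T)" "\<And>v. v \<in> ball 0 (1 / T) - {0} \<Longrightarrow> h v = f v"
    using holomorphic_on_extend_bounded[of f "ball 0 (1 / T)" 0] T by auto
  have "L \<omega> = \<omega> ^ N * h (1 / \<omega>)" if "T < norm \<omega>" for \<omega>
  proof -
    have "\<omega> \<noteq> 0" using that T by auto
    then show ?thesis
      using h(2)[of "1 / \<omega>"] inverse_in_ball[OF T that] by (simp add: f_def field_simps)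
  qed
  then show ?thesis using h(1) by (auto simp: inf_rep_def)
qed

lemma inf_rep_holomorphic:
  assumes "inf_rep T N h L" "T > 0"
  shows "L holomorphic_on {\<omega>. T < norm \<omega>}"
proof -
  have "(\<lambda>\<omega>. \<omega> ^ N * h (1 / \<omega>)) holomorphic_on {\<omega>. T < norm \<omega>}"
    by (intro holomorphic_intros holomorphic_on_compose_gen[OF _ inf_repD(1)[OF assms(1)], unfolded o_def])
      (use assms(2) inverse_in_ball in auto)
  then show ?thesis using inf_repD(2)[OF assms(1)] by (subst holomorphic_cong[OF refl]) auto
qed

lemma inf_rep_bigo:
  assumes L: "inf_rep T N h L" and T: "T > 0"
  shows "L \<in> O[at_infinity](\<lambda>\<omega>. \<omega> ^ N)"
proof -
  have "isCont h 0"
    using holomorphic_ball_isCont[OF inf_repD(1)[OF L]] T by simp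
  then have "((\<lambda>\<omega>. h (inverse \<omega>)) \<longlongrightarrow> h 0) at_infinity"
    unfolding isCont_def using tendsto_inverse_0
    by (intro isCont_tendsto_compose[OF \<open>isCont h 0\<close>]) auto
  then have "(\<lambda>\<omega>. h (inverse \<omega>)) \<in> O[at_infinity](\<lambda>_. 1)"
    by (intro bigoI_tendsto[where c = "h 0"]) auto
  from landau_o.big.mult[OF landau_o.big_refl[of "\<lambda>\<omega>. \<omega> ^ N"] this]
  have "(\<lambda>\<omega>. \<omega> ^ N * h (inverse \<omega>)) \<in> O[at_infinity](\<lambda>\<omega>. \<omega> ^ N)" by simp
  moreover have "eventually (\<lambda>\<omega>. L \<omega> = \<omega> ^ N * h (inverse \<omega>)) at_infinity"
    unfolding eventually_at_infinity using inf_repD(2)[OF L] T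
    by (intro exI[of _ "T + 1"]) (auto simp: inverse_eq_divide)
  ultimately show ?thesis by (subst landau_o.big.in_cong)
qed

text \<open>Allows finitely many symbols to be brought to a common exponent, as sums
  require.\<close>

lemma inf_rep_add_exp:
  assumes "inf_rep T N h L" "T > 0"
  shows "inf_rep T (N + k) (\<lambda>v. v ^ k * h v) L"
  unfolding inf_rep_def
proof (intro conjI allI impI)
  show "(\<lambda>v. v ^ k * h v) holomorphic_on ball 0 (1 / T)"
    by (intro holomorphic_intros inf_repD[OF assms(1)])
  fix \<omega> :: complex assume "T < norm \<omega>"
  moreover from this assms have "\<omega> \<noteq> 0" by auto
  ultimately show "L \<omega> = \<omega> ^ (N + k) * ((1 / \<omega>) ^ k * h (1 / \<omega>))"
    using inf_repD(2)[OF assms(1), of \<omega>] by (simp add: power_add power_divide)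
qed

lemma inf_rep_mult:
  "inf_rep T N h L \<Longrightarrow> inf_rep T N' h' L' \<Longrightarrow> inf_rep T (N + N') (\<lambda>v. h v * h' v) (\<lambda>\<omega>. L \<omega> * L' \<omega>)"
  unfolding inf_rep_def by (auto intro!: holomorphic_intros simp: power_add)

lemma inf_rep_const: "inf_rep T 0 (\<lambda>_. c) (\<lambda>_. c)"
  unfolding inf_rep_def by auto

lemma inf_rep_power: "inf_rep T N h L \<Longrightarrow> inf_rep T (n * N) (\<lambda>v. h v ^ n) (\<lambda>\<omega>. L \<omega> ^ n)"
proof (induction n)
  case 0
  then show ?case using inf_rep_const[of T 1] by simp
next
  case (Suc n)
  from inf_rep_mult[OF Suc.prems Suc.IH[OF Suc.prems]] show ?case by simp
qed

lemma inf_rep_sum: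
  assumes "\<And>j. j \<in> J \<Longrightarrow> inf_rep T N (h j) (L j)"
  shows "inf_rep T N (\<lambda>v. \<Sum>j\<in>J. c j * h j v) (\<lambda>\<omega>. \<Sum>j\<in>J. c j * L j \<omega>)"
  unfolding inf_rep_def
proof (intro conjI allI impI)
  show "(\<lambda>v. \<Sum>j\<in>J. c j * h j v) holomorphic_on ball 0 (1 / T)"
    by (intro holomorphic_intros inf_repD(1)[OF assms])
  fix \<omega> :: complex assume "T < norm \<omega>"
  then show "(\<Sum>j\<in>J. c j * L j \<omega>) = \<omega> ^ N * (\<Sum>j\<in>J. c j * h j (1 / \<omega>))"
    unfolding sum_distrib_left using inf_repD(2)[OF assms] by (intro sum.cong) simp_all
qed

lemma inf_rep_add:
  assumes "inf_rep T N h L" "inf_rep T N' h' L'" "T > 0"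
  shows "\<exists>M g. inf_rep T M g (\<lambda>\<omega>. L \<omega> + L' \<omega>)"
proof -
  have "inf_rep T (N + N') (\<lambda>v. v ^ N' * h v) L" "inf_rep T (N + N') (\<lambda>v. v ^ N * h' v) L'"
    using inf_rep_add_exp[OF assms(1,3), of N'] inf_rep_add_exp[OF assms(2,3), of N] by (simp_all add: add.commute)
  then have "inf_rep T (N + N') (\<lambda>v. v ^ N' * h v + v ^ N * h' v) (\<lambda>\<omega>. L \<omega> + L' \<omega>)"
    unfolding inf_rep_def by (auto intro!: holomorphic_intros simp: distrib_left)
  then show ?thesis by blast
qed

text \<open>A function that does not vanish identically has \<open>h v = v ^ n * g v\<close> near 0
  with \<open>g\<close> free of zeros, so its zeros do not accumulate at infinity. The roles of the
  exponents \<open>n\<close> and \<open>N\<close> are exchanged in the reciprocal.\<close>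

lemma inf_rep_inverse:
  assumes D: "inf_rep T N h D" and T: "T > 0" and nz: "T < norm \<omega>0" "D \<omega>0 \<noteq> 0"
  shows "\<exists>T'\<ge>T. \<exists>n g. (\<forall>\<omega>. T' < norm \<omega> \<longrightarrow> D \<omega> \<noteq> 0) \<and> inf_rep T' n g (\<lambda>\<omega>. 1 / D \<omega>)"
proof -
  have hol: "h holomorphic_on ball 0 (1 / T)" by (rule inf_repD(1)[OF D])
  obtain g r n where r: "0 < r" "r \<le> 1 / T" and g: "g holomorphic_on ball 0 r"
    "\<And>v. v \<in> ball 0 r \<Longrightarrow> h v = v ^ n * g v" "\<And>v. v \<in> ball 0 r \<Longrightarrow> g v \<noteq> 0"
  proof (cases "h 0 = 0")
    case True
    have nc: "\<not> h constant_on ball 0 (1 / T)"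
    proof
      assume "h constant_on ball 0 (1 / T)"
      then have "h (1 / \<omega>0) = 0"
        using True T inverse_in_ball[OF T nz(1)] by (metis centre_in_ball constant_on_def zero_less_divide_1_iff)
      then show False using nz inf_repD(2)[OF D nz(1)] by simp
    qed
    have "\<exists>g r n. 0 < r \<and> ball (0::complex) r \<subseteq> ball 0 (1 / T) \<and> g holomorphic_on ball 0 r \<and>
      (\<forall>w\<in>ball 0 r. h w = (w - 0) ^ n * g w) \<and> (\<forall>w\<in>ball 0 r. g w \<noteq> 0)"
      by (rule holomorphic_factor_zero_nonconstant[OF hol open_ball connected_ball _ True nc]) (use T in simp, blast)
    then obtain g r n where "0 < r" "ball (0::complex) r \<subseteq> ball 0 (1 / T)" "g holomorphic_on ball 0 r"
      "\<And>w. w \<in> ball 0 r \<Longrightarrow> h w = w ^ n * g w" "\<And>w. w \<in> ball 0 r \<Longrightarrow> g w \<noteq> 0" by auto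
    then show ?thesis using that[of r g n] by (simp add: ball_subset_ball_iff)
  next
    case False
    have "isCont h 0"
      using holomorphic_ball_isCont[OF hol] T by simp
    from continuous_at_avoid[OF this False] obtain e where e: "e > 0" "\<And>v. dist 0 v < e \<Longrightarrow> h v \<noteq> 0" by auto
    define r where "r = min e (1 / T)"
    show ?thesis
      by (rule that[of r h 0]) (use e T in \<open>auto simp: r_def intro: holomorphic_on_subset[OF hol]\<close>)
  qed
  define T' where "T' = 1 / r"
  have T': "T' > 0" "T \<le> T'" using r T by (auto simp: T'_def field_simps)
  have b: "1 / \<omega> \<in> ball 0 r" if "T' < norm \<omega>" for \<omega> :: complex
    using inverse_in_ball[OF T'(1) that] by (simp add: T'_def)
  have eq: "D \<omega> = \<omega> ^ N * ((1 / \<omega>) ^ n * g (1 / \<omega>))" if "T' < norm \<omega>" for \<omega>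
    using inf_repD(2)[OF D, of \<omega>] T' that g(2)[OF b[OF that]] by simp
  have "D \<omega> \<noteq> 0" if "T' < norm \<omega>" for \<omega>
    using eq[OF that] g(3)[OF b[OF that]] T' that by auto
  moreover have "inf_rep T' n (\<lambda>v. v ^ N / g v) (\<lambda>\<omega>. 1 / D \<omega>)"
    unfolding inf_rep_def
  proof (intro conjI allI impI)
    show "(\<lambda>v. v ^ N / g v) holomorphic_on ball 0 (1 / T')"
      using g by (intro holomorphic_intros) (auto simp: T'_def)
    fix \<omega> :: complex assume "T' < norm \<omega>"
    with T' show "1 / D \<omega> = \<omega> ^ n * ((1 / \<omega>) ^ N / g (1 / \<omega>))"
      by (subst eq) (auto simp: field_simps power_divide)
  qed
  ultimately show ?thesis using T' by blast
qed

lemma of_rat_complex: "(of_rat q :: complex) = of_real (of_rat q)"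
  by (cases q) (simp add: of_rat_rat)

text \<open>The least possible exponent is chosen. If it were too large, the quotient that defines
  the pole order would be unbounded along the positive reals. The maximum with 0 is due to the
  exponent being natural.\<close>

lemma inf_rep_pole_order:
  assumes L: "inf_rep T N0 h0 L" and T: "T > 0" "T = root \<kappa> R" and \<kappa>: "\<kappa> \<ge> 1"
    and g: "\<And>\<zeta>. R < norm \<zeta> \<Longrightarrow> g \<zeta> = L (\<zeta> powr (1 / of_nat \<kappa>))" and q: "pole_order g q"
  shows "\<exists>N h. inf_rep T N h L \<and> real N \<le> real \<kappa> * max 0 (of_rat q)"
proof -
  define N where "N = (LEAST N. \<exists>h. inf_rep T N h L)"
  have "\<exists>h. inf_rep T N h L"
    using L LeastI_ex[of "\<lambda>N. \<exists>h. inf_rep T N h L"] unfolding N_def by blast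
  then obtain h where h: "inf_rep T N h L" by blast
  have "real N \<le> real \<kappa> * max 0 (of_rat q)"
  proof (rule ccontr)
    assume "\<not> ?thesis"
    then have "real N > real \<kappa> * max 0 (of_rat q)" by simp
    moreover have "real \<kappa> * of_rat q \<le> real \<kappa> * max 0 (of_rat q)" by (intro mult_left_mono) auto
    moreover have "0 \<le> real \<kappa> * max 0 (of_rat q :: real)" by simp
    ultimately have N: "real N > real \<kappa> * of_rat q" "N > 0" by linarith+
    \<comment> \<open>Otherwise a factor \<open>v\<close> could be split off from \<open>h\<close>,
      against the minimality of \<open>N\<close>.\<close>
    have "h 0 \<noteq> 0"
    proof
      assume h0: "h 0 = 0"
      define h1 where "h1 z = (if z = 0 then deriv h 0 else (h z - h 0) / (z - 0))" for z
      have "h1 holomorphic_on ball 0 (1 / T)"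
        unfolding h1_def by (rule pole_lemma[OF inf_repD(1)[OF h]]) (use T in simp)
      moreover have "L \<omega> = \<omega> ^ (N - 1) * h1 (1 / \<omega>)" if "T < norm \<omega>" for \<omega>
      proof -
        have "\<omega> \<noteq> 0" using that T by auto
        then show ?thesis using inf_repD(2)[OF h that] N(2) h0
          by (simp add: h1_def power_eq_if[of \<omega> N])
      qed
      ultimately have "inf_rep T (N - 1) h1 L" by (simp add: inf_rep_def)
      then have "N \<le> N - 1"
        using Least_le[of "\<lambda>N. \<exists>h. inf_rep T N h L" "N - 1"] unfolding N_def by blast
      then show False using N(2) by simp
    qed
    obtain a where a: "a \<noteq> 0" "((\<lambda>\<zeta>. g \<zeta> / \<zeta> powr of_rat q) \<longlongrightarrow> a) at_infinity"
      using q by (auto simp: pole_order_def)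
    \<comment> \<open>The order of growth of the quotient along the positive reals once
      \<open>h 0 \<noteq> 0\<close> is known.\<close>
    define c where "c = real N / real \<kappa> - of_rat q"
    have c: "c > 0" using N \<kappa> by (simp add: c_def field_simps)
    define y where "y x = x powr (1 / real \<kappa>)" for x :: real
    have lim1: "((\<lambda>x. norm (g (of_real x) / of_real x powr of_rat q)) \<longlongrightarrow> norm a) at_top"
      by (intro tendsto_norm filterlim_compose[OF a(2)] filterlim_of_real_at_infinity)
    have ev: "eventually (\<lambda>x. norm (g (of_real x) / of_real x powr of_rat q) = x powr c * norm (h (of_real (inverse (y x))))) at_top"
      using eventually_gt_at_top[of "max R 1"]
    proof eventually_elim
      case (elim x)
      then have x: "x > R" "x > 0" by auto
      have yx: "complex_of_real x powr (1 / of_nat \<kappa>) = of_real (y x)"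
        using x by (simp add: y_def powr_of_real[symmetric])
      have "y x = root \<kappa> x" using x \<kappa> by (simp add: y_def root_powr_inverse)
      then have "T < y x" using x T \<kappa> by simp
      then have "T < norm (complex_of_real (y x))" by simp
      from inf_repD(2)[OF h this] have "g (of_real x) = of_real (y x) ^ N * h (of_real (inverse (y x)))"
        using g[of "of_real x"] x unfolding yx by (simp add: inverse_eq_divide)
      moreover have "y x ^ N = x powr (real N / real \<kappa>)"
        using x powr_realpow[of "y x" N] by (simp add: y_def powr_powr)
      moreover have "norm (complex_of_real x powr of_rat q) = x powr of_rat q"
        using x by (simp add: norm_powr_real_powr of_rat_complex)
      moreover have "norm (complex_of_real (y x)) = y x" by (simp add: y_def)
      ultimately show ?case using x by (simp add: norm_divide norm_mult norm_power c_def powr_diff)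
    qed
    have "((\<lambda>x. inverse (x powr e)) \<longlongrightarrow> 0) at_top" if "e > 0" for e :: real
      using that by real_asymp
    from this[of "1 / real \<kappa>"] have "((\<lambda>x. inverse (y x)) \<longlongrightarrow> 0) at_top"
      unfolding y_def using \<kappa> by simp
    then have "((\<lambda>x. complex_of_real (inverse (y x))) \<longlongrightarrow> of_real 0) at_top" by (rule tendsto_of_real)
    moreover have "isCont h 0"
      using holomorphic_ball_isCont[OF inf_repD(1)[OF h]] T by simp
    ultimately have "((\<lambda>x. norm (h (of_real (inverse (y x))))) \<longlongrightarrow> norm (h 0)) at_top"
      by (intro tendsto_norm isCont_tendsto_compose[of 0 h]) auto
    moreover have "filterlim (\<lambda>x::real. x powr c) at_top at_top" using c by real_asymp
    ultimately have "filterlim (\<lambda>x. x powr c * norm (h (of_real (inverse (y x))))) at_top at_top"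
      using \<open>h 0 \<noteq> 0\<close> by (intro filterlim_at_top_mult_tendsto_pos[of _ "norm (h 0)"]) auto
    then have "filterlim (\<lambda>x. norm (g (of_real x) / of_real x powr of_rat q)) at_top at_top"
      using ev by (subst filterlim_cong[OF refl refl ev]) auto
    then have "filterlim (\<lambda>x. norm (g (of_real x) / of_real x powr of_rat q)) at_infinity at_top"
      by (rule filterlim_at_top_imp_at_infinity)
    then show False
      using not_tendsto_and_filterlim_at_infinity[OF _ lim1] by simp
  qed
  then show ?thesis using h by blast
qed

text \<open>The intermediate radius makes Cauchy's inequality available on the closed disc of radius
  \<open>1 / \<rho>'\<close>; the evaluation at \<open>inverse \<rho>\<close> then leaves the ratio
  \<open>\<rho>' / \<rho> < 1\<close>.\<close>

lemma inf_rep_expansion: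
  assumes L: "inf_rep T N h L" and T: "0 < T" "T < \<rho>'" "\<rho>' < \<rho>"
    and B: "\<And>v. norm v \<le> 1 / \<rho>' \<Longrightarrow> norm (h v) \<le> B"
  shows "summable (\<lambda>i. norm (taylor h i) * inverse \<rho> ^ i)"
    and "(\<Sum>i. norm (taylor h i) * inverse \<rho> ^ i) \<le> B * (1 / (1 - \<rho>' / \<rho>))"
    and "norm \<zeta> \<ge> \<rho> \<Longrightarrow> (\<lambda>i. taylor h i * \<zeta> powi (int N - int i)) sums L \<zeta>"
proof -
  have sub: "cball 0 (1 / \<rho>') \<subseteq> ball 0 (1 / T)" "ball 0 (1 / \<rho>') \<subseteq> ball 0 (1 / T)"
    using frac_less2[of 1 1 T \<rho>'] T by auto
  have h: "h holomorphic_on ball 0 (1 / \<rho>')" "continuous_on (cball 0 (1 / \<rho>')) h"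
    using holomorphic_on_subset[OF inf_repD(1)[OF L]] sub holomorphic_on_imp_continuous_on by blast+
  have x: "0 \<le> inverse \<rho>" "inverse \<rho> < 1 / \<rho>'" using T by (auto simp: field_simps)
  have "inverse \<rho> / (1 / \<rho>') = \<rho>' / \<rho>" by (simp add: field_simps)
  then show "summable (\<lambda>i. norm (taylor h i) * inverse \<rho> ^ i)"
    "(\<Sum>i. norm (taylor h i) * inverse \<rho> ^ i) \<le> B * (1 / (1 - \<rho>' / \<rho>))"
    using taylor_abs_summable[OF h B x] by auto
  show "(\<lambda>i. taylor h i * \<zeta> powi (int N - int i)) sums L \<zeta>" if "norm \<zeta> \<ge> \<rho>"
  proof -
    have z: "T < norm \<zeta>" "\<zeta> \<noteq> 0" using that T by auto
    have "(\<lambda>i. \<zeta> ^ N * (taylor h i * (1 / \<zeta>) ^ i)) sums (\<zeta> ^ N * h (1 / \<zeta>))"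
      using inverse_in_ball[OF T(1) z(1)] by (intro sums_mult taylor_sums[OF inf_repD(1)[OF L]]) simp
    moreover have "\<zeta> ^ N * (taylor h i * (1 / \<zeta>) ^ i) = taylor h i * \<zeta> powi (int N - int i)" for i
      using z by (simp add: power_int_diff power_divide)
    ultimately show ?thesis using inf_repD(2)[OF L z(1)] by simp
  qed
qed

section \<open>Algebraic functions\<close>

lemma eval2_map_poly: "eval2 Q \<xi> \<zeta> = poly (map_poly (\<lambda>p. poly p \<zeta>) Q) \<xi>"
proof -
  have "poly (poly Q A) \<zeta> = poly (map_poly (\<lambda>p. poly p \<zeta>) Q) (poly A \<zeta>)" for A
    by (induction Q) (auto simp: map_poly_pCons)
  from this[of "[:\<xi>:]"] show ?thesis by (simp add: eval2_def)
qed

lemma eval2_altdef: "eval2 Q \<xi> \<zeta> = (\<Sum>j\<le>degree Q. poly (coeff Q j) \<zeta> * \<xi> ^ j)"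
  unfolding eval2_def poly_altdef[of Q] by (simp add: poly_sum poly_power)

definition alg_on :: "complex set \<Rightarrow> (complex \<Rightarrow> complex) \<Rightarrow> (complex \<Rightarrow> complex) \<Rightarrow> bool" where
  "alg_on \<Omega> z u \<longleftrightarrow> (\<exists>Q. Q \<noteq> 0 \<and> (\<forall>\<omega>\<in>\<Omega>. eval2 Q (u \<omega>) (z \<omega>) = 0))"

text \<open>On $\Omega$ the multiplication by $A u$ maps the span of the $V_i$ over the polynomials in $z$ into
  itself, so $A u$ is an eigenvalue of $M$ and a root of its characteristic polynomial.\<close>

definition mod_rep ::
    "complex set \<Rightarrow> (complex \<Rightarrow> complex) \<Rightarrow> (complex \<Rightarrow> complex) \<Rightarrow> complex poly \<Rightarrow> nat \<Rightarrow>
     (nat \<Rightarrow> nat \<Rightarrow> complex poly) \<Rightarrow> (nat \<Rightarrow> complex \<Rightarrow> complex) \<Rightarrow> bool" where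
  "mod_rep \<Omega> z u A n M V \<longleftrightarrow> A \<noteq> 0 \<and> n > 0 \<and> (\<forall>\<omega>\<in>\<Omega>. V 0 \<omega> = 1 \<and>
     (\<forall>i<n. poly A (z \<omega>) * u \<omega> * V i \<omega> = (\<Sum>j<n. poly (M i j) (z \<omega>) * V j \<omega>)))"

lemma mod_rep_imp_alg_on:
  assumes "mod_rep \<Omega> z u A n M V"
  shows "alg_on \<Omega> z u"
proof -
  have A: "A \<noteq> 0" "n > 0" and V0: "\<And>\<omega>. \<omega> \<in> \<Omega> \<Longrightarrow> V 0 \<omega> = 1"
    and ev: "\<And>\<omega> i. \<omega> \<in> \<Omega> \<Longrightarrow> i < n \<Longrightarrow> poly A (z \<omega>) * u \<omega> * V i \<omega> = (\<Sum>j<n. poly (M i j) (z \<omega>) * V j \<omega>)"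
    using assms by (auto simp: mod_rep_def)
  define B where "B = Matrix.mat n n (\<lambda>p. M (fst p) (snd p))"
  define cp where "cp = char_poly B"
  have B: "B \<in> carrier_mat n n" by (simp add: B_def)
  have "coeff cp n = 1"
    using degree_monic_char_poly[OF B] by (simp add: cp_def)
  then have "cp \<noteq> 0" by auto
  \<comment> \<open>\<open>[:0, A:]\<close> substitutes \<open>A * \<xi>\<close> for the outer
    variable, because the eigenvalue is \<open>A u\<close> and not \<open>u\<close>.\<close>
  then have Q: "pcompose cp [:0, A:] \<noteq> 0" using A by (simp add: pcompose_eq_0_iff)
  have "eval2 (pcompose cp [:0, A:]) (u \<omega>) (z \<omega>) = 0" if \<omega>: "\<omega> \<in> \<Omega>" for \<omega>
  proof -
    have h: "comm_ring_hom (\<lambda>p. poly p (z \<omega>))" by unfold_locales auto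
    define B' where "B' = map_mat (\<lambda>p. poly p (z \<omega>)) B"
    have B': "B' \<in> carrier_mat n n" using B by (simp add: B'_def)
    define v where "v = Matrix.vec n (\<lambda>i. V i \<omega>)"
    define k where "k = poly A (z \<omega>) * u \<omega>"
    have "B' *\<^sub>v v = k \<cdot>\<^sub>v v"
    proof (rule eq_vecI)
      fix i assume "i < dim_vec (k \<cdot>\<^sub>v v)"
      then have i: "i < n" by (simp add: v_def)
      then show "vec_index (B' *\<^sub>v v) i = vec_index (k \<cdot>\<^sub>v v) i"
        using ev[OF \<omega> i] by (simp add: B'_def B_def v_def k_def scalar_prod_def lessThan_atLeast0)
    qed (simp add: B'_def B_def v_def)
    \<comment> \<open>The normalisation \<open>V 0 = 1\<close> keeps the vector from vanishing at
      any point.\<close>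
    moreover have "v \<noteq> 0\<^sub>v n"
    proof
      assume "v = 0\<^sub>v n"
      then have "vec_index v 0 = 0" using A by simp
      then show False using V0[OF \<omega>] A by (simp add: v_def)
    qed
    ultimately have "eigenvector B' v k" unfolding eigenvector_def using B' by (simp add: v_def)
    then have "eigenvalue B' k" by (auto simp: eigenvalue_def)
    then have "poly (char_poly B') k = 0" using eigenvalue_root_char_poly[OF B'] by simp
    then have "poly (map_poly (\<lambda>p. poly p (z \<omega>)) cp) k = 0"
      unfolding B'_def cp_def comm_ring_hom.char_poly_hom[OF h B] .
    moreover have "eval2 (pcompose q [:0, A:]) (u \<omega>) (z \<omega>) = poly (map_poly (\<lambda>p. poly p (z \<omega>)) q) k" for q
      unfolding eval2_def poly_pcompose by (induction q) (auto simp: map_poly_pCons k_def mult_ac)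
    ultimately show ?thesis by simp
  qed
  with Q show ?thesis by (auto simp: alg_on_def)
qed

text \<open>The powers of \<open>u\<close> with the companion matrix of \<open>Q\<close>, multiplied
  by the leading coefficient \<open>A\<close> because \<open>Q\<close> is not monic in
  general.\<close>

lemma alg_on_imp_mod_rep:
  assumes "alg_on \<Omega> z u"
  shows "\<exists>A n M V. mod_rep \<Omega> z u A n M V"
proof -
  obtain Q0 where Q0: "Q0 \<noteq> 0" "\<And>\<omega>. \<omega> \<in> \<Omega> \<Longrightarrow> eval2 Q0 (u \<omega>) (z \<omega>) = 0"
    using assms by (auto simp: alg_on_def)
  \<comment> \<open>The extra factor \<open>\<xi>\<close> makes the degree in \<open>\<xi>\<close>
    positive even if \<open>Q0\<close> does not contain \<open>\<xi>\<close>.\<close>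
  define Q where "Q = pCons 0 Q0"
  define n where "n = degree Q"
  have n: "n > 0" using Q0 by (simp add: n_def Q_def)
  have Q: "eval2 Q (u \<omega>) (z \<omega>) = 0" if "\<omega> \<in> \<Omega>" for \<omega>
    using Q0(2)[OF that] by (simp add: Q_def eval2_def)
  define A where "A = lead_coeff Q"
  define M where "M i j = (if Suc i < n then if j = Suc i then A else 0 else - coeff Q j)" for i j
  have "mod_rep \<Omega> z u A n M (\<lambda>i \<omega>. u \<omega> ^ i)"
    unfolding mod_rep_def
  proof (intro conjI ballI allI impI)
    show "A \<noteq> 0" using Q0 by (simp add: A_def Q_def)
    fix \<omega> i assume \<omega>: "\<omega> \<in> \<Omega>" and i: "i < n"
    show "poly A (z \<omega>) * u \<omega> * u \<omega> ^ i = (\<Sum>j<n. poly (M i j) (z \<omega>) * u \<omega> ^ j)"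
    proof (cases "Suc i < n")
      case True
      have "(\<Sum>j<n. poly (M i j) (z \<omega>) * u \<omega> ^ j) = (\<Sum>j<n. if j = Suc i then poly A (z \<omega>) * u \<omega> ^ j else 0)"
        using True by (intro sum.cong) (auto simp: M_def)
      then show ?thesis using True by (simp add: mult_ac)
    next
      case False
      with i have ni: "n = Suc i" by simp
      have "0 = (\<Sum>j\<le>n. poly (coeff Q j) (z \<omega>) * u \<omega> ^ j)"
        using Q[OF \<omega>] by (simp add: eval2_altdef n_def)
      also have "\<dots> = (\<Sum>j<n. poly (coeff Q j) (z \<omega>) * u \<omega> ^ j) + poly A (z \<omega>) * u \<omega> ^ n"
        by (simp add: A_def n_def flip: lessThan_Suc_atMost)
      finally have "poly A (z \<omega>) * u \<omega> ^ n = - (\<Sum>j<n. poly (coeff Q j) (z \<omega>) * u \<omega> ^ j)"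
        by (metis add.commute add_eq_0_iff)
      then show ?thesis using False ni by (simp add: M_def sum_negf mult.assoc)
    qed
  qed (use n in auto)
  then show ?thesis by blast
qed

lemma sum_div_mod:
  fixes f :: "nat \<Rightarrow> nat \<Rightarrow> 'a :: comm_monoid_add"
  assumes m: "m > 0"
  shows "(\<Sum>q<n * m. f (q div m) (q mod m)) = (\<Sum>i<n. \<Sum>j<m. f i j)"
proof -
  have lt: "i * m + j < n * m" if "i < n" "j < m" for i j
  proof -
    have "i * m + j < Suc i * m" using that by simp
    also have "\<dots> \<le> n * m" using that by (intro mult_right_mono) auto
    finally show ?thesis .
  qed
  have "(\<Sum>i<n. \<Sum>j<m. f i j) = (\<Sum>(i, j)\<in>{..<n} \<times> {..<m}. f i j)"
    by (simp add: sum.cartesian_product)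
  also have "\<dots> = (\<Sum>q<n * m. f (q div m) (q mod m))"
    by (rule sum.reindex_bij_witness[of _ "\<lambda>q. (q div m, q mod m)" "\<lambda>(i, j). i * m + j"])
      (use m lt in \<open>auto simp: less_mult_imp_div_less\<close>)
  finally show ?thesis ..
qed

text \<open>The products \<open>V i * W j\<close> span a module stable under both functions. In this
  basis the product acts by the Kronecker product of \<open>M\<close> and \<open>K\<close>, and the
  sum by \<open>B M\<close> tensor 1 plus 1 tensor \<open>A K\<close>; pairs are coded by quotient
  and remainder modulo \<open>m\<close>.\<close>

lemma alg_on_add_mult:
  assumes "alg_on \<Omega> z u" "alg_on \<Omega> z v"
  shows "alg_on \<Omega> z (\<lambda>\<omega>. u \<omega> + v \<omega>)" "alg_on \<Omega> z (\<lambda>\<omega>. u \<omega> * v \<omega>)"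
proof -
  obtain A n M V where "mod_rep \<Omega> z u A n M V" using alg_on_imp_mod_rep[OF assms(1)] by blast
  then have A: "A \<noteq> 0" "n > 0" and V: "\<And>\<omega>. \<omega> \<in> \<Omega> \<Longrightarrow> V 0 \<omega> = 1"
    "\<And>\<omega> i. \<omega> \<in> \<Omega> \<Longrightarrow> i < n \<Longrightarrow> poly A (z \<omega>) * u \<omega> * V i \<omega> = (\<Sum>j<n. poly (M i j) (z \<omega>) * V j \<omega>)"
    by (auto simp: mod_rep_def)
  obtain B m K W where "mod_rep \<Omega> z v B m K W" using alg_on_imp_mod_rep[OF assms(2)] by blast
  then have B: "B \<noteq> 0" "m > 0" and W: "\<And>\<omega>. \<omega> \<in> \<Omega> \<Longrightarrow> W 0 \<omega> = 1"
    "\<And>\<omega> i. \<omega> \<in> \<Omega> \<Longrightarrow> i < m \<Longrightarrow> poly B (z \<omega>) * v \<omega> * W i \<omega> = (\<Sum>j<m. poly (K i j) (z \<omega>) * W j \<omega>)"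
    by (auto simp: mod_rep_def)
  define X where "X p \<omega> = V (p div m) \<omega> * W (p mod m) \<omega>" for p \<omega>
  have dm: "p div m < n" "p mod m < m" if "p < n * m" for p
    using that B(2) by (auto simp: less_mult_imp_div_less)
  have "mod_rep \<Omega> z (\<lambda>\<omega>. u \<omega> * v \<omega>) (A * B) (n * m) (\<lambda>p q. M (p div m) (q div m) * K (p mod m) (q mod m)) X"
    unfolding mod_rep_def
  proof (intro conjI ballI allI impI)
    fix \<omega> p assume \<omega>: "\<omega> \<in> \<Omega>" and p: "p < n * m"
    have "(\<Sum>q<n * m. poly (M (p div m) (q div m) * K (p mod m) (q mod m)) (z \<omega>) * X q \<omega>) =
      (\<Sum>i<n. \<Sum>j<m. poly (M (p div m) i * K (p mod m) j) (z \<omega>) * (V i \<omega> * W j \<omega>))"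
      unfolding X_def by (rule sum_div_mod[OF B(2)])
    also have "\<dots> = (\<Sum>i<n. poly (M (p div m) i) (z \<omega>) * V i \<omega>) * (\<Sum>j<m. poly (K (p mod m) j) (z \<omega>) * W j \<omega>)"
      by (simp add: sum_product mult_ac)
    also have "\<dots> = poly (A * B) (z \<omega>) * (u \<omega> * v \<omega>) * X p \<omega>"
      unfolding V(2)[OF \<omega> dm(1)[OF p], symmetric] W(2)[OF \<omega> dm(2)[OF p], symmetric]
      by (simp add: X_def mult_ac)
    finally show "poly (A * B) (z \<omega>) * (u \<omega> * v \<omega>) * X p \<omega> =
      (\<Sum>q<n * m. poly (M (p div m) (q div m) * K (p mod m) (q mod m)) (z \<omega>) * X q \<omega>)" ..
  qed (use A B V W in \<open>auto simp: X_def\<close>)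
  then show "alg_on \<Omega> z (\<lambda>\<omega>. u \<omega> * v \<omega>)" by (rule mod_rep_imp_alg_on)
  have "mod_rep \<Omega> z (\<lambda>\<omega>. u \<omega> + v \<omega>) (A * B) (n * m)
     (\<lambda>p q. (if p mod m = q mod m then B * M (p div m) (q div m) else 0) +
       (if p div m = q div m then A * K (p mod m) (q mod m) else 0)) X"
    unfolding mod_rep_def
  proof (intro conjI ballI allI impI)
    fix \<omega> p assume \<omega>: "\<omega> \<in> \<Omega>" and p: "p < n * m"
    have "(\<Sum>q<n * m. poly ((if p mod m = q mod m then B * M (p div m) (q div m) else 0) +
       (if p div m = q div m then A * K (p mod m) (q mod m) else 0)) (z \<omega>) * X q \<omega>) =
      (\<Sum>i<n. \<Sum>j<m. poly ((if p mod m = j then B * M (p div m) i else 0) +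
       (if p div m = i then A * K (p mod m) j else 0)) (z \<omega>) * (V i \<omega> * W j \<omega>))"
      unfolding X_def by (rule sum_div_mod[OF B(2)])
    also have "\<dots> = (\<Sum>i<n. \<Sum>j<m. if p mod m = j then poly (B * M (p div m) i) (z \<omega>) * (V i \<omega> * W j \<omega>) else 0) +
       (\<Sum>i<n. \<Sum>j<m. if p div m = i then poly (A * K (p mod m) j) (z \<omega>) * (V i \<omega> * W j \<omega>) else 0)"
      unfolding sum.distrib[symmetric] by (intro sum.cong refl) (auto simp: algebra_simps)
    also have "(\<Sum>i<n. \<Sum>j<m. if p mod m = j then poly (B * M (p div m) i) (z \<omega>) * (V i \<omega> * W j \<omega>) else 0) =
      poly B (z \<omega>) * W (p mod m) \<omega> * (\<Sum>i<n. poly (M (p div m) i) (z \<omega>) * V i \<omega>)"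
      using dm(2)[OF p] by (simp add: sum_distrib_left mult_ac)
    also have "(\<Sum>i<n. \<Sum>j<m. if p div m = i then poly (A * K (p mod m) j) (z \<omega>) * (V i \<omega> * W j \<omega>) else 0) =
      poly A (z \<omega>) * V (p div m) \<omega> * (\<Sum>j<m. poly (K (p mod m) j) (z \<omega>) * W j \<omega>)"
      using dm(1)[OF p] by (subst sum.swap) (simp add: sum_distrib_left mult_ac)
    finally show "poly (A * B) (z \<omega>) * (u \<omega> + v \<omega>) * X p \<omega> =
      (\<Sum>q<n * m. poly ((if p mod m = q mod m then B * M (p div m) (q div m) else 0) +
       (if p div m = q div m then A * K (p mod m) (q mod m) else 0)) (z \<omega>) * X q \<omega>)"
      unfolding V(2)[OF \<omega> dm(1)[OF p], symmetric] W(2)[OF \<omega> dm(2)[OF p], symmetric]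
      by (simp add: X_def algebra_simps)
  qed (use A B V W in \<open>auto simp: X_def\<close>)
  then show "alg_on \<Omega> z (\<lambda>\<omega>. u \<omega> + v \<omega>)" by (rule mod_rep_imp_alg_on)
qed

lemma alg_on_const: "alg_on \<Omega> z (\<lambda>_. c)"
  unfolding alg_on_def by (intro exI[of _ "[:[:- c:], 1:]"]) (simp add: eval2_def)

text \<open>Reversing the coefficients turns a nonzero root into its reciprocal.\<close>

lemma alg_on_inverse:
  assumes "alg_on \<Omega> z u" "\<And>\<omega>. \<omega> \<in> \<Omega> \<Longrightarrow> u \<omega> \<noteq> 0"
  shows "alg_on \<Omega> z (\<lambda>\<omega>. 1 / u \<omega>)"
proof -
  obtain Q where Q: "Q \<noteq> 0" "\<And>\<omega>. \<omega> \<in> \<Omega> \<Longrightarrow> eval2 Q (u \<omega>) (z \<omega>) = 0"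
    using assms(1) by (auto simp: alg_on_def)
  have "eval2 (reflect_poly Q) (1 / x) \<zeta> * x ^ degree Q = eval2 Q x \<zeta>" if "x \<noteq> 0" for x \<zeta>
  proof -
    have "eval2 (reflect_poly Q) (1 / x) \<zeta> = (\<Sum>j\<le>degree Q. poly (coeff (reflect_poly Q) j) \<zeta> * (1 / x) ^ j)"
      unfolding eval2_altdef
      by (rule sum.mono_neutral_left) (auto simp: degree_reflect_poly_le coeff_eq_0)
    then have "eval2 (reflect_poly Q) (1 / x) \<zeta> * x ^ degree Q =
        (\<Sum>j\<le>degree Q. poly (coeff Q (degree Q - j)) \<zeta> * x ^ (degree Q - j))"
      unfolding sum_distrib_right using that
      by (simp only: sum_distrib_right) (intro sum.cong; simp add: coeff_reflect_poly power_divide power_diff)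
    also have "\<dots> = eval2 Q x \<zeta>"
      unfolding eval2_altdef by (rule sum.reindex_bij_witness[of _ "\<lambda>j. degree Q - j" "\<lambda>j. degree Q - j"]) auto
    finally show ?thesis .
  qed
  then have "eval2 (reflect_poly Q) (1 / u \<omega>) (z \<omega>) = 0" if "\<omega> \<in> \<Omega>" for \<omega>
    using Q(2)[OF that] assms(2)[OF that] by (metis mult_eq_0_iff power_not_zero)
  then show ?thesis using Q(1) unfolding alg_on_def by (intro exI[of _ "reflect_poly Q"]) simp
qed

section \<open>Partial fractions\<close>

definition geom_fps :: "complex \<Rightarrow> complex fps" where
  "geom_fps c = inverse (1 - fps_const c * fps_X)"

lemma geom_fps_mult: "geom_fps c * (1 - fps_const c * fps_X) = 1"
  unfolding geom_fps_def by (rule inverse_mult_eq_1) simp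

text \<open>The resolvent identity: \<open>a - b\<close> equals
  \<open>a (1 - b X) - b (1 - a X)\<close>, and each bracket cancels one geometric series.\<close>

lemma geom_fps_prod:
  assumes "a \<noteq> b"
  shows "geom_fps a * geom_fps b = fps_const (1 / (a - b)) * (fps_const a * geom_fps a - fps_const b * geom_fps b)"
proof -
  let ?A = "1 - fps_const a * fps_X" and ?B = "1 - fps_const b * fps_X"
  have "fps_const (a - b) * (geom_fps a * geom_fps b) =
     (fps_const a * ?B - fps_const b * ?A) * (geom_fps a * geom_fps b)"
  proof -
    have c: "fps_const (a - b) = fps_const a - fps_const b" by simp
    have "(x - y) * g = (x * (1 - y * fps_X) - y * (1 - x * fps_X)) * g" for x y g :: "complex fps"
      by (simp add: algebra_simps)
    then show ?thesis unfolding c .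
  qed
  also have "\<dots> = fps_const a * geom_fps a * (geom_fps b * ?B) - fps_const b * geom_fps b * (geom_fps a * ?A)"
  proof -
    have "(x * B - y * A) * (g * h) = x * g * (h * B) - y * h * (g * A)" for x y A B g h :: "complex fps"
      by (simp add: algebra_simps)
    then show ?thesis .
  qed
  also have "\<dots> = fps_const a * geom_fps a - fps_const b * geom_fps b" unfolding geom_fps_mult by simp
  finally have "fps_const (1 / (a - b)) * (fps_const (a - b) * (geom_fps a * geom_fps b)) =
      fps_const (1 / (a - b)) * (fps_const a * geom_fps a - fps_const b * geom_fps b)" by (rule arg_cong)
  then show ?thesis using assms by (simp add: mult.assoc[symmetric])
qed

lemma fact_quot_eq_choose: "fact_quot n (Suc i) = fact i * of_nat (n choose i)"
proof -
  have "(of_nat n gchoose i :: complex) = (\<Prod>j<i. of_nat n - of_nat j) / fact i"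
    by (simp add: gbinomial_prod_rev lessThan_atLeast0)
  then show ?thesis by (simp add: fact_quot_def binomial_gbinomial)
qed

text \<open>Vandermonde's identity expands the negative binomial coefficient
  \<open>(n + b) choose b\<close> in the \<open>n choose i\<close>, which are the
  \<open>fact_quot n (Suc i)\<close> up to \<open>fact i\<close>.\<close>

lemma geom_fps_power_nth:
  "fps_nth (geom_fps c ^ Suc b) n = (\<Sum>i\<le>b. of_nat (b choose (b - i)) / fact i * fact_quot n (Suc i)) * c ^ n"
proof -
  have "geom_fps c ^ Suc b = Abs_fps (\<lambda>k. of_nat ((Suc b + k - 1) choose k) * c ^ k)"
    unfolding geom_fps_def fps_inverse_power[symmetric] by (rule one_minus_const_fps_X_neg_power') simp
  then have "fps_nth (geom_fps c ^ Suc b) n = of_nat ((n + b) choose b) * c ^ n"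
    using binomial_symmetric[of n "n + b"] by (simp add: add.commute)
  also have "(n + b) choose b = (\<Sum>i\<le>b. (n choose i) * (b choose (b - i)))" by (rule vandermonde[symmetric])
  finally show ?thesis by (simp add: fact_quot_eq_choose mult_ac)
qed

text \<open>Partial fractions use only ring operations and reciprocals of the differences of the
  roots, so any property stable under these passes to the coefficients. In the application
  \<open>K\<close> combines at most a pole at infinity with algebraicity.\<close>

locale function_ring =
  fixes \<Omega> :: "complex set" and K :: "(complex \<Rightarrow> complex) set"
    and S :: "nat set" and \<Lambda> :: "nat \<Rightarrow> complex \<Rightarrow> complex"
  assumes K_const: "(\<lambda>_. c) \<in> K"
    and K_add: "u \<in> K \<Longrightarrow> v \<in> K \<Longrightarrow> (\<lambda>\<omega>. u \<omega> + v \<omega>) \<in> K"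
    and K_mult: "u \<in> K \<Longrightarrow> v \<in> K \<Longrightarrow> (\<lambda>\<omega>. u \<omega> * v \<omega>) \<in> K"
    and S: "finite S"
    and \<Lambda>: "\<alpha> \<in> S \<Longrightarrow> \<Lambda> \<alpha> \<in> K"
    and distinct: "\<alpha> \<in> S \<Longrightarrow> \<gamma> \<in> S \<Longrightarrow> \<alpha> \<noteq> \<gamma> \<Longrightarrow> \<omega> \<in> \<Omega> \<Longrightarrow> \<Lambda> \<alpha> \<omega> \<noteq> \<Lambda> \<gamma> \<omega>"
    and inv_diff: "\<alpha> \<in> S \<Longrightarrow> \<gamma> \<in> S \<Longrightarrow> \<alpha> \<noteq> \<gamma> \<Longrightarrow> (\<lambda>\<omega>. 1 / (\<Lambda> \<alpha> \<omega> - \<Lambda> \<gamma> \<omega>)) \<in> K"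
begin

lemma K_sum: "(\<And>i. i \<in> I \<Longrightarrow> u i \<in> K) \<Longrightarrow> (\<lambda>\<omega>. \<Sum>i\<in>I. u i \<omega>) \<in> K"
  by (induction I rule: infinite_finite_induct) (auto intro: K_const[of 0] K_add)

definition E :: "nat \<Rightarrow> complex \<Rightarrow> complex fps" where "E \<alpha> \<omega> = geom_fps (\<Lambda> \<alpha> \<omega>)"

definition span :: "(nat \<Rightarrow> nat) \<Rightarrow> (complex \<Rightarrow> complex fps) \<Rightarrow> bool" where
  "span m F \<longleftrightarrow> (\<exists>c. (\<forall>\<alpha>\<in>S. \<forall>\<beta>\<in>{1..m \<alpha>}. c \<alpha> \<beta> \<in> K) \<and>
     (\<forall>\<omega>\<in>\<Omega>. F \<omega> = (\<Sum>\<alpha>\<in>S. \<Sum>\<beta>=1..m \<alpha>. fps_const (c \<alpha> \<beta> \<omega>) * E \<alpha> \<omega> ^ \<beta>)))"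

lemma span_cong: "span m F \<Longrightarrow> (\<And>\<omega>. \<omega> \<in> \<Omega> \<Longrightarrow> G \<omega> = F \<omega>) \<Longrightarrow> span m G"
  unfolding span_def by auto

lemma span_0: "span m (\<lambda>_. 0)"
  unfolding span_def by (intro exI[of _ "\<lambda>_ _ _. 0"]) (use K_const in auto)

lemma span_add:
  assumes "span m F" "span m G" shows "span m (\<lambda>\<omega>. F \<omega> + G \<omega>)"
proof -
  obtain c c' where "\<forall>\<alpha>\<in>S. \<forall>\<beta>\<in>{1..m \<alpha>}. c \<alpha> \<beta> \<in> K" "\<forall>\<alpha>\<in>S. \<forall>\<beta>\<in>{1..m \<alpha>}. c' \<alpha> \<beta> \<in> K"
    "\<forall>\<omega>\<in>\<Omega>. F \<omega> = (\<Sum>\<alpha>\<in>S. \<Sum>\<beta>=1..m \<alpha>. fps_const (c \<alpha> \<beta> \<omega>) * E \<alpha> \<omega> ^ \<beta>)"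
    "\<forall>\<omega>\<in>\<Omega>. G \<omega> = (\<Sum>\<alpha>\<in>S. \<Sum>\<beta>=1..m \<alpha>. fps_const (c' \<alpha> \<beta> \<omega>) * E \<alpha> \<omega> ^ \<beta>)"
    using assms unfolding span_def by blast
  then show ?thesis unfolding span_def
    by (intro exI[of _ "\<lambda>\<alpha> \<beta> \<omega>. c \<alpha> \<beta> \<omega> + c' \<alpha> \<beta> \<omega>"])
      (auto intro: K_add simp: sum.distrib distrib_right simp flip: fps_const_add)
qed

lemma span_scale:
  assumes "span m F" "k \<in> K" shows "span m (\<lambda>\<omega>. fps_const (k \<omega>) * F \<omega>)"
proof -
  obtain c where "\<forall>\<alpha>\<in>S. \<forall>\<beta>\<in>{1..m \<alpha>}. c \<alpha> \<beta> \<in> K"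
    "\<forall>\<omega>\<in>\<Omega>. F \<omega> = (\<Sum>\<alpha>\<in>S. \<Sum>\<beta>=1..m \<alpha>. fps_const (c \<alpha> \<beta> \<omega>) * E \<alpha> \<omega> ^ \<beta>)"
    using assms unfolding span_def by blast
  then show ?thesis unfolding span_def
    by (intro exI[of _ "\<lambda>\<alpha> \<beta> \<omega>. k \<omega> * c \<alpha> \<beta> \<omega>"])
      (auto intro: K_mult assms simp: sum_distrib_left mult.assoc simp flip: fps_const_mult)
qed

lemma span_sum: "(\<And>i. i \<in> I \<Longrightarrow> span m (F i)) \<Longrightarrow> span m (\<lambda>\<omega>. \<Sum>i\<in>I. F i \<omega>)"
  by (induction I rule: infinite_finite_induct) (auto intro: span_0 span_add)

lemma span_basis:
  assumes "\<alpha> \<in> S" "1 \<le> \<beta>" "\<beta> \<le> m \<alpha>" shows "span m (\<lambda>\<omega>. E \<alpha> \<omega> ^ \<beta>)"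
  unfolding span_def
proof (intro exI[of _ "\<lambda>a b _. if a = \<alpha> \<and> b = \<beta> then 1 else 0"] conjI ballI)
  fix \<omega>
  have "(\<Sum>a\<in>S. \<Sum>b=1..m a. fps_const (if a = \<alpha> \<and> b = \<beta> then 1 else 0) * E a \<omega> ^ b) =
     (\<Sum>a\<in>S. if a = \<alpha> then E a \<omega> ^ \<beta> else 0)"
  proof (intro sum.cong refl)
    fix a
    show "(\<Sum>b=1..m a. fps_const (if a = \<alpha> \<and> b = \<beta> then 1 else 0) * E a \<omega> ^ b) = (if a = \<alpha> then E a \<omega> ^ \<beta> else 0)"
    proof (cases "a = \<alpha>")
      case True
      have "(\<Sum>b=1..m a. fps_const (if a = \<alpha> \<and> b = \<beta> then 1 else 0) * E a \<omega> ^ b) = (\<Sum>b=1..m a. if b = \<beta> then E a \<omega> ^ b else 0)"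
        using True by (intro sum.cong) auto
      then show ?thesis using True assms by simp
    qed simp
  qed
  then show "E \<alpha> \<omega> ^ \<beta> = (\<Sum>a\<in>S. \<Sum>b=1..m a. fps_const (if a = \<alpha> \<and> b = \<beta> then 1 else 0) * E a \<omega> ^ b)"
    using assms S by simp
qed (auto intro: K_const)

text \<open>By \<open>geom_fps_prod\<close> the product with one more factor
  \<open>E \<alpha>\<close> splits into the same product with one factor less and a pure power of
  \<open>E \<alpha>\<close>, with coefficients from \<open>K\<close>.\<close>

lemma span_mult_other:
  assumes "\<gamma> \<in> S" "\<alpha> \<in> S" "\<alpha> \<noteq> \<gamma>" "m \<gamma> \<ge> 1"
  shows "\<beta> \<le> m \<alpha> \<Longrightarrow> span m (\<lambda>\<omega>. E \<gamma> \<omega> * E \<alpha> \<omega> ^ \<beta>)"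
proof (induction \<beta>)
  case 0
  then show ?case using span_basis[of \<gamma> 1 m] assms by simp
next
  case (Suc \<beta>)
  let ?u = "\<lambda>\<omega>. 1 / (\<Lambda> \<gamma> \<omega> - \<Lambda> \<alpha> \<omega>)"
  have "span m (\<lambda>\<omega>. fps_const (?u \<omega>) * (fps_const (\<Lambda> \<gamma> \<omega>) * (E \<gamma> \<omega> * E \<alpha> \<omega> ^ \<beta>) +
     fps_const (-1) * (fps_const (\<Lambda> \<alpha> \<omega>) * E \<alpha> \<omega> ^ Suc \<beta>)))"
    using assms Suc by (intro span_scale span_add span_basis inv_diff \<Lambda> K_const) auto
  then show ?case
  proof (rule span_cong)
    fix \<omega> assume "\<omega> \<in> \<Omega>"
    then have ne: "\<Lambda> \<gamma> \<omega> \<noteq> \<Lambda> \<alpha> \<omega>" using distinct assms by metis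
    have "E \<gamma> \<omega> * E \<alpha> \<omega> ^ Suc \<beta> = (E \<gamma> \<omega> * E \<alpha> \<omega>) * E \<alpha> \<omega> ^ \<beta>" by simp
    also have "\<dots> = fps_const (?u \<omega>) * (fps_const (\<Lambda> \<gamma> \<omega>) * (E \<gamma> \<omega> * E \<alpha> \<omega> ^ \<beta>) +
       fps_const (-1) * (fps_const (\<Lambda> \<alpha> \<omega>) * E \<alpha> \<omega> ^ Suc \<beta>))"
      unfolding E_def geom_fps_prod[OF ne] by (simp add: algebra_simps flip: fps_const_neg)
    finally show "E \<gamma> \<omega> * E \<alpha> \<omega> ^ Suc \<beta> = \<dots>" .
  qed
qed

lemma span_mult:
  assumes F: "span m F" and \<gamma>: "\<gamma> \<in> S"
  shows "span (m(\<gamma> := Suc (m \<gamma>))) (\<lambda>\<omega>. E \<gamma> \<omega> * F \<omega>)"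
proof -
  let ?m = "m(\<gamma> := Suc (m \<gamma>))"
  obtain c where c: "\<forall>\<alpha>\<in>S. \<forall>\<beta>\<in>{1..m \<alpha>}. c \<alpha> \<beta> \<in> K"
    "\<forall>\<omega>\<in>\<Omega>. F \<omega> = (\<Sum>\<alpha>\<in>S. \<Sum>\<beta>=1..m \<alpha>. fps_const (c \<alpha> \<beta> \<omega>) * E \<alpha> \<omega> ^ \<beta>)"
    using F unfolding span_def by blast
  have "span ?m (\<lambda>\<omega>. \<Sum>\<alpha>\<in>S. \<Sum>\<beta>=1..m \<alpha>. fps_const (c \<alpha> \<beta> \<omega>) * (E \<gamma> \<omega> * E \<alpha> \<omega> ^ \<beta>))"
  proof (intro span_sum span_scale)
    fix \<alpha> \<beta> assume \<alpha>: "\<alpha> \<in> S" and \<beta>: "\<beta> \<in> {1..m \<alpha>}"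
    show "c \<alpha> \<beta> \<in> K" using c \<alpha> \<beta> by blast
    show "span ?m (\<lambda>\<omega>. E \<gamma> \<omega> * E \<alpha> \<omega> ^ \<beta>)"
    proof (cases "\<alpha> = \<gamma>")
      case True
      then show ?thesis using span_basis[of \<gamma> "Suc \<beta>" ?m] \<gamma> \<beta> by simp
    next
      case False
      then show ?thesis using \<gamma> \<alpha> \<beta> by (intro span_mult_other) auto
    qed
  qed
  then show ?thesis
    by (rule span_cong) (use c in \<open>simp add: sum_distrib_left mult.left_commute\<close>)
qed

text \<open>Induction on the total multiplicity, one factor at a time. It starts with a single
  factor, because with total multiplicity 0 the span offers only 0, not the empty product 1.\<close>

lemma span_prod:
  "sum m S = Suc N \<Longrightarrow> span m (\<lambda>\<omega>. \<Prod>\<alpha>\<in>S. E \<alpha> \<omega> ^ m \<alpha>)"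
proof (induction N arbitrary: m)
  case 0
  then obtain \<gamma> where \<gamma>: "\<gamma> \<in> S" "m \<gamma> = 1" "\<forall>\<alpha>\<in>S. \<alpha> \<noteq> \<gamma> \<longrightarrow> m \<alpha> = 0"
    using sum_eq_1_iff[OF S, of m] by auto
  have "span m (\<lambda>\<omega>. E \<gamma> \<omega> ^ 1)" using \<gamma> by (intro span_basis) auto
  then show ?case
  proof (rule span_cong)
    fix \<omega>
    have "(\<Prod>\<alpha>\<in>S. E \<alpha> \<omega> ^ m \<alpha>) = (\<Prod>\<alpha>\<in>S. if \<alpha> = \<gamma> then E \<gamma> \<omega> else 1)"
      using \<gamma> by (intro prod.cong) auto
    then show "(\<Prod>\<alpha>\<in>S. E \<alpha> \<omega> ^ m \<alpha>) = E \<gamma> \<omega> ^ 1" using \<gamma> S by simp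
  qed
next
  case (Suc N)
  have "sum m S \<noteq> 0" using Suc.prems by simp
  then obtain \<gamma> where \<gamma>: "\<gamma> \<in> S" "m \<gamma> \<noteq> 0" using S by auto
  define m' where "m' = m(\<gamma> := m \<gamma> - 1)"
  have m: "m'(\<gamma> := Suc (m' \<gamma>)) = m" using \<gamma> by (auto simp: m'_def)
  have "sum m S = m \<gamma> + sum m (S - {\<gamma>})" using \<gamma> S by (simp add: sum.remove)
  moreover have "sum m' S = m \<gamma> - 1 + sum m (S - {\<gamma>})" using \<gamma> S by (simp add: sum.remove m'_def)
  ultimately have "sum m' S = Suc N" using Suc.prems \<gamma> by simp
  from span_mult[OF Suc.IH[OF this] \<gamma>(1)] have "span m (\<lambda>\<omega>. E \<gamma> \<omega> * (\<Prod>\<alpha>\<in>S. E \<alpha> \<omega> ^ m' \<alpha>))" unfolding m .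
  then show ?case
  proof (rule span_cong)
    fix \<omega>
    have "(\<Prod>\<alpha>\<in>S. E \<alpha> \<omega> ^ m \<alpha>) = E \<gamma> \<omega> ^ m \<gamma> * (\<Prod>\<alpha>\<in>S - {\<gamma>}. E \<alpha> \<omega> ^ m \<alpha>)"
      using \<gamma> S by (simp add: prod.remove)
    also have "\<dots> = E \<gamma> \<omega> * (E \<gamma> \<omega> ^ m' \<gamma> * (\<Prod>\<alpha>\<in>S - {\<gamma>}. E \<alpha> \<omega> ^ m' \<alpha>))"
      using \<gamma> by (simp add: m'_def mult.assoc[symmetric] flip: power_Suc)
    also have "\<dots> = E \<gamma> \<omega> * (\<Prod>\<alpha>\<in>S. E \<alpha> \<omega> ^ m' \<alpha>)" using \<gamma> S by (simp add: prod.remove)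
    finally show "(\<Prod>\<alpha>\<in>S. E \<alpha> \<omega> ^ m \<alpha>) = E \<gamma> \<omega> * (\<Prod>\<alpha>\<in>S. E \<alpha> \<omega> ^ m' \<alpha>)" .
  qed
qed

lemma partial_fractions:
  assumes "sum m S \<noteq> 0"
  shows "\<exists>C. (\<forall>\<alpha>\<in>S. \<forall>\<beta>\<in>{1..m \<alpha>}. C \<alpha> \<beta> \<in> K) \<and> (\<forall>\<omega>\<in>\<Omega>. \<forall>n. fps_nth (\<Prod>\<alpha>\<in>S. geom_fps (\<Lambda> \<alpha> \<omega>) ^ m \<alpha>) n =
     (\<Sum>\<alpha>\<in>S. \<Sum>\<beta>=1..m \<alpha>. C \<alpha> \<beta> \<omega> * fact_quot n \<beta> * \<Lambda> \<alpha> \<omega> ^ n))"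
proof -
  obtain N where "sum m S = Suc N" using assms not0_implies_Suc by blast
  from span_prod[OF this] obtain c where c: "\<forall>\<alpha>\<in>S. \<forall>\<beta>\<in>{1..m \<alpha>}. c \<alpha> \<beta> \<in> K"
    "\<forall>\<omega>\<in>\<Omega>. (\<Prod>\<alpha>\<in>S. E \<alpha> \<omega> ^ m \<alpha>) = (\<Sum>\<alpha>\<in>S. \<Sum>\<beta>=1..m \<alpha>. fps_const (c \<alpha> \<beta> \<omega>) * E \<alpha> \<omega> ^ \<beta>)"
    unfolding span_def by blast
  \<comment> \<open>The change of basis from \<open>geom_fps_power_nth\<close>, with indices
    starting at 1.\<close>
  define k where "k b i = (of_nat ((b - 1) choose (b - i)) / fact (i - 1) :: complex)" for b i :: nat
  have En: "fps_nth (E \<alpha> \<omega> ^ b) n = (\<Sum>i=1..b. k b i * fact_quot n i) * \<Lambda> \<alpha> \<omega> ^ n" if b1: "b \<ge> 1" for \<alpha> \<omega> b n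
  proof -
    obtain b' where b: "b = Suc b'" using b1 by (cases b) auto
    have "(\<Sum>i=1..b. k b i * fact_quot n i) = (\<Sum>i\<le>b'. k b (Suc i) * fact_quot n (Suc i))"
      unfolding b by (rule sum.reindex_bij_witness[of _ Suc "\<lambda>i. i - 1"]) auto
    then show ?thesis unfolding E_def b geom_fps_power_nth by (simp add: k_def)
  qed
  \<comment> \<open>The power \<open>b\<close> contributes to every \<open>fact_quot n i\<close>
    with \<open>i \<le> b\<close>; summing over \<open>b\<close> first collects the coefficient for
    \<open>i\<close>.\<close>
  define C where "C \<alpha> i \<omega> = (\<Sum>b=i..m \<alpha>. k b i * c \<alpha> b \<omega>)" for \<alpha> i \<omega>
  have "C \<alpha> \<beta> \<in> K" if "\<alpha> \<in> S" "\<beta> \<in> {1..m \<alpha>}" for \<alpha> \<beta>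
    unfolding C_def[abs_def] using that c(1) by (intro K_sum K_mult K_const) auto
  moreover have "fps_nth (\<Prod>\<alpha>\<in>S. geom_fps (\<Lambda> \<alpha> \<omega>) ^ m \<alpha>) n =
     (\<Sum>\<alpha>\<in>S. \<Sum>\<beta>=1..m \<alpha>. C \<alpha> \<beta> \<omega> * fact_quot n \<beta> * \<Lambda> \<alpha> \<omega> ^ n)" if "\<omega> \<in> \<Omega>" for \<omega> n
  proof -
    have "fps_nth (\<Prod>\<alpha>\<in>S. geom_fps (\<Lambda> \<alpha> \<omega>) ^ m \<alpha>) n = (\<Sum>\<alpha>\<in>S. \<Sum>b=1..m \<alpha>. c \<alpha> b \<omega> * ((\<Sum>i=1..b. k b i * fact_quot n i) * \<Lambda> \<alpha> \<omega> ^ n))"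
      using c(2) that by (simp add: E_def[symmetric] fps_sum_nth En)
    also have "\<dots> = (\<Sum>\<alpha>\<in>S. \<Sum>\<beta>=1..m \<alpha>. C \<alpha> \<beta> \<omega> * fact_quot n \<beta> * \<Lambda> \<alpha> \<omega> ^ n)"
    proof (rule sum.cong[OF refl])
      fix \<alpha>
      have "(\<Sum>b=1..m \<alpha>. c \<alpha> b \<omega> * ((\<Sum>i=1..b. k b i * fact_quot n i) * \<Lambda> \<alpha> \<omega> ^ n)) =
          (\<Sum>b=1..m \<alpha>. \<Sum>i=1..b. k b i * c \<alpha> b \<omega> * fact_quot n i * \<Lambda> \<alpha> \<omega> ^ n)"
        by (simp add: sum_distrib_left sum_distrib_right mult_ac)
      also have "\<dots> = (\<Sum>i=1..m \<alpha>. \<Sum>b=i..m \<alpha>. k b i * c \<alpha> b \<omega> * fact_quot n i * \<Lambda> \<alpha> \<omega> ^ n)"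
        unfolding sum.Sigma[OF finite_atLeastAtMost ballI[OF finite_atLeastAtMost]]
        by (rule sum.reindex_bij_witness[of _ "\<lambda>(i, b). (b, i)" "\<lambda>(b, i). (i, b)"]) auto
      finally show "(\<Sum>b=1..m \<alpha>. c \<alpha> b \<omega> * ((\<Sum>i=1..b. k b i * fact_quot n i) * \<Lambda> \<alpha> \<omega> ^ n)) =
         (\<Sum>\<beta>=1..m \<alpha>. C \<alpha> \<beta> \<omega> * fact_quot n \<beta> * \<Lambda> \<alpha> \<omega> ^ n)"
        by (simp add: C_def sum_distrib_right)
    qed
    finally show ?thesis .
  qed
  ultimately show ?thesis by blast
qed

end

section \<open>Moment derivatives and formal solutions\<close>

lemma taylor_sum:
  assumes "\<And>j. j \<in> J \<Longrightarrow> h j holomorphic_on ball 0 r" "r > 0"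
  shows "taylor (\<lambda>v. \<Sum>j\<in>J. c j * h j v) i = (\<Sum>j\<in>J. c j * taylor (h j) i)"
proof (rule taylor_unique[OF assms(2)])
  fix v :: complex assume "norm v < r"
  then have "(\<lambda>i. \<Sum>j\<in>J. c j * (taylor (h j) i * v ^ i)) sums (\<Sum>j\<in>J. c j * h j v)"
    by (intro sums_sum sums_mult taylor_sums[OF assms(1)])
  then show "(\<lambda>i. (\<Sum>j\<in>J. c j * taylor (h j) i) * v ^ i) sums (\<Sum>j\<in>J. c j * h j v)"
    by (simp add: sum_distrib_right mult.assoc)
qed

lemma cball_bound:
  fixes \<phi> :: "complex \<Rightarrow> complex"
  assumes "continuous_on (cball 0 e) \<phi>"
  shows "\<exists>B. \<forall>v. norm v \<le> e \<longrightarrow> norm (\<phi> v) \<le> B"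
proof -
  have "bounded (\<phi> ` cball 0 e)" using assms by (intro compact_imp_bounded compact_continuous_image) auto
  then obtain B where "\<forall>y\<in>\<phi> ` cball 0 e. norm y \<le> B" by (auto simp: bounded_iff)
  then show ?thesis by (intro exI[of _ B]) auto
qed

lemma has_sum_finite_sum:
  fixes f :: "'j \<Rightarrow> 'a \<Rightarrow> 'c :: real_normed_vector"
  assumes "\<And>j. j \<in> J \<Longrightarrow> (f j has_sum S j) A"
  shows "((\<lambda>x. \<Sum>j\<in>J. f j x) has_sum (\<Sum>j\<in>J. S j)) A"
  using assms by (induction J rule: infinite_finite_induct) (auto intro: has_sum_add)

lemma inf_rep_common:
  assumes "finite J" "T > 0" "\<And>j. j \<in> J \<Longrightarrow> \<exists>N h. inf_rep T N h (L j)"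
  shows "\<exists>N h. \<forall>j\<in>J. inf_rep T N (h j) (L j)"
proof -
  obtain M g where M: "\<And>j. j \<in> J \<Longrightarrow> inf_rep T (M j) (g j) (L j)" using assms(3) by metis
  define N where "N = Max (insert 0 (M ` J))"
  have "\<exists>h. inf_rep T N h (L j)" if "j \<in> J" for j
  proof -
    have "M j \<le> N" unfolding N_def using assms(1) that by (intro Max_ge) auto
    then show ?thesis using inf_rep_add_exp[OF M[OF that] assms(2), of "N - M j"] by auto
  qed
  then show ?thesis by metis
qed

section \<open>Linearity in the symbol and the operators attached to powers\<close>

context
  fixes s \<rho> d r T :: real
  assumes s: "s > 0" and d: "0 < d" "d < r" and T: "0 < T" "T < \<rho>"
begin

lemma ball_series:
  assumes "\<phi> holomorphic_on ball 0 r"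
  shows "summable (\<lambda>n. norm (taylor \<phi> n) * d ^ n)" "norm w = d \<Longrightarrow> (\<lambda>n. taylor \<phi> n * w ^ n) sums \<phi> w"
proof -
  define e where "e = (d + r) / 2"
  have e: "d < e" "e < r" using d by (auto simp: e_def)
  have sub: "ball (0::complex) e \<subseteq> ball 0 r" "cball (0::complex) e \<subseteq> ball 0 r" using e by auto
  have hol: "\<phi> holomorphic_on ball 0 e" using assms sub by (auto intro: holomorphic_on_subset)
  have cont: "continuous_on (cball 0 e) \<phi>" using assms sub by (auto intro: holomorphic_on_imp_continuous_on holomorphic_on_subset)
  obtain B where "\<And>v. norm v \<le> e \<Longrightarrow> norm (\<phi> v) \<le> B"
    using cball_bound[OF cont] by blast
  then show "summable (\<lambda>n. norm (taylor \<phi> n) * d ^ n)"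
    using taylor_abs_summable(1)[OF hol cont, of B d] d e by auto
  show "norm w = d \<Longrightarrow> (\<lambda>n. taylor \<phi> n * w ^ n) sums \<phi> w"
    using taylor_sums[OF assms, of w] d by simp
qed

lemma inf_rep_series:
  assumes "inf_rep T N h L"
  shows "summable (\<lambda>i. norm (taylor h i) * inverse \<rho> ^ i)"
    and "norm \<zeta> \<ge> \<rho> \<Longrightarrow> (\<lambda>i. taylor h i * \<zeta> powi (int N - int i)) sums L \<zeta>"
proof -
  define \<rho>' where "\<rho>' = (T + \<rho>) / 2"
  have r: "T < \<rho>'" "\<rho>' < \<rho>" using T by (auto simp: \<rho>'_def)
  have "cball (0::complex) (1 / \<rho>') \<subseteq> ball 0 (1 / T)" using frac_less2[of 1 1 T \<rho>'] T r by auto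
  then have "continuous_on (cball 0 (1 / \<rho>')) h"
    using inf_repD(1)[OF assms] by (auto intro: holomorphic_on_imp_continuous_on holomorphic_on_subset)
  then obtain B where B: "\<And>v. norm v \<le> 1 / \<rho>' \<Longrightarrow> norm (h v) \<le> B"
    using cball_bound by blast
  show "summable (\<lambda>i. norm (taylor h i) * inverse \<rho> ^ i)"
    "norm \<zeta> \<ge> \<rho> \<Longrightarrow> (\<lambda>i. taylor h i * \<zeta> powi (int N - int i)) sums L \<zeta>"
    using inf_rep_expansion(1,3)[OF assms T(1) r B] by auto
qed

lemma rho_pos: "\<rho> > 0" using T by simp

lemma psdo_has_sum:
  assumes L: "inf_rep T N h L" and \<phi>: "\<phi> holomorphic_on ball 0 r" and z: "4 powr s * norm z < d"
  shows "(psdo_term s \<rho> d (taylor \<phi>) (taylor h) N t0 z has_sum psdo s \<rho> d t0 L \<phi> z) UNIV"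
    and "(\<lambda>p. norm (psdo_term s \<rho> d (taylor \<phi>) (taylor h) N t0 z p)) summable_on UNIV"
  using psdo_series(1,2)[OF s rho_pos d(1) inf_rep_series[OF L] ball_series[OF \<phi>] z] by auto

text \<open>After passing to a common exponent the Taylor coefficients at infinity are linear in the
  symbol, hence so is every term of the triple series. The values of \<open>monomial_op\<close> at
  the fixed \<open>t0\<close> are the same in all of them, resonant or not.\<close>

lemma psdo_linear:
  assumes J: "finite J" and L: "\<And>j. j \<in> J \<Longrightarrow> \<exists>N h. inf_rep T N h (L j)"
    and eq: "\<And>\<omega>. T < norm \<omega> \<Longrightarrow> G \<omega> = (\<Sum>j\<in>J. c j * L j \<omega>)"
    and \<phi>: "\<phi> holomorphic_on ball 0 r" and z: "4 powr s * norm z < d"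
  shows "psdo s \<rho> d t0 G \<phi> z = (\<Sum>j\<in>J. c j * psdo s \<rho> d t0 (L j) \<phi> z)"
proof -
  obtain N h where h: "\<And>j. j \<in> J \<Longrightarrow> inf_rep T N (h j) (L j)" using inf_rep_common[of J T L] J T(1) L by blast
  have "inf_rep T N (\<lambda>v. \<Sum>j\<in>J. c j * h j v) (\<lambda>\<omega>. \<Sum>j\<in>J. c j * L j \<omega>)" by (rule inf_rep_sum[OF h])
  then have G: "inf_rep T N (\<lambda>v. \<Sum>j\<in>J. c j * h j v) G" using eq by (simp add: inf_rep_def)
  have "((\<lambda>p. \<Sum>j\<in>J. c j * psdo_term s \<rho> d (taylor \<phi>) (taylor (h j)) N t0 z p) has_sum (\<Sum>j\<in>J. c j * psdo s \<rho> d t0 (L j) \<phi> z)) UNIV"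
    using psdo_has_sum(1)[OF h \<phi> z] by (intro has_sum_finite_sum has_sum_cmult_right) auto
  moreover have "(\<Sum>j\<in>J. c j * psdo_term s \<rho> d (taylor \<phi>) (taylor (h j)) N t0 z p) =
      psdo_term s \<rho> d (taylor \<phi>) (taylor (\<lambda>v. \<Sum>j\<in>J. c j * h j v)) N t0 z p" for p
    using taylor_sum[of J h "1 / T" c] inf_repD(1)[OF h] T
    by (simp add: psdo_term_def[OF s rho_pos d(1)] case_prod_unfold sum_distrib_left sum_distrib_right sum_divide_distrib mult_ac)
  ultimately have "(psdo_term s \<rho> d (taylor \<phi>) (taylor (\<lambda>v. \<Sum>j\<in>J. c j * h j v)) N t0 z has_sum
      (\<Sum>j\<in>J. c j * psdo s \<rho> d t0 (L j) \<phi> z)) UNIV" by simp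
  then show ?thesis using psdo_has_sum(1)[OF G \<phi> z] has_sum_unique by blast
qed

text \<open>The expansion of the symbol has a single term, and \<open>monomial_op_nonneg\<close>
  leaves only the indices on a diagonal. The result is the power series of the \<open>a\<close>-th
  moment derivative.\<close>

lemma psdo_power_sums:
  assumes \<phi>: "\<phi> holomorphic_on ball 0 r" and z: "4 powr s * norm z < d"
  shows "(\<lambda>m. taylor \<phi> (m + a) * of_real (Gamma (1 + real (m + a) * s) / Gamma (1 + real m * s)) * z ^ m) sums
    psdo s \<rho> d t0 (\<lambda>\<omega>. \<omega> ^ a) \<phi> z"
proof -
  define H where "H i = (if i = 0 then 1 else 0 :: complex)" for i :: nat
  have 1: "summable (\<lambda>i. norm (H i) * inverse \<rho> ^ i)"
    by (rule summable_finite[of "{0}"]) (auto simp: H_def)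
  have 2: "(\<lambda>i. H i * \<zeta> powi (int a - int i)) sums \<zeta> ^ a" for \<zeta> :: complex
    using sums_finite[of "{0}" "\<lambda>i. H i * \<zeta> powi (int a - int i)"] by (auto simp: H_def)
  let ?t = "psdo_term s \<rho> d (taylor \<phi>) H a t0 z"
  have hs: "(?t has_sum psdo s \<rho> d t0 (\<lambda>\<omega>. \<omega> ^ a) \<phi> z) UNIV"
    by (rule psdo_series(2)[OF s rho_pos d(1) 1 2 ball_series[OF \<phi>] z])
  \<comment> \<open>The surviving triples: \<open>i = 0\<close> and
    \<open>n = m + a\<close>.\<close>
  let ?g = "\<lambda>m. (m + a, m, 0::nat)"
  have zero: "?t p = 0" if "p \<notin> range ?g" for p
  proof -
    obtain n m i where p: "p = (n, m, i)" by (cases p) auto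
    show ?thesis
    proof (cases "i = 0")
      case True
      with that p have "n \<noteq> m + a" by auto
      then show ?thesis
        using True p monomial_op_nonneg[OF s rho_pos d(1), of t0 "a + m" n]
        by (simp add: psdo_term_def[OF s rho_pos d(1)] add.commute flip: of_nat_add)
    qed (simp add: psdo_term_def[OF s rho_pos d(1)] p H_def)
  qed
  have "(?t has_sum psdo s \<rho> d t0 (\<lambda>\<omega>. \<omega> ^ a) \<phi> z) (range ?g)"
    using hs zero by (subst has_sum_cong_neutral[of "UNIV" "range ?g" ?t ?t]) auto
  then have "((?t \<circ> ?g) has_sum psdo s \<rho> d t0 (\<lambda>\<omega>. \<omega> ^ a) \<phi> z) UNIV"
    by (subst (asm) has_sum_reindex) (auto intro: injI)
  then have "(?t \<circ> ?g) sums psdo s \<rho> d t0 (\<lambda>\<omega>. \<omega> ^ a) \<phi> z" by (rule has_sum_imp_sums)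
  moreover have "(?t \<circ> ?g) m = taylor \<phi> (m + a) * of_real (Gamma (1 + real (m + a) * s) / Gamma (1 + real m * s)) * z ^ m" for m
    using monomial_op_nonneg[OF s rho_pos d(1), of t0 "a + m" "m + a"]
    by (simp add: psdo_term_def[OF s rho_pos d(1)] H_def add.commute flip: of_nat_add)
  ultimately show ?thesis by (simp add: o_def)
qed

end

text \<open>These coefficients turn the moment derivative into a shift.\<close>

definition borel_coeff :: "real \<Rightarrow> (complex \<Rightarrow> complex) \<Rightarrow> nat \<Rightarrow> complex" where
  "borel_coeff s \<phi> n = of_real (Gamma_seq s n) * taylor \<phi> n"

text \<open>The action of \<open>Q(\<zeta>)\<close> on coefficient sequences. The variable
  \<open>\<zeta>\<close> moves by \<open>\<kappa>\<close> places because the moment derivative in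
  \<open>z\<close> is the \<open>\<kappa>\<close>-th power of the one in \<open>w\<close>.\<close>

definition shift_op :: "nat \<Rightarrow> complex poly \<Rightarrow> (nat \<Rightarrow> complex) \<Rightarrow> nat \<Rightarrow> complex" where
  "shift_op \<kappa> Q b n = (\<Sum>j\<le>degree Q. coeff Q j * b (n + \<kappa> * j))"

lemma shift_op_bound: "degree Q \<le> D \<Longrightarrow> shift_op \<kappa> Q b n = (\<Sum>j\<le>D. coeff Q j * b (n + \<kappa> * j))"
  unfolding shift_op_def by (rule sum.mono_neutral_left) (auto simp: coeff_eq_0)

lemma shift_op_0 [simp]: "shift_op \<kappa> 0 b n = 0" by (simp add: shift_op_def)

lemma shift_op_pCons: "shift_op \<kappa> (pCons a Q) b n = a * b n + shift_op \<kappa> Q b (n + \<kappa>)"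
proof -
  have "shift_op \<kappa> (pCons a Q) b n = (\<Sum>j\<le>Suc (degree Q). coeff (pCons a Q) j * b (n + \<kappa> * j))"
    by (rule shift_op_bound) (rule degree_pCons_le)
  then show ?thesis by (simp add: sum.atMost_Suc_shift shift_op_def algebra_simps del: sum.atMost_Suc)
qed

lemma shift_op_add: "shift_op \<kappa> (P + Q) b n = shift_op \<kappa> P b n + shift_op \<kappa> Q b n"
  by (subst (1 2 3) shift_op_bound[of _ "max (degree P) (degree Q)"])
    (auto simp: degree_add_le_max distrib_right sum.distrib)

lemma shift_op_sum: "shift_op \<kappa> (\<Sum>i\<in>I. P i) b n = (\<Sum>i\<in>I. shift_op \<kappa> (P i) b n)"
  by (induction I rule: infinite_finite_induct) (auto simp: shift_op_add)

lemma shift_op_sum_right: "shift_op \<kappa> P (\<lambda>k. \<Sum>i\<in>I. b i k) n = (\<Sum>i\<in>I. shift_op \<kappa> P (b i) n)"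
  unfolding shift_op_def sum_distrib_left by (rule sum.swap)

lemma shift_op_smult: "shift_op \<kappa> (Polynomial.smult a Q) b n = a * shift_op \<kappa> Q b n"
  by (subst shift_op_bound[of _ "degree Q"]) (auto simp: shift_op_def sum_distrib_left mult.assoc)

text \<open>Makes sequences a module over the polynomials, so that identities between symbols can be
  applied to Taylor coefficients.\<close>

lemma shift_op_mult: "shift_op \<kappa> (P * Q) b n = shift_op \<kappa> P (shift_op \<kappa> Q b) n"
  by (induction P arbitrary: n) (auto simp: shift_op_pCons shift_op_add shift_op_smult)

lemma shift_op_1 [simp]: "shift_op \<kappa> 1 b n = b n" by (simp add: shift_op_def)

text \<open>The sequence \<open>q\<close> is the convolution inverse of the coefficients of
  \<open>P\<close>, and operators of this kind compose like their symbols. The formula is checked by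
  inserting the equation for \<open>F\<close>.\<close>

lemma solve_shift_equation:
  fixes P :: "complex poly poly" and q :: "nat \<Rightarrow> complex poly" and X F :: "nat \<Rightarrow> nat \<Rightarrow> complex"
  assumes eq: "\<And>N k. (\<Sum>j\<le>min N (degree P). shift_op \<kappa> (coeff P j) (X (N - j)) k) = F N k"
    and q: "\<And>M. (\<Sum>n\<le>M. q n * coeff P (M - n)) = (if M = 0 then 1 else 0)"
  shows "X N k = (\<Sum>n\<le>N. shift_op \<kappa> (q n) (F (N - n)) k)"
proof -
  have F: "F M = (\<lambda>k. \<Sum>j\<le>M. shift_op \<kappa> (coeff P j) (X (M - j)) k)" for M
  proof
    fix k
    have "(\<Sum>j\<le>M. shift_op \<kappa> (coeff P j) (X (M - j)) k) = (\<Sum>j\<le>min M (degree P). shift_op \<kappa> (coeff P j) (X (M - j)) k)"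
    proof (rule sum.mono_neutral_right)
      show "\<forall>i\<in>{..M} - {..min M (degree P)}. shift_op \<kappa> (coeff P i) (X (M - i)) k = 0"
      proof
        fix i assume "i \<in> {..M} - {..min M (degree P)}"
        then have "degree P < i" by auto
        then show "shift_op \<kappa> (coeff P i) (X (M - i)) k = 0" by (simp add: coeff_eq_0)
      qed
    qed auto
    then show "F M k = (\<Sum>j\<le>M. shift_op \<kappa> (coeff P j) (X (M - j)) k)" using eq by simp
  qed
  have "(\<Sum>n\<le>N. shift_op \<kappa> (q n) (F (N - n)) k) =
      (\<Sum>n\<le>N. \<Sum>j\<le>N - n. shift_op \<kappa> (q n * coeff P j) (X (N - n - j)) k)"
    unfolding F shift_op_sum_right shift_op_mult ..
  \<comment> \<open>The terms are regrouped by \<open>M = n + j\<close>; the inner sum becomes the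
    convolution, which leaves only \<open>M = 0\<close>.\<close>
  also have "\<dots> = (\<Sum>(n, j)\<in>{(n, j). n + j \<le> N}. shift_op \<kappa> (q n * coeff P j) (X (N - (n + j))) k)"
    unfolding sum.Sigma[OF finite_atMost ballI[OF finite_atMost]] by (intro sum.cong) auto
  also have "\<dots> = (\<Sum>M\<le>N. \<Sum>n\<le>M. shift_op \<kappa> (q n * coeff P (M - n)) (X (N - (n + (M - n)))) k)"
    by (rule sum.triangle_reindex_eq)
  also have "\<dots> = (\<Sum>M\<le>N. shift_op \<kappa> (\<Sum>n\<le>M. q n * coeff P (M - n)) (X (N - M)) k)"
    unfolding shift_op_sum by (intro sum.cong) auto
  also have "\<dots> = (\<Sum>M\<le>N. if M = 0 then X N k else 0)"
    unfolding q by (intro sum.cong) auto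
  finally show ?thesis by simp
qed

text \<open>The radius stays open because the estimates control a moment derivative only on a
  smaller disc, while the comparison of Taylor coefficients needs no common radius.\<close>

definition germ :: "(complex \<Rightarrow> complex) \<Rightarrow> bool" where
  "germ \<phi> \<longleftrightarrow> (\<exists>r>0. \<phi> holomorphic_on ball 0 r)"

text \<open>\<open>Gamma_1_add_le\<close> bounds the quotient of consecutive moments geometrically,
  which preserves a positive radius of convergence; the shift can then be read off the
  series.\<close>

lemma moment_deriv_germ:
  assumes s: "s > 0" and g: "germ \<phi>"
  shows "germ (moment_deriv (Gamma_seq s) \<phi>)"
    and "borel_coeff s (moment_deriv (Gamma_seq s) \<phi>) n = borel_coeff s \<phi> (Suc n)"
proof -
  obtain r where r: "r > 0" "\<phi> holomorphic_on ball 0 r" using g by (auto simp: germ_def)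
  define e where "e = r / 2"
  have e: "e > 0" "e < r" using r by (auto simp: e_def)
  have sub: "cball (0::complex) e \<subseteq> ball 0 r" "ball (0::complex) e \<subseteq> ball 0 r" using e by auto
  have hol: "\<phi> holomorphic_on ball 0 e" and cont: "continuous_on (cball 0 e) \<phi>"
    using holomorphic_on_subset[OF r(2)] sub holomorphic_on_imp_continuous_on by blast+
  obtain B where B: "\<And>v. norm v \<le> e \<Longrightarrow> norm (\<phi> v) \<le> B"
    using cball_bound[OF cont] by blast
  define a where "a n = borel_coeff s \<phi> (Suc n) / of_real (Gamma_seq s n)" for n
  define C where "C = 2 * 4 powr s * Gamma (1 + s) * (B / e)"
  \<comment> \<open>The factor \<open>4 powr s\<close> is the ratio in the bound on
    \<open>Gamma_seq s (Suc n) / Gamma_seq s n\<close>.\<close>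
  define r1 where "r1 = e / 4 powr s"
  have r1: "r1 > 0" using e by (simp add: r1_def)
  have Gp: "Gamma_seq s n > 0" for n unfolding Gamma_seq_def using s by (intro Gamma_1_plus_pos) simp
  have an: "norm (a n) \<le> C * (1 / r1) ^ n" for n
  proof -
    have "Gamma_seq s (Suc n) \<le> 2 * (4 powr (s * real n + s) * Gamma_seq s n * Gamma (1 + s))"
      using Gamma_1_add_le[of "s * real n" s] s by (simp add: Gamma_seq_def algebra_simps)
    then have "Gamma_seq s (Suc n) / Gamma_seq s n \<le> 2 * 4 powr (s * real n + s) * Gamma (1 + s)"
      using Gp[of n] by (simp add: divide_le_eq mult_ac)
    also have "4 powr (s * real n + s) = 4 powr s * (4 powr s) ^ n"
      by (simp add: powr_add powr_powr[symmetric] powr_realpow)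
    finally have "Gamma_seq s (Suc n) / Gamma_seq s n \<le> 2 * (4 powr s * (4 powr s) ^ n) * Gamma (1 + s)" .
    then have "Gamma_seq s (Suc n) / Gamma_seq s n * norm (taylor \<phi> (Suc n)) \<le>
        (2 * (4 powr s * (4 powr s) ^ n) * Gamma (1 + s)) * (B / e ^ Suc n)"
      using norm_taylor_le[OF hol cont e(1) B, of "Suc n"] Gp[of n] Gp[of "Suc n"] s Gamma_1_plus_pos[of s]
      by (intro mult_mono) (auto intro!: mult_nonneg_nonneg simp: less_imp_le)
    also have "\<dots> = C * (1 / r1) ^ n" by (simp add: C_def r1_def power_divide)
    finally show ?thesis using Gp[of n] Gp[of "Suc n"] by (simp add: a_def borel_coeff_def norm_mult norm_divide)
  qed
  have md: "moment_deriv (Gamma_seq s) \<phi> z = (\<Sum>n. a n * z ^ n)" for z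
    by (simp add: moment_deriv_def a_def borel_coeff_def taylor_def)
  have sums: "(\<lambda>n. a n * z ^ n) sums moment_deriv (Gamma_seq s) \<phi> z" if z: "norm z < r1" for z
    unfolding md
  proof (rule summable_sums, rule summable_comparison_test'[where N = 0])
    show "summable (\<lambda>n. C * (norm z / r1) ^ n)" using z r1 by (intro summable_mult summable_geometric) simp
    show "norm (a n * z ^ n) \<le> C * (norm z / r1) ^ n" for n
      using mult_right_mono[OF an[of n], of "norm z ^ n"] by (simp add: norm_mult norm_power power_divide)
  qed
  have "moment_deriv (Gamma_seq s) \<phi> holomorphic_on ball 0 r1"
    by (rule power_series_holomorphic[of _ _ a]) (use sums in simp)
  then show "germ (moment_deriv (Gamma_seq s) \<phi>)" using r1 by (auto simp: germ_def)
  show "borel_coeff s (moment_deriv (Gamma_seq s) \<phi>) n = borel_coeff s \<phi> (Suc n)"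
    using taylor_unique[OF r1 sums, of n] Gp[of n] by (simp add: borel_coeff_def[of _ "moment_deriv _ _"] a_def)
qed

lemma moment_deriv_funpow_germ:
  assumes s: "s > 0" and g: "germ \<phi>"
  shows "germ ((moment_deriv (Gamma_seq s) ^^ j) \<phi>)"
    and "borel_coeff s ((moment_deriv (Gamma_seq s) ^^ j) \<phi>) n = borel_coeff s \<phi> (n + j)"
proof (induction j arbitrary: n)
  case 0
  { case 1 show ?case using g by simp }
  { case 2 show ?case by simp }
next
  case (Suc j)
  { case 1 show ?case using moment_deriv_germ(1)[OF s Suc(1)] by simp }
  { case 2 show ?case using moment_deriv_germ(2)[OF s Suc(1), of n] Suc(2)[of "Suc n"] by simp }
qed

lemma germ_sum:
  assumes "finite J" "\<And>j. j \<in> J \<Longrightarrow> germ (h j)"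
  shows "germ (\<lambda>v. \<Sum>j\<in>J. c j * h j v)"
    and "taylor (\<lambda>v. \<Sum>j\<in>J. c j * h j v) i = (\<Sum>j\<in>J. c j * taylor (h j) i)"
proof -
  obtain r where r: "\<And>j. j \<in> J \<Longrightarrow> r j > 0" "\<And>j. j \<in> J \<Longrightarrow> h j holomorphic_on ball 0 (r j)"
    using assms(2) unfolding germ_def by metis
  define R where "R = Min (insert 1 (r ` J))"
  have R: "R > 0" unfolding R_def using assms(1) r(1) by (subst Min_gr_iff) auto
  have Rle: "R \<le> r j" if "j \<in> J" for j unfolding R_def using assms(1) that by (intro Min_le) auto
  have h: "h j holomorphic_on ball 0 R" if "j \<in> J" for j
    by (rule holomorphic_on_subset[OF r(2)[OF that] subset_ball[OF Rle[OF that]]])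
  show "germ (\<lambda>v. \<Sum>j\<in>J. c j * h j v)" unfolding germ_def using R h by (intro exI[of _ R] conjI holomorphic_intros) auto
  show "taylor (\<lambda>v. \<Sum>j\<in>J. c j * h j v) i = (\<Sum>j\<in>J. c j * taylor (h j) i)"
    by (rule taylor_sum[OF h R])
qed

lemma poly_moment_op_germ:
  assumes s: "s > 0" and \<kappa>: "\<kappa> \<ge> 1" and g: "germ \<phi>"
  shows "germ (poly_moment_op \<kappa> s Q \<phi>)"
    and "borel_coeff (s / real \<kappa>) (poly_moment_op \<kappa> s Q \<phi>) n = shift_op \<kappa> Q (borel_coeff (s / real \<kappa>) \<phi>) n"
proof -
  have s': "s / real \<kappa> > 0" using s \<kappa> by simp
  have pw: "moment_deriv_ram \<kappa> s ^^ j = moment_deriv (Gamma_seq (s / real \<kappa>)) ^^ (\<kappa> * j)" for j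
    unfolding moment_deriv_ram_def by (simp add: funpow_mult mult.commute)
  have eq: "poly_moment_op \<kappa> s Q \<phi> = (\<lambda>w. \<Sum>j\<le>degree Q. coeff Q j * (moment_deriv (Gamma_seq (s / real \<kappa>)) ^^ (\<kappa> * j)) \<phi> w)"
    by (simp add: poly_moment_op_def fun_eq_iff pw)
  show "germ (poly_moment_op \<kappa> s Q \<phi>)"
    unfolding eq by (intro germ_sum(1) moment_deriv_funpow_germ(1)[OF s' g]) simp
  have "borel_coeff (s / real \<kappa>) (poly_moment_op \<kappa> s Q \<phi>) n =
    (\<Sum>j\<le>degree Q. coeff Q j * borel_coeff (s / real \<kappa>) ((moment_deriv (Gamma_seq (s / real \<kappa>)) ^^ (\<kappa> * j)) \<phi>) n)"
    unfolding borel_coeff_def eq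
    by (subst germ_sum(2)) (auto intro: moment_deriv_funpow_germ(1)[OF s' g] simp: sum_distrib_left mult.left_commute)
  then show "borel_coeff (s / real \<kappa>) (poly_moment_op \<kappa> s Q \<phi>) n = shift_op \<kappa> Q (borel_coeff (s / real \<kappa>) \<phi>) n"
    unfolding moment_deriv_funpow_germ(2)[OF s' g] shift_op_def .
qed

lemma taylor_cong:
  assumes "r > 0" "\<And>w. norm w < r \<Longrightarrow> g w = h w" "h holomorphic_on ball 0 r"
  shows "taylor g i = taylor h i"
  by (rule taylor_unique[OF assms(1)]) (use taylor_sums[OF assms(3)] assms(2) in auto)

text \<open>Taking Taylor coefficients at 0 of the equation in each order of the perturbation
  parameter turns moment derivatives into shifts.\<close>

lemma formal_solution_borel:
  assumes s: "s > 0" and \<kappa>: "\<kappa> \<ge> 1" and r: "r > 0"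
    and x: "x \<in> E_series \<kappa> r" and f: "f \<in> E_series \<kappa> r" and sol: "formal_solution \<kappa> s r P x f"
  shows "(\<Sum>j\<le>min N (degree P). shift_op \<kappa> (coeff P j) (borel_coeff (s / real \<kappa>) (x (N - j))) k) =
    borel_coeff (s / real \<kappa>) (f N) k"
proof -
  have R: "root \<kappa> r > 0" using r \<kappa> by simp
  have gx: "germ (x n)" for n using x R by (auto simp: E_series_def E_space_def germ_def)
  have fh: "f N holomorphic_on ball 0 (root \<kappa> r)" using f by (auto simp: E_series_def E_space_def)
  have "taylor (\<lambda>w. \<Sum>j\<le>min N (degree P). 1 * poly_moment_op \<kappa> s (coeff P j) (x (N - j)) w) k = taylor (f N) k"
    by (rule taylor_cong[OF R _ fh]) (use sol in \<open>auto simp: formal_solution_def\<close>)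
  then have "(\<Sum>j\<le>min N (degree P). taylor (poly_moment_op \<kappa> s (coeff P j) (x (N - j))) k) = taylor (f N) k"
    by (subst (asm) germ_sum(2)) (auto intro: poly_moment_op_germ(1)[OF s \<kappa> gx])
  then have "(\<Sum>j\<le>min N (degree P). borel_coeff (s / real \<kappa>) (poly_moment_op \<kappa> s (coeff P j) (x (N - j))) k) =
     borel_coeff (s / real \<kappa>) (f N) k"
    by (simp add: borel_coeff_def flip: sum_distrib_left)
  then show ?thesis unfolding poly_moment_op_germ(2)[OF s \<kappa> gx] .
qed

section \<open>Gevrey estimates\<close>

lemma norm_fact_quot_le: "norm (fact_quot n b) \<le> fact (b - 1) * 2 ^ n"
proof -
  have "fact_quot n b = fact (b - 1) * of_nat (n choose (b - 1))"
    using fact_quot_eq_choose[of n "b - 1"] by (cases b) (simp_all add: fact_quot_def)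
  then have "norm (fact_quot n b) = fact (b - 1) * real (n choose (b - 1))" by (simp add: norm_mult)
  also have "\<dots> \<le> fact (b - 1) * 2 ^ n"
  proof (rule mult_left_mono)
    have "real (n choose (b - 1)) \<le> real (2 ^ n)" by (rule of_nat_mono[OF binomial_le_pow2])
    then show "real (n choose (b - 1)) \<le> 2 ^ n" by simp
  qed simp
  finally show ?thesis .
qed

lemma fact_mult_fact_le: "n \<le> N \<Longrightarrow> fact n * fact (N - n) \<le> (fact N :: real)"
proof -
  assume n: "n \<le> N"
  have "fact n * fact (N - n) * 1 \<le> (fact n * fact (N - n)) * real (N choose n)"
    using n by (intro mult_left_mono) (simp_all add: Suc_leI)
  also have "\<dots> = fact N" using n by (simp add: binomial_fact)
  finally show ?thesis by simp
qed

text \<open>Rests on \<open>fact n * fact (N - n) \<le> fact N\<close>. Of the constant 4, one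
  factor 2 absorbs \<open>2 ^ n\<close> and the other the number \<open>N + 1\<close> of
  summands.\<close>

lemma gevrey_convolution:
  fixes \<tau> \<sigma> \<nu> :: real
  assumes AB: "A \<ge> 0" "B \<ge> 0" "A' \<ge> 0" "B' \<ge> 0" and \<tau>: "\<tau> \<le> \<nu>" and \<sigma>: "\<sigma> \<le> \<nu>" and \<nu>: "0 \<le> \<nu>"
  shows "(\<Sum>n\<le>N. F * 2 ^ n * (A * B ^ n * fact n powr \<tau> * (A' * B' ^ (N - n) * fact (N - n) powr \<sigma>))) \<le>
    \<bar>F\<bar> * A * A' * (4 * max 1 B * max 1 B') ^ N * fact N powr \<nu>"
proof -
  let ?B = "max 1 B" and ?B' = "max 1 B'"
  have t: "F * 2 ^ n * (A * B ^ n * fact n powr \<tau> * (A' * B' ^ (N - n) * fact (N - n) powr \<sigma>)) \<le>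
      \<bar>F\<bar> * A * A' * (2 * ?B * ?B') ^ N * fact N powr \<nu>" if n: "n \<le> N" for n
  proof -
    have b: "B ^ n \<le> ?B ^ N" "B' ^ (N - n) \<le> ?B' ^ N" "(2::real) ^ n \<le> 2 ^ N"
      using AB n by (auto intro!: order_trans[OF power_mono[of B ?B n] power_increasing[of n N ?B]]
          order_trans[OF power_mono[of B' ?B' "N - n"] power_increasing[of "N - n" N ?B']])
    have "(fact n :: real) powr \<tau> * fact (N - n) powr \<sigma> \<le> fact n powr \<nu> * fact (N - n) powr \<nu>"
      using \<tau> \<sigma> by (intro mult_mono powr_mono) auto
    also have "\<dots> = (fact n * fact (N - n)) powr \<nu>" by (simp add: powr_mult)
    also have "\<dots> \<le> fact N powr \<nu>" using \<nu> fact_mult_fact_le[OF n] by (intro powr_mono2) auto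
    finally have f: "(fact n :: real) powr \<tau> * fact (N - n) powr \<sigma> \<le> fact N powr \<nu>" .
    have "F * 2 ^ n * (A * B ^ n * fact n powr \<tau> * (A' * B' ^ (N - n) * fact (N - n) powr \<sigma>)) =
      F * A * A' * (2 ^ n * (B ^ n * (B' ^ (N - n) * (fact n powr \<tau> * fact (N - n) powr \<sigma>))))"
      by (simp add: mult_ac)
    also have "\<dots> \<le> \<bar>F\<bar> * A * A' * (2 ^ N * (?B ^ N * (?B' ^ N * fact N powr \<nu>)))"
      using AB b f by (intro mult_mono mult_nonneg_nonneg) auto
    also have "\<dots> = \<bar>F\<bar> * A * A' * (2 * ?B * ?B') ^ N * fact N powr \<nu>" by (simp add: power_mult_distrib mult_ac)
    finally show ?thesis .
  qed
  let ?Q = "\<bar>F\<bar> * A * A' * (2 * ?B * ?B') ^ N * fact N powr \<nu>"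
  have Q: "?Q \<ge> 0" using AB by auto
  have "(\<Sum>n\<le>N. F * 2 ^ n * (A * B ^ n * fact n powr \<tau> * (A' * B' ^ (N - n) * fact (N - n) powr \<sigma>))) \<le> (\<Sum>n\<le>N. ?Q)"
    by (rule sum_mono) (use t in simp)
  also have "\<dots> = real (N + 1) * ?Q" by simp
  also have "\<dots> \<le> 2 ^ N * ?Q"
  proof (rule mult_right_mono[OF _ Q])
    have "N + 1 \<le> 2 ^ N" using less_exp[of N] by (simp add: Suc_le_eq del: less_exp)
    then have "real (N + 1) \<le> real (2 ^ N)" by (rule of_nat_mono)
    then show "real (N + 1) \<le> 2 ^ N" by simp
  qed
  also have "2 ^ N * ?Q = \<bar>F\<bar> * A * A' * (2 ^ N * (2 * ?B * ?B') ^ N) * fact N powr \<nu>" by (simp only: mult_ac)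
  also have "2 ^ N * (2 * ?B * ?B') ^ N = (2 * (2 * ?B * ?B')) ^ N" by (rule power_mult_distrib[symmetric])
  also have "2 * (2 * ?B * ?B') = 4 * ?B * ?B'" by simp
  finally show ?thesis .
qed

context
  fixes s \<rho> d r T :: real
  assumes s: "s > 0" and d: "0 < d" "d < r" and T: "0 < T" "T < \<rho>"
begin

text \<open>The finite partial sums are polynomials in \<open>z\<close>, and the terms at the real
  point \<open>z1\<close> majorise those on the whole disc, so the Weierstrass test gives uniform
  convergence.\<close>

lemma psdo_holomorphic:
  assumes L: "inf_rep T N h L" and \<phi>: "\<phi> holomorphic_on ball 0 r" and z1: "z1 \<ge> 0" "4 powr s * z1 < d"
  shows "continuous_on (cball 0 z1) (psdo s \<rho> d t0 L \<phi>)" "psdo s \<rho> d t0 L \<phi> holomorphic_on ball 0 z1"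
proof -
  let ?t = "psdo_term s \<rho> d (taylor \<phi>) (taylor h) N t0"
  have \<rho>: "\<rho> > 0" using T by simp
  have small: "4 powr s * norm z < d" if "z \<in> cball 0 z1" for z :: complex
  proof -
    have "4 powr s * norm z \<le> 4 powr s * z1" using that by (intro mult_left_mono) auto
    then show ?thesis using z1 by linarith
  qed
  have le: "norm (?t z p) \<le> norm (?t (of_real z1) p)" if "z \<in> cball 0 z1" for z p
  proof -
    have "norm z ^ m \<le> z1 ^ m" for m using that z1 by (intro power_mono) auto
    then show ?thesis using z1
      by (auto simp: psdo_term_def[OF s \<rho> d(1)] case_prod_unfold norm_mult norm_divide norm_power
          intro!: mult_right_mono mult_left_mono divide_right_mono)
  qed
  have U: "uniform_limit (cball 0 z1) (\<lambda>X z. \<Sum>p\<in>X. ?t z p) (psdo s \<rho> d t0 L \<phi>) (finite_subsets_at_top UNIV)"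
  proof (rule Weierstrass_m_test_general')
    show "norm (?t z p) \<le> norm (?t (of_real z1) p)" if "z \<in> cball 0 z1" for z p using le that by blast
    show "((\<lambda>p. ?t z p) has_sum psdo s \<rho> d t0 L \<phi> z) UNIV" if "z \<in> cball 0 z1" for z
      by (rule psdo_has_sum(1)[OF s d T L \<phi> small[OF that]])
    show "(\<lambda>p. norm (?t (of_real z1) p)) summable_on UNIV"
      by (rule psdo_has_sum(2)[OF s d T L \<phi> small]) (use z1 in simp)
  qed
  have hol: "(\<lambda>z. \<Sum>p\<in>X. ?t z p) holomorphic_on A" for X A
    unfolding psdo_term_def[OF s \<rho> d(1)] case_prod_unfold by (intro holomorphic_intros) (auto simp: Gamma_pos[OF s \<rho> d(1), THEN less_imp_neq, symmetric])
  then have "eventually (\<lambda>X. continuous_on (cball 0 z1) (\<lambda>z. \<Sum>p\<in>X. ?t z p) \<and> (\<lambda>z. \<Sum>p\<in>X. ?t z p) holomorphic_on ball 0 z1)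
      (finite_subsets_at_top UNIV)"
    by (intro always_eventually allI conjI holomorphic_on_imp_continuous_on)
  from holomorphic_uniform_limit[OF this U]
  show "continuous_on (cball 0 z1) (psdo s \<rho> d t0 L \<phi>)" "psdo s \<rho> d t0 L \<phi> holomorphic_on ball 0 z1" by auto
qed

text \<open>The exponent of the symbol \<open>C * L ^ n\<close> has the form
  \<open>M + n * K\<close>. Only the slope \<open>K\<close> affects the Gevrey order;
  \<open>M\<close> goes into the constants.\<close>

lemma Gamma_power_exponent_le:
  "\<exists>A\<ge>0. \<exists>B\<ge>0. \<forall>n. Gamma (1 + real (M + n * K) * s) \<le> A * B ^ n * fact n powr (real K * s)"
proof -
  define b where "b = 4 powr (real K * s) * max 1 ((2 * (real K * s)) powr (real K * s))"
  define a where "a = 2 * (4 powr (real M * s) * Gamma (1 + real M * s)) * 2"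
  have "Gamma (1 + real (M + n * K) * s) \<le> a * b ^ n * fact n powr (real K * s)" for n
  proof -
    have e: "real (M + n * K) * s = real M * s + real K * s * real n" by (simp add: algebra_simps)
    have "Gamma (1 + real (M + n * K) * s) \<le> 2 * (4 powr (real M * s + real K * s * real n) * Gamma (1 + real M * s) * Gamma (1 + real K * s * real n))"
      unfolding e using s by (intro Gamma_1_add_le) auto
    also have "\<dots> \<le> 2 * (4 powr (real M * s + real K * s * real n) * Gamma (1 + real M * s) *
        (2 * max 1 ((2 * (real K * s)) powr (real K * s)) ^ n * fact n powr (real K * s)))"
      using s Gamma_1_plus_pos[of "real M * s"] by (intro mult_left_mono Gamma_1_le_fact_powr) auto
    also have "4 powr (real M * s + real K * s * real n) = 4 powr (real M * s) * (4 powr (real K * s)) ^ n"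
      by (simp add: powr_add powr_powr[symmetric] powr_realpow)
    finally show ?thesis by (simp add: a_def b_def power_mult_distrib mult_ac)
  qed
  moreover have "a \<ge> 0" using s Gamma_1_plus_pos[of "real M * s"] by (simp add: a_def)
  moreover have "b \<ge> 0" by (simp add: b_def)
  ultimately show ?thesis by blast
qed

text \<open>The constants must serve all \<open>n\<close> and all functions at once. The index
  \<open>n\<close> enters through the bound \<open>Bl ^ n\<close> for the expansion at infinity and
  through the exponent \<open>Nc + n * Nl\<close>, whose Gamma value produces the factorial.\<close>

lemma psdo_gevrey_bound:
  assumes C: "inf_rep T Nc hc C" and L: "inf_rep T Nl hl L" and z1: "z1 \<ge> 0" "4 powr s * z1 < d"
  shows "\<exists>A\<ge>0. \<exists>B\<ge>0. \<forall>n \<phi> M z. \<phi> holomorphic_on ball 0 r \<longrightarrow> continuous_on (cball 0 r) \<phi> \<longrightarrow>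
    (\<forall>w\<in>cball 0 r. norm (\<phi> w) \<le> M) \<longrightarrow> norm z \<le> z1 \<longrightarrow>
    norm (psdo s \<rho> d t0 (\<lambda>\<omega>. C \<omega> * L \<omega> ^ n) \<phi> z) \<le> A * B ^ n * fact n powr (real Nl * s) * M"
proof -
  have \<rho>: "\<rho> > 0" using T by simp
  define \<rho>' where "\<rho>' = (T + \<rho>) / 2"
  have r: "T < \<rho>'" "\<rho>' < \<rho>" "\<rho>' > 0" using T by (auto simp: \<rho>'_def)
  have sub: "cball (0::complex) (1 / \<rho>') \<subseteq> ball 0 (1 / T)" using frac_less2[of 1 1 T \<rho>'] T r by auto
  have "continuous_on (cball 0 (1 / \<rho>')) hc" "continuous_on (cball 0 (1 / \<rho>')) hl"
    using inf_repD(1)[OF C] inf_repD(1)[OF L] sub by (auto intro: holomorphic_on_imp_continuous_on holomorphic_on_subset)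
  then obtain Bc Bl where Bc: "\<And>v. norm v \<le> 1 / \<rho>' \<Longrightarrow> norm (hc v) \<le> Bc" and Bl: "\<And>v. norm v \<le> 1 / \<rho>' \<Longrightarrow> norm (hl v) \<le> Bl"
    using cball_bound by metis
  have B0: "Bc \<ge> 0" "Bl \<ge> 0" using Bc[of 0] Bl[of 0] r norm_ge_zero order_trans by (auto intro: order_trans[OF norm_ge_zero])
  define K where "K = d * (1 + 2 * \<rho> * (1 + s) * kernel_bound s (d * \<rho>))"
  have K: "K \<ge> 0" using s \<rho> d by (simp add: K_def kernel_bound_def)
  define e where "e = 1 / (1 - \<rho>' / \<rho>)"
  have e: "e \<ge> 0" using r \<rho> by (simp add: e_def)
  define y where "y = 1 / (1 - d / r)"
  have y: "y \<ge> 0" using d by (simp add: y_def)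
  define g where "g = 1 / (1 - 4 powr s * z1 / d)"
  have g: "g \<ge> 0" using z1 d by (simp add: g_def)
  define M0 where "M0 = (\<Sum>m. (\<rho> * z1) ^ m / Gamma (1 + real m * s))"
  have M0: "M0 \<ge> 0" unfolding M0_def using summable_power_div_Gamma[OF s, of "\<rho> * z1"] \<rho> z1 Gamma_pos[OF s \<rho> d(1)]
    by (intro suminf_nonneg) (auto simp: less_imp_le)
  obtain a b where ab: "a \<ge> 0" "b \<ge> 0" and Gab: "\<And>n. Gamma (1 + real (Nc + n * Nl) * s) \<le> a * b ^ n * fact n powr (real Nl * s)"
    using Gamma_power_exponent_le[of Nc Nl] by blast
  define q where "q = 4 powr s / d"
  have q: "q \<ge> 0" using d by (simp add: q_def)
  define A where "A = K * y * (Bc * e) * (\<rho> ^ Nc * M0 + 2 * a * q ^ Nc / d * g)"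
  \<comment> \<open>\<open>Bl\<close> comes from the expansion of the symbol; the two summands
    dominate the \<open>n\<close>-dependent factors of the two parts of
    \<open>suminf_shift_factor_le\<close>.\<close>
  define B where "B = Bl * (\<rho> ^ Nl + b * q ^ Nl)"
  have "A \<ge> 0" "B \<ge> 0" unfolding A_def B_def using K y B0 e \<rho> M0 ab q d g by auto
  moreover have "norm (psdo s \<rho> d t0 (\<lambda>\<omega>. C \<omega> * L \<omega> ^ n) \<phi> z) \<le> A * B ^ n * fact n powr (real Nl * s) * M"
    if \<phi>: "\<phi> holomorphic_on ball 0 r" "continuous_on (cball 0 r) \<phi>" and M: "\<forall>w\<in>cball 0 r. norm (\<phi> w) \<le> M" and z: "norm z \<le> z1" for n \<phi> M z
  proof -
    define N where "N = Nc + n * Nl"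
    define h where "h v = hc v * hl v ^ n" for v
    have rep: "inf_rep T N h (\<lambda>\<omega>. C \<omega> * L \<omega> ^ n)"
      unfolding N_def h_def by (rule inf_rep_mult[OF C inf_rep_power[OF L]])
    have hB: "norm (h v) \<le> Bc * Bl ^ n" if "norm v \<le> 1 / \<rho>'" for v
      unfolding h_def norm_mult norm_power using Bc[OF that] Bl[OF that] B0 by (intro mult_mono power_mono) auto
    have "4 powr s * norm z \<le> 4 powr s * z1" using z by (intro mult_left_mono) auto
    then have zs: "4 powr s * norm z < d" using z1 by linarith
    have M': "\<And>v. norm v \<le> r \<Longrightarrow> norm (\<phi> v) \<le> M" using M by auto
    have Mp: "M \<ge> 0" using M'[of 0] d order_trans[OF norm_ge_zero] by fastforce
    have 1: "(\<Sum>i. norm (taylor \<phi> i) * d ^ i) \<le> M * y"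
      unfolding y_def by (rule taylor_abs_summable(2)[OF \<phi> M']) (use d in auto)
    have 2: "(\<Sum>i. norm (taylor h i) * inverse \<rho> ^ i) \<le> Bc * Bl ^ n * e"
      unfolding e_def by (rule inf_rep_expansion(2)[OF rep T(1) r(1,2) hB])
    have F: "(1::real) \<le> fact n powr (real Nl * s)"
      using s by (intro ge_one_powr_ge_zero) (auto simp: fact_ge_1)
    have 3: "suminf (shift_factor s \<rho> d N (norm z)) \<le> (\<rho> ^ Nc * M0 + 2 * a * q ^ Nc / d * g) * ((\<rho> ^ Nl + b * q ^ Nl) ^ n * fact n powr (real Nl * s))"
    proof -
      have "suminf (shift_factor s \<rho> d N (norm z)) \<le> suminf (shift_factor s \<rho> d N z1)"
      proof (rule suminf_le)
        show "shift_factor s \<rho> d N (norm z) m \<le> shift_factor s \<rho> d N z1 m" for m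
          unfolding shift_factor_def[OF s \<rho> d(1)] using z z1 Gamma_pos[OF s \<rho> d(1), of m] Gamma_pos[OF s \<rho> d(1), of "N + m"] \<rho> d
          by (intro mult_right_mono divide_right_mono power_mono) (auto intro!: add_nonneg_nonneg simp: less_imp_le)
      qed (use zs z1 in \<open>auto intro!: summable_shift_factor[OF s \<rho> d(1)]\<close>)
      also have "\<dots> \<le> \<rho> ^ N * M0 + 2 * Gamma (1 + real N * s) * q ^ N / d * g"
        unfolding M0_def q_def g_def by (rule suminf_shift_factor_le[OF s \<rho> d(1) z1])
      also have "\<dots> \<le> \<rho> ^ Nc * M0 * ((\<rho> ^ Nl + b * q ^ Nl) ^ n * fact n powr (real Nl * s)) +
          2 * a * q ^ Nc / d * g * ((\<rho> ^ Nl + b * q ^ Nl) ^ n * fact n powr (real Nl * s))"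
      proof (rule add_mono)
        have "(\<rho> ^ Nl) ^ n * 1 \<le> (\<rho> ^ Nl + b * q ^ Nl) ^ n * fact n powr (real Nl * s)"
          using \<rho> ab q F by (intro mult_mono power_mono) auto
        then have "\<rho> ^ Nc * M0 * ((\<rho> ^ Nl) ^ n * 1) \<le> \<rho> ^ Nc * M0 * ((\<rho> ^ Nl + b * q ^ Nl) ^ n * fact n powr (real Nl * s))"
          using \<rho> M0 by (intro mult_left_mono) auto
        moreover have "\<rho> ^ N = \<rho> ^ Nc * (\<rho> ^ Nl) ^ n" by (simp add: N_def power_add power_mult[symmetric] mult.commute)
        ultimately show "\<rho> ^ N * M0 \<le> \<rho> ^ Nc * M0 * ((\<rho> ^ Nl + b * q ^ Nl) ^ n * fact n powr (real Nl * s))"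
          by (simp add: mult_ac)
        have "(b * q ^ Nl) ^ n * fact n powr (real Nl * s) \<le> (\<rho> ^ Nl + b * q ^ Nl) ^ n * fact n powr (real Nl * s)"
          using \<rho> ab q by (intro mult_right_mono power_mono) auto
        then have u: "2 * a * q ^ Nc / d * g * ((b * q ^ Nl) ^ n * fact n powr (real Nl * s)) \<le>
           2 * a * q ^ Nc / d * g * ((\<rho> ^ Nl + b * q ^ Nl) ^ n * fact n powr (real Nl * s))"
          using ab q d g by (intro mult_left_mono) auto
        have qN: "q ^ N = q ^ Nc * (q ^ Nl) ^ n" by (simp add: N_def power_add power_mult[symmetric] mult.commute)
        have "Gamma (1 + real N * s) * (2 * q ^ N / d * g) \<le> a * b ^ n * fact n powr (real Nl * s) * (2 * q ^ N / d * g)"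
          using Gab[of n] q d g unfolding N_def by (intro mult_right_mono) auto
        also have "\<dots> = 2 * a * q ^ Nc / d * g * ((b * q ^ Nl) ^ n * fact n powr (real Nl * s))"
          unfolding qN by (simp add: power_mult_distrib mult_ac)
        finally show "2 * Gamma (1 + real N * s) * q ^ N / d * g \<le>
           2 * a * q ^ Nc / d * g * ((\<rho> ^ Nl + b * q ^ Nl) ^ n * fact n powr (real Nl * s))"
          using u by (simp add: mult_ac)
      qed
      finally show ?thesis by (simp add: distrib_right)
    qed
    have sf0: "0 \<le> suminf (shift_factor s \<rho> d N (norm z))"
      using shift_factor_nonneg[OF s \<rho> d(1)] by (intro suminf_nonneg summable_shift_factor[OF s \<rho> d(1)]) (use zs in auto)
    have h0: "0 \<le> (\<Sum>i. norm (taylor h i) * inverse \<rho> ^ i)"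
      using \<rho> by (intro suminf_nonneg inf_rep_series(1)[OF s d T rep]) auto
    have "norm (psdo s \<rho> d t0 (\<lambda>\<omega>. C \<omega> * L \<omega> ^ n) \<phi> z) \<le>
        K * ((\<Sum>i. norm (taylor \<phi> i) * d ^ i) * (suminf (shift_factor s \<rho> d N (norm z)) * (\<Sum>i. norm (taylor h i) * inverse \<rho> ^ i)))"
      unfolding K_def
      by (rule psdo_series(3)[OF s \<rho> d(1) inf_rep_series[OF s d T rep] ball_series[OF s d T \<phi>(1)] zs])
    also have "\<dots> \<le> K * ((M * y) * (((\<rho> ^ Nc * M0 + 2 * a * q ^ Nc / d * g) * ((\<rho> ^ Nl + b * q ^ Nl) ^ n * fact n powr (real Nl * s))) * (Bc * Bl ^ n * e)))"
      using K 1 2 3 sf0 h0 Mp y B0 e order_trans[OF sf0 3] by (intro mult_left_mono mult_mono mult_nonneg_nonneg[of M y]) auto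
    also have "\<dots> = A * B ^ n * fact n powr (real Nl * s) * M"
      unfolding A_def B_def by (simp add: power_mult_distrib mult_ac)
    finally show ?thesis .
  qed
  ultimately show ?thesis by blast
qed

end

section \<open>The resolvent\<close>

text \<open>The inverse of \<open>P\<close> as a power series in \<open>\<xi>\<close> over the ring
  of polynomials in \<open>\<zeta>\<close>. That ring is not a field, so the inverse of the constant
  term is supplied explicitly.\<close>

definition resolvent_poly :: "complex poly poly \<Rightarrow> complex \<Rightarrow> nat \<Rightarrow> complex poly" where
  "resolvent_poly P P0 n = fps_nth (fps_right_inverse (Abs_fps (coeff P)) [:1 / P0:]) n"

lemma resolvent_poly_0: "resolvent_poly P P0 0 = [:1 / P0:]"
  by (simp add: resolvent_poly_def)

context
  fixes P :: "complex poly poly" and P0 :: complex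
  assumes P0: "P0 \<noteq> 0" "coeff P 0 = [:P0:]"
begin

lemma resolvent_poly_conv:
  "(\<Sum>i\<le>n. coeff P i * resolvent_poly P P0 (n - i)) = (if n = 0 then 1 else 0)"
proof -
  have "Abs_fps (coeff P) * fps_right_inverse (Abs_fps (coeff P)) [:1 / P0:] = 1"
    by (rule fps_right_inverse) (use P0 in \<open>simp add: one_pCons\<close>)
  from arg_cong[OF this, of "\<lambda>f. fps_nth f n"]
  show ?thesis by (simp add: fps_mult_nth resolvent_poly_def atLeast0AtMost)
qed

lemma difference_solution_resolvent:
  "difference_solution P P0 (\<lambda>n. if n < 0 then 0 else resolvent_poly P P0 (nat n))"
  unfolding difference_solution_def
proof (intro conjI ballI allI impI)
  fix n :: int assume n: "n \<ge> 1"
  let ?Q = "\<lambda>n. if n < 0 then 0 else resolvent_poly P P0 (nat n)"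
  have "(\<Sum>j\<le>degree P. coeff P j * ?Q (n - int j)) = (\<Sum>j\<le>min (nat n) (degree P). coeff P j * resolvent_poly P P0 (nat n - j))"
  proof (rule sum.mono_neutral_cong_right)
    fix j assume "j \<in> {..min (nat n) (degree P)}"
    then have "\<not> n - int j < 0" "nat (n - int j) = nat n - j" using n by auto
    then show "coeff P j * ?Q (n - int j) = coeff P j * resolvent_poly P P0 (nat n - j)" by simp
  qed auto
  also have "\<dots> = (\<Sum>j\<le>nat n. coeff P j * resolvent_poly P P0 (nat n - j))"
  proof (rule sum.mono_neutral_left)
    show "\<forall>i\<in>{..nat n} - {..min (nat n) (degree P)}. coeff P i * resolvent_poly P P0 (nat n - i) = 0"
    proof
      fix i assume "i \<in> {..nat n} - {..min (nat n) (degree P)}"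
      then have "degree P < i" by auto
      then show "coeff P i * resolvent_poly P P0 (nat n - i) = 0" by (simp add: coeff_eq_0)
    qed
  qed auto
  also have "\<dots> = 0" using n by (simp add: resolvent_poly_conv)
  finally show "(\<Sum>j\<le>degree P. coeff P j * ?Q (n - int j)) = 0" .
qed (auto simp: resolvent_poly_0)

text \<open>The term with \<open>j = 0\<close> carries the nonzero constant \<open>P0\<close>, so
  the recursion determines each value from earlier ones. The indices considered are those reached by
  the recursion and the initial conditions.\<close>

lemma difference_solution_unique:
  assumes Q: "difference_solution P P0 Q" and Q': "difference_solution P P0 Q'"
    and n: "n \<ge> 1 - int (degree P)"
  shows "Q' n = Q n"
proof -
  have nat: "Q' (int k) = Q (int k)" for k
  proof (induction k rule: less_induct)
    case (less k)
    show ?case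
    proof (cases "k = 0")
      case True
      then show ?thesis using Q Q' by (simp add: difference_solution_def)
    next
      case False
      have step: "[:P0:] * R (int k) = - (\<Sum>j=1..degree P. coeff P j * R (int k - int j))" if "difference_solution P P0 R" for R
      proof -
        have "(\<Sum>j\<le>degree P. coeff P j * R (int k - int j)) = 0"
          using that False by (auto simp: difference_solution_def)
        moreover have "(\<Sum>j\<le>degree P. coeff P j * R (int k - int j)) = [:P0:] * R (int k) + (\<Sum>j=1..degree P. coeff P j * R (int k - int j))"
          using P0 by (simp add: atMost_atLeast0 sum.atLeast_Suc_atMost)
        ultimately show ?thesis by (simp add: eq_neg_iff_add_eq_0)
      qed
      have "Q' (int k - int j) = Q (int k - int j)" if "j \<in> {1..degree P}" for j
      proof (cases "j \<le> k")
        case True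
        then show ?thesis using less[of "k - j"] that by (simp add: of_nat_diff)
      next
        case False
        then have "int k - int j \<in> {1 - int (degree P)..-1}" using that \<open>k \<noteq> 0\<close> by auto
        then show ?thesis using Q Q' by (simp add: difference_solution_def)
      qed
      then have "[:P0:] * Q' (int k) = [:P0:] * Q (int k)" unfolding step[OF Q] step[OF Q'] by simp
      then show ?thesis using P0 mult_left_cancel[of "[:P0:]"] by (metis pCons_eq_0_iff)
    qed
  qed
  show ?thesis
  proof (cases "n < 0")
    case True
    then have "n \<in> {1 - int (degree P)..-1}" using n by auto
    then show ?thesis using Q Q' by (simp add: difference_solution_def)
  next
    case False
    then show ?thesis using nat[of "nat n"] by simp
  qed
qed

text \<open>At a fixed \<open>z\<close> both sides are coefficients of an inverse of the same power
  series in \<open>\<xi>\<close>, and inverses are unique.\<close>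

lemma poly_resolvent:
  fixes \<Lambda> :: "nat \<Rightarrow> complex"
  assumes S: "finite S" and fac: "\<And>\<xi>. eval2 P \<xi> z = P0 * (\<Prod>\<alpha>\<in>S. (1 - \<xi> * \<Lambda> \<alpha>) ^ m \<alpha>)"
  shows "poly (resolvent_poly P P0 n) z = 1 / P0 * fps_nth (\<Prod>\<alpha>\<in>S. geom_fps (\<Lambda> \<alpha>) ^ m \<alpha>) n"
proof -
  define p where "p = map_poly (\<lambda>q. poly q z) P"
  define f where "f = fps_of_poly p"
  define A where "A = Abs_fps (\<lambda>n. poly (resolvent_poly P P0 n) z)"
  have "poly p = poly ([:P0:] * (\<Prod>\<alpha>\<in>S. [:1, - \<Lambda> \<alpha>:] ^ m \<alpha>))"
    using fac by (simp add: fun_eq_iff p_def eval2_map_poly poly_prod poly_power)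
  then have "p = [:P0:] * (\<Prod>\<alpha>\<in>S. [:1, - \<Lambda> \<alpha>:] ^ m \<alpha>)"
    by (rule poly_eq_poly_eq_iff[THEN iffD1])
  then have f: "f = fps_const P0 * (\<Prod>\<alpha>\<in>S. (1 - fps_const (\<Lambda> \<alpha>) * fps_X) ^ m \<alpha>)"
    unfolding f_def by (simp add: fps_of_poly_smult fps_of_poly_mult fps_of_poly_prod fps_of_poly_power fps_of_poly_pCons mult.commute flip: fps_const_neg)
  have fA: "f * A = 1"
  proof (rule fps_ext)
    fix n
    have "fps_nth (f * A) n = poly (\<Sum>i\<le>n. coeff P i * resolvent_poly P P0 (n - i)) z"
      by (simp add: fps_mult_nth f_def A_def p_def coeff_map_poly poly_sum atLeast0AtMost)
    then show "fps_nth (f * A) n = fps_nth 1 n" unfolding resolvent_poly_conv by simp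
  qed
  have fG: "f * (fps_const (1 / P0) * (\<Prod>\<alpha>\<in>S. geom_fps (\<Lambda> \<alpha>) ^ m \<alpha>)) = 1"
  proof -
    have "f * (fps_const (1 / P0) * (\<Prod>\<alpha>\<in>S. geom_fps (\<Lambda> \<alpha>) ^ m \<alpha>)) =
        (fps_const P0 * fps_const (1 / P0)) * (\<Prod>\<alpha>\<in>S. (geom_fps (\<Lambda> \<alpha>) * (1 - fps_const (\<Lambda> \<alpha>) * fps_X)) ^ m \<alpha>)"
      unfolding f power_mult_distrib prod.distrib by (simp only: mult_ac)
    then show ?thesis using P0 by (simp add: geom_fps_mult)
  qed
  have "A = A * (f * (fps_const (1 / P0) * (\<Prod>\<alpha>\<in>S. geom_fps (\<Lambda> \<alpha>) ^ m \<alpha>)))" unfolding fG by simp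
  also have "\<dots> = (f * A) * (fps_const (1 / P0) * (\<Prod>\<alpha>\<in>S. geom_fps (\<Lambda> \<alpha>) ^ m \<alpha>))" by (simp only: mult_ac)
  finally have "A = fps_const (1 / P0) * (\<Prod>\<alpha>\<in>S. geom_fps (\<Lambda> \<alpha>) ^ m \<alpha>)" unfolding fA by simp
  from arg_cong[OF this, of "\<lambda>f. fps_nth f n"] show ?thesis by (simp add: A_def)
qed

end

lemma root_branch:
  assumes "\<kappa> \<ge> 1" "\<zeta> \<noteq> 0"
  shows "(\<zeta> powr (1 / of_nat \<kappa>)) ^ \<kappa> = (\<zeta> :: complex)" "norm (\<zeta> powr (1 / of_nat \<kappa>)) = root \<kappa> (norm \<zeta>)"
proof -
  show *: "(\<zeta> powr (1 / of_nat \<kappa>)) ^ \<kappa> = \<zeta>"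
    using assms by (simp add: powr_def exp_of_nat_mult[symmetric])
  have "norm (\<zeta> powr (1 / of_nat \<kappa>)) = root \<kappa> (norm (\<zeta> powr (1 / of_nat \<kappa>)) ^ \<kappa>)"
    using assms by (simp add: real_root_power_cancel)
  then show "norm (\<zeta> powr (1 / of_nat \<kappa>)) = root \<kappa> (norm \<zeta>)"
    using * by (simp flip: norm_power)
qed

lemma power_less_iff_root:
  assumes "\<kappa> \<ge> 1" "T \<ge> 0" "x \<ge> 0"
  shows "T ^ \<kappa> < x ^ \<kappa> \<longleftrightarrow> T < (x :: real)"
  using assms by (auto intro: power_less_imp_less_base power_strict_mono)

lemma eval2_holomorphic:
  assumes "u holomorphic_on A" "v holomorphic_on A"
  shows "(\<lambda>\<omega>. eval2 Q (u \<omega>) (v \<omega>)) holomorphic_on A"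
  unfolding eval2_altdef poly_altdef by (intro holomorphic_intros assms)

lemma E_spaceD:
  assumes "\<phi> \<in> E_space \<kappa> r"
  shows "\<phi> holomorphic_on ball 0 (root \<kappa> r)" "continuous_on (cball 0 (root \<kappa> r)) \<phi>"
  using assms by (auto simp: E_space_def)

lemma norm_le_E_norm:
  assumes "\<phi> \<in> E_space \<kappa> r" "w \<in> cball 0 (root \<kappa> r)"
  shows "norm (\<phi> w) \<le> E_norm \<kappa> r \<phi>"
  unfolding E_norm_def
proof (rule cSUP_upper[OF assms(2)])
  obtain B where "\<forall>v. norm v \<le> root \<kappa> r \<longrightarrow> norm (\<phi> v) \<le> B" using cball_bound[OF E_spaceD(2)[OF assms(1)]] by blast
  then show "bdd_above ((\<lambda>w. norm (\<phi> w)) ` cball 0 (root \<kappa> r))" by (intro bdd_aboveI2[of _ _ B]) auto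
qed

text \<open>The branches of the roots separate outside a disc; there the coefficients of the partial
  fraction decomposition of $1/P$ are polynomials in the branches and in the reciprocals of
  their differences.\<close>

lemma resolvent_coefficients:
  fixes P :: "complex poly poly" and \<Lambda> :: "nat \<Rightarrow> complex \<Rightarrow> complex"
  assumes P0: "P0 \<noteq> 0" "coeff P 0 = [:P0:]" and p: "degree P \<ge> 1" and T: "T > 0" and \<kappa>: "\<kappa> \<ge> 1" and S: "finite S"
    and rep: "\<And>\<alpha>. \<alpha> \<in> S \<Longrightarrow> \<exists>N h. inf_rep T N h (\<Lambda> \<alpha>)"
    and fac: "\<And>\<xi> \<omega>. T < norm \<omega> \<Longrightarrow> eval2 P \<xi> (\<omega> ^ \<kappa>) = P0 * (\<Prod>\<alpha>\<in>S. (1 - \<xi> * \<Lambda> \<alpha> \<omega>) ^ m \<alpha>)"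
    and roots: "\<And>\<alpha> \<omega>. \<alpha> \<in> S \<Longrightarrow> T < norm \<omega> \<Longrightarrow> eval2 (reflect_poly P) (\<Lambda> \<alpha> \<omega>) (\<omega> ^ \<kappa>) = 0"
    and ne: "\<And>\<alpha> \<gamma>. \<alpha> \<in> S \<Longrightarrow> \<gamma> \<in> S \<Longrightarrow> \<alpha> \<noteq> \<gamma> \<Longrightarrow> \<exists>\<omega>. T < norm \<omega> \<and> \<Lambda> \<alpha> \<omega> \<noteq> \<Lambda> \<gamma> \<omega>"
  shows "\<exists>T1\<ge>T. \<exists>C. (\<forall>\<alpha>\<in>S. \<forall>\<beta>\<in>{1..m \<alpha>}. (\<exists>N h. inf_rep T1 N h (C \<alpha> \<beta>)) \<and> alg_on {\<omega>. T1 < norm \<omega>} (\<lambda>\<omega>. \<omega> ^ \<kappa>) (C \<alpha> \<beta>)) \<and>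
    (\<forall>n \<omega>. T1 < norm \<omega> \<longrightarrow> poly (resolvent_poly P P0 n) (\<omega> ^ \<kappa>) =
      (\<Sum>\<alpha>\<in>S. \<Sum>\<beta>=1..m \<alpha>. C \<alpha> \<beta> \<omega> * fact_quot n \<beta> * \<Lambda> \<alpha> \<omega> ^ n))"
proof -
  \<comment> \<open>The difference is written with \<open>+ (-1) *\<close> so that closure under
    sums and products applies to it.\<close>
  define D where "D a \<omega> = \<Lambda> (fst a) \<omega> + (-1) * \<Lambda> (snd a) \<omega>" for a \<omega>
  define J where "J = {a \<in> S \<times> S. fst a \<noteq> snd a}"
  have J: "finite J" using S by (simp add: J_def)
  have "\<exists>T'\<ge>T. \<exists>n g. (\<forall>\<omega>. T' < norm \<omega> \<longrightarrow> D a \<omega> \<noteq> 0) \<and> inf_rep T' n g (\<lambda>\<omega>. 1 / D a \<omega>)" if a: "a \<in> J" for a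
  proof -
    have mem: "fst a \<in> S" "snd a \<in> S" using a by (auto simp: J_def)
    obtain N h where "inf_rep T N h (\<Lambda> (fst a))" using rep[OF mem(1)] by blast
    moreover obtain N' h' where "inf_rep T N' h' (\<Lambda> (snd a))" using rep[OF mem(2)] by blast
    moreover have "\<exists>M g. inf_rep T M g (D a)"
      unfolding D_def[abs_def] using calculation by (intro inf_rep_add[OF _ inf_rep_mult[OF inf_rep_const] T])
    then obtain M g where "inf_rep T M g (D a)" by blast
    moreover obtain \<omega> where "T < norm \<omega>" "D a \<omega> \<noteq> 0" using ne[of "fst a" "snd a"] a by (auto simp: J_def D_def)
    ultimately show ?thesis using inf_rep_inverse T by blast
  qed
  then obtain T' where T': "\<And>a. a \<in> J \<Longrightarrow> T \<le> T' a" "\<And>a \<omega>. a \<in> J \<Longrightarrow> T' a < norm \<omega> \<Longrightarrow> D a \<omega> \<noteq> 0"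
    "\<And>a. a \<in> J \<Longrightarrow> \<exists>n g. inf_rep (T' a) n g (\<lambda>\<omega>. 1 / D a \<omega>)" by metis
  \<comment> \<open>Beyond the largest of these finitely many radii the branches are pairwise
    different at every point.\<close>
  define T1 where "T1 = Max (insert T (T' ` J))"
  have T1: "T \<le> T1" "\<And>a. a \<in> J \<Longrightarrow> T' a \<le> T1" using J by (auto simp: T1_def)
  define \<Omega> where "\<Omega> = {\<omega> :: complex. T1 < norm \<omega>}"
  define K where "K = {u. (\<exists>N h. inf_rep T1 N h u) \<and> alg_on \<Omega> (\<lambda>\<omega>. \<omega> ^ \<kappa>) u}"
  have T1p: "T1 > 0" using T T1 by simp
  have K_const: "(\<lambda>_. c) \<in> K" for c using inf_rep_const alg_on_const by (auto simp: K_def)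
  have K_add: "(\<lambda>\<omega>. u \<omega> + v \<omega>) \<in> K" if "u \<in> K" "v \<in> K" for u v
    using that inf_rep_add[OF _ _ T1p] alg_on_add_mult(1) unfolding K_def by blast
  have K_mult: "(\<lambda>\<omega>. u \<omega> * v \<omega>) \<in> K" if "u \<in> K" "v \<in> K" for u v
    using that inf_rep_mult alg_on_add_mult(2) unfolding K_def by blast
  have K_\<Lambda>: "\<Lambda> \<alpha> \<in> K" if \<alpha>: "\<alpha> \<in> S" for \<alpha>
  proof -
    have "P \<noteq> 0" using p by auto
    then have "alg_on \<Omega> (\<lambda>\<omega>. \<omega> ^ \<kappa>) (\<Lambda> \<alpha>)"
      unfolding alg_on_def using roots[OF \<alpha>] T1 by (intro exI[of _ "reflect_poly P"]) (auto simp: \<Omega>_def)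
    then show ?thesis using rep[OF \<alpha>] inf_rep_mono[OF _ T T1(1)] unfolding K_def by blast
  qed
  have D_ne: "D (\<alpha>, \<gamma>) \<omega> \<noteq> 0" if "\<alpha> \<in> S" "\<gamma> \<in> S" "\<alpha> \<noteq> \<gamma>" "\<omega> \<in> \<Omega>" for \<alpha> \<gamma> \<omega>
    using that T'(2)[of "(\<alpha>, \<gamma>)" \<omega>] T1(2)[of "(\<alpha>, \<gamma>)"] by (auto simp: J_def \<Omega>_def)
  have K_inv: "(\<lambda>\<omega>. 1 / (\<Lambda> \<alpha> \<omega> - \<Lambda> \<gamma> \<omega>)) \<in> K" if st: "\<alpha> \<in> S" "\<gamma> \<in> S" "\<alpha> \<noteq> \<gamma>" for \<alpha> \<gamma>
  proof -
    have a: "(\<alpha>, \<gamma>) \<in> J" using st by (auto simp: J_def)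
    obtain n g where "inf_rep (T' (\<alpha>, \<gamma>)) n g (\<lambda>\<omega>. 1 / D (\<alpha>, \<gamma>) \<omega>)" using T'(3)[OF a] by blast
    from inf_rep_mono[OF this _ T1(2)[OF a]] have 1: "\<exists>n g. inf_rep T1 n g (\<lambda>\<omega>. 1 / D (\<alpha>, \<gamma>) \<omega>)"
      using T'(1)[OF a] T by auto
    have "(\<lambda>\<omega>. \<Lambda> \<alpha> \<omega> + (-1) * \<Lambda> \<gamma> \<omega>) \<in> K"
      by (intro K_add K_mult K_const K_\<Lambda> st)
    then have "D (\<alpha>, \<gamma>) \<in> K" unfolding D_def[abs_def] fst_conv snd_conv .
    then have "alg_on \<Omega> (\<lambda>\<omega>. \<omega> ^ \<kappa>) (\<lambda>\<omega>. 1 / D (\<alpha>, \<gamma>) \<omega>)"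
      using D_ne[OF st] by (intro alg_on_inverse) (auto simp: K_def)
    with 1 show ?thesis by (simp add: K_def D_def)
  qed
  interpret function_ring \<Omega> K S \<Lambda>
    using K_const K_add K_mult S K_\<Lambda> D_ne K_inv by unfold_locales (auto simp: D_def)
  \<comment> \<open>If all multiplicities vanished, \<open>P\<close> would be constant in
    \<open>\<xi>\<close> for every large real \<open>\<zeta>\<close>, and its leading coefficient
    would have infinitely many zeros.\<close>
  have "sum m S \<noteq> 0"
  proof
    assume "sum m S = 0"
    then have m0: "\<And>\<alpha>. \<alpha> \<in> S \<Longrightarrow> m \<alpha> = 0" using S by simp
    have "poly (coeff P (degree P)) (of_real x) = 0" if x: "x > T ^ \<kappa>" for x :: real
    proof -
      define w where "w = complex_of_real (root \<kappa> x)"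
      have xp: "x > 0" using x T zero_less_power[of T \<kappa>] by linarith
      have wk: "w ^ \<kappa> = of_real x" using xp \<kappa> unfolding w_def by (simp flip: of_real_power)
      have "T < norm w" using x xp \<kappa> T real_root_less_mono[OF _ x, of \<kappa>] by (simp add: w_def real_root_power_cancel)
      then have "poly (map_poly (\<lambda>q. poly q (of_real x)) P) = poly [:P0:]"
        using fac[of w] m0 by (simp add: fun_eq_iff wk eval2_map_poly)
      then have "map_poly (\<lambda>q. poly q (of_real x)) P = [:P0:]"
        by (rule poly_eq_poly_eq_iff[THEN iffD1])
      then have "coeff (map_poly (\<lambda>q. poly q (of_real x)) P) (degree P) = coeff [:P0:] (degree P)" by simp
      then show ?thesis using p by (simp add: coeff_map_poly coeff_pCons split: nat.splits)
    qed
    then have sub: "complex_of_real ` {T ^ \<kappa><..} \<subseteq> {z. poly (coeff P (degree P)) z = 0}" by auto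
    have "infinite (complex_of_real ` {T ^ \<kappa><..})"
      by (subst finite_image_iff) (auto simp: infinite_Ioi intro: inj_onI)
    then have "coeff P (degree P) = 0" using poly_roots_finite finite_subset[OF sub] by blast
    then show False using p by auto
  qed
  from partial_fractions[OF this] obtain C where C: "\<And>\<alpha> \<beta>. \<alpha> \<in> S \<Longrightarrow> \<beta> \<in> {1..m \<alpha>} \<Longrightarrow> C \<alpha> \<beta> \<in> K"
    "\<And>\<omega> n. \<omega> \<in> \<Omega> \<Longrightarrow> fps_nth (\<Prod>\<alpha>\<in>S. geom_fps (\<Lambda> \<alpha> \<omega>) ^ m \<alpha>) n =
     (\<Sum>\<alpha>\<in>S. \<Sum>\<beta>=1..m \<alpha>. C \<alpha> \<beta> \<omega> * fact_quot n \<beta> * \<Lambda> \<alpha> \<omega> ^ n)" by blast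
  have CK: "(\<lambda>\<omega>. 1 / P0 * C \<alpha> \<beta> \<omega>) \<in> K" if "\<alpha> \<in> S" "\<beta> \<in> {1..m \<alpha>}" for \<alpha> \<beta>
    by (intro K_mult K_const C that)
  have "poly (resolvent_poly P P0 n) (\<omega> ^ \<kappa>) =
      (\<Sum>\<alpha>\<in>S. \<Sum>\<beta>=1..m \<alpha>. (1 / P0 * C \<alpha> \<beta> \<omega>) * fact_quot n \<beta> * \<Lambda> \<alpha> \<omega> ^ n)" if w: "T1 < norm \<omega>" for n \<omega>
  proof -
    have "poly (resolvent_poly P P0 n) (\<omega> ^ \<kappa>) = 1 / P0 * fps_nth (\<Prod>\<alpha>\<in>S. geom_fps (\<Lambda> \<alpha> \<omega>) ^ m \<alpha>) n"
      by (rule poly_resolvent[OF P0 S fac]) (use w T1 in simp)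
    also have "\<dots> = 1 / P0 * (\<Sum>\<alpha>\<in>S. \<Sum>\<beta>=1..m \<alpha>. C \<alpha> \<beta> \<omega> * fact_quot n \<beta> * \<Lambda> \<alpha> \<omega> ^ n)"
      using w by (subst C(2)) (simp_all add: \<Omega>_def)
    finally show ?thesis by (simp add: sum_distrib_left mult.assoc)
  qed
  then show ?thesis using T1 CK unfolding K_def \<Omega>_def
    by (intro exI[of _ T1] conjI exI[of _ "\<lambda>\<alpha> \<beta> \<omega>. 1 / P0 * C \<alpha> \<beta> \<omega>"]) auto
qed

section \<open>The decomposition\<close>

theorem theorem5:
  fixes s r r0 :: real
    and P :: "complex poly poly" and P0 :: complex
    and l \<kappa> :: nat and m :: "nat \<Rightarrow> nat"
    and lam Lam :: "nat \<Rightarrow> complex \<Rightarrow> complex"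
    and q :: "nat \<Rightarrow> rat"
    and f x :: "nat \<Rightarrow> complex \<Rightarrow> complex"
  assumes s: "s > 0"
    and P0: "P0 \<noteq> 0" "coeff P 0 = [:P0:]"
    and p: "degree P \<ge> 1"
    and r0: "r0 > 0"
    and factorization: "\<And>\<xi> \<zeta>. r0 < norm \<zeta> \<Longrightarrow>
          eval2 P \<xi> \<zeta> = P0 * (\<Prod>\<alpha>=1..l. (1 - \<xi> * lam \<alpha> \<zeta>) ^ m \<alpha>)"
    and roots: "\<And>\<alpha> \<zeta>. \<alpha> \<in> {1..l} \<Longrightarrow> r0 < norm \<zeta> \<Longrightarrow>
          eval2 (reflect_poly P) (lam \<alpha> \<zeta>) \<zeta> = 0"
    and distinct: "\<And>\<alpha> \<alpha>'. \<alpha> \<in> {1..l} \<Longrightarrow> \<alpha>' \<in> {1..l} \<Longrightarrow> \<alpha> \<noteq> \<alpha>' \<Longrightarrow>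
          \<exists>\<zeta>. r0 < norm \<zeta> \<and> lam \<alpha> \<zeta> \<noteq> lam \<alpha>' \<zeta>"
    and multiplicities: "\<And>\<alpha>. \<alpha> \<in> {1..l} \<Longrightarrow> m \<alpha> \<ge> 1"
    and kappa: "\<kappa> \<ge> 1" "\<And>\<alpha>. \<alpha> \<in> {1..l} \<Longrightarrow> ramified_hol \<kappa> r0 (Lam \<alpha>) (lam \<alpha>)"
    and kappa_minimal: "\<And>\<kappa>' R. \<kappa>' \<ge> 1 \<Longrightarrow> R > 0 \<Longrightarrow>
          (\<forall>\<alpha>\<in>{1..l}. \<exists>G. ramified_hol \<kappa>' R G (lam \<alpha>)) \<Longrightarrow> \<kappa> \<le> \<kappa>'"
    and pole_orders: "\<And>\<alpha>. \<alpha> \<in> {1..l} \<Longrightarrow> pole_order (lam \<alpha>) (q \<alpha>)"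
    and r: "r > 0"
    and f: "f \<in> E_series \<kappa> r"
    and x: "x \<in> E_series \<kappa> r"
    and solution: "formal_solution \<kappa> s r P x f"
  shows "\<exists>Q. difference_solution P P0 Q \<and>
           (\<forall>Q'. difference_solution P P0 Q' \<longrightarrow> (\<forall>n\<ge>1 - int (degree P). Q' n = Q n)) \<and>
           (\<exists>R\<ge>r0. \<exists>c C.
              (\<forall>\<alpha>\<in>{1..l}. \<forall>\<beta>\<in>{1..m \<alpha>}.
                 algebraic_fun R (c \<alpha> \<beta>) \<and> ramified_hol \<kappa> R (C \<alpha> \<beta>) (c \<alpha> \<beta>)) \<and>
              (\<forall>n \<zeta>. R < norm \<zeta> \<longrightarrow>
                 poly (Q (int n)) \<zeta> =
                   (\<Sum>\<alpha>=1..l. \<Sum>\<beta>=1..m \<alpha>. c \<alpha> \<beta> \<zeta> * fact_quot n \<beta> * lam \<alpha> \<zeta> ^ n)) \<and>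
              (\<forall>\<rho> d t0. 0 < \<rho> \<and> R < \<rho> ^ \<kappa> \<and> 0 < d \<and> d < root \<kappa> r \<longrightarrow>
                 (\<exists>r' X. 0 < r' \<and> r' \<le> r \<and> root \<kappa> r' < d \<and>
                    (\<forall>\<alpha>\<in>{1..l}. \<forall>\<beta>\<in>{1..m \<alpha>}.
                       X \<alpha> \<beta> \<in> E_series \<kappa> r' \<and>
                       (\<forall>n. \<forall>w\<in>cball 0 (root \<kappa> r').
                          X \<alpha> \<beta> n w =
                            q_op_coeff \<kappa> s \<rho> d t0 (C \<alpha> \<beta>) (Lam \<alpha>) \<beta> f n w)) \<and>
                    (\<forall>n. \<forall>w\<in>cball 0 (root \<kappa> r').
                       x n w = (\<Sum>\<alpha>=1..l. \<Sum>\<beta>=1..m \<alpha>. X \<alpha> \<beta> n w)) \<and>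
                    (\<forall>\<sigma>\<ge>0. f \<in> E_gevrey \<kappa> r \<sigma> \<longrightarrow>
                       (\<forall>\<alpha>\<in>{1..l}. \<forall>\<beta>\<in>{1..m \<alpha>}.
                          X \<alpha> \<beta> \<in> E_gevrey \<kappa> r' (max \<sigma> (of_rat (q \<alpha>) * s)))))))"
proof -

  \<comment> \<open>Transfer of the hypotheses from \<open>\<zeta>\<close> to
    \<open>\<omega>\<close>\<close>
  define T where "T = root \<kappa> r0"
  have T: "T > 0" using r0 kappa(1) by (simp add: T_def)
  have Tk: "T ^ \<kappa> = r0" using r0 kappa(1) by (simp add: T_def)
  have outside: "r0 < norm \<omega> ^ \<kappa> \<longleftrightarrow> T < norm \<omega>" for \<omega> :: complex
    using power_less_iff_root[OF kappa(1), of T "norm \<omega>"] T by (simp add: Tk)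
  define S where "S = {1..l}"
  have fS: "finite S" by (simp add: S_def)
  have LamH: "Lam \<alpha> holomorphic_on {\<omega>. T < norm \<omega>}"
    and LamO: "\<exists>N::nat. Lam \<alpha> \<in> O[at_infinity](\<lambda>\<omega>. \<omega> ^ N)"
    and lamLam: "\<And>\<zeta>. r0 < norm \<zeta> \<Longrightarrow> lam \<alpha> \<zeta> = Lam \<alpha> (\<zeta> powr (1 / of_nat \<kappa>))" if "\<alpha> \<in> S" for \<alpha>
    using kappa(2)[of \<alpha>] that unfolding ramified_hol_def outside S_def by auto
  have rep: "\<exists>N h. inf_rep T N h (Lam \<alpha>)" if "\<alpha> \<in> S" for \<alpha>
    using LamO[OF that] inf_rep_exists[OF LamH[OF that] _ T] by blast
  \<comment> \<open>On the positive half-line the principal root inverts the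
    \<open>\<kappa>\<close>-th power; elsewhere it may return another root. The identity theorem
    needs no more than this half-line.\<close>
  have real_branch: "r0 < norm (complex_of_real x ^ \<kappa>)" "(complex_of_real x ^ \<kappa>) powr (1 / of_nat \<kappa>) = of_real x" if x: "x > T" for x
  proof -
    have "r0 < x ^ \<kappa>" using x outside[of "of_real x"] T by simp
    then show "r0 < norm (complex_of_real x ^ \<kappa>)" using x T by (simp add: norm_power)
    have "complex_of_real (x ^ \<kappa>) powr of_real (1 / real \<kappa>) = of_real ((x ^ \<kappa>) powr (1 / real \<kappa>))"
      using x T by (intro powr_of_real) auto
    also have "(x ^ \<kappa>) powr (1 / real \<kappa>) = x"
      using x T kappa(1) by (simp add: powr_powr flip: powr_realpow)
    finally show "(complex_of_real x ^ \<kappa>) powr (1 / of_nat \<kappa>) = of_real x" by simp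
  qed
  have fac: "eval2 P \<xi> (\<omega> ^ \<kappa>) = P0 * (\<Prod>\<alpha>\<in>S. (1 - \<xi> * Lam \<alpha> \<omega>) ^ m \<alpha>)" if \<omega>: "T < norm \<omega>" for \<xi> \<omega>
  proof (rule eq_outside_if_eq_on_reals[OF _ _ T _ \<omega>])
    show "(\<lambda>\<omega>. eval2 P \<xi> (\<omega> ^ \<kappa>)) holomorphic_on {\<omega>. T < norm \<omega>}"
      by (intro eval2_holomorphic holomorphic_intros)
    show "(\<lambda>\<omega>. P0 * (\<Prod>\<alpha>\<in>S. (1 - \<xi> * Lam \<alpha> \<omega>) ^ m \<alpha>)) holomorphic_on {\<omega>. T < norm \<omega>}"
      by (intro holomorphic_intros LamH)
    fix x assume x: "x > T"
    show "eval2 P \<xi> (of_real x ^ \<kappa>) = P0 * (\<Prod>\<alpha>\<in>S. (1 - \<xi> * Lam \<alpha> (of_real x)) ^ m \<alpha>)"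
      unfolding factorization[OF real_branch(1)[OF x]] S_def[symmetric]
      by (intro arg_cong2[of _ _ _ _ "(*)"] prod.cong refl) (simp add: lamLam real_branch[OF x])
  qed
  have rts: "eval2 (reflect_poly P) (Lam \<alpha> \<omega>) (\<omega> ^ \<kappa>) = 0" if \<alpha>: "\<alpha> \<in> S" and \<omega>: "T < norm \<omega>" for \<alpha> \<omega>
  proof (rule eq_outside_if_eq_on_reals[OF _ _ T _ \<omega>])
    show "(\<lambda>\<omega>. eval2 (reflect_poly P) (Lam \<alpha> \<omega>) (\<omega> ^ \<kappa>)) holomorphic_on {\<omega>. T < norm \<omega>}"
      by (intro eval2_holomorphic holomorphic_intros LamH \<alpha>)
    fix x assume x: "x > T"
    show "eval2 (reflect_poly P) (Lam \<alpha> (of_real x)) (of_real x ^ \<kappa>) = 0"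
      using roots[of \<alpha>, OF _ real_branch(1)[OF x]] \<alpha> lamLam[OF \<alpha> real_branch(1)[OF x]]
      by (simp add: S_def real_branch[OF x])
  qed auto
  have branch: "(\<zeta> powr (1 / of_nat \<kappa>)) ^ \<kappa> = \<zeta>" "R ^ \<kappa> < norm \<zeta> \<longleftrightarrow> R < norm (\<zeta> powr (1 / of_nat \<kappa>))" if "\<zeta> \<noteq> 0" "R \<ge> 0" for \<zeta> :: complex and R :: real
  proof -
    show 1: "(\<zeta> powr (1 / of_nat \<kappa>)) ^ \<kappa> = \<zeta>" by (rule root_branch(1)[OF kappa(1) that(1)])
    have "norm \<zeta> = norm (\<zeta> powr (1 / of_nat \<kappa>)) ^ \<kappa>" by (subst 1[symmetric]) (simp add: norm_power)
    then show "R ^ \<kappa> < norm \<zeta> \<longleftrightarrow> R < norm (\<zeta> powr (1 / of_nat \<kappa>))"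
      using power_less_iff_root[OF kappa(1) that(2)] by simp
  qed
  have ne: "\<exists>\<omega>. T < norm \<omega> \<and> Lam \<alpha> \<omega> \<noteq> Lam \<gamma> \<omega>" if st: "\<alpha> \<in> S" "\<gamma> \<in> S" "\<alpha> \<noteq> \<gamma>" for \<alpha> \<gamma>
  proof -
    obtain \<zeta> where z: "r0 < norm \<zeta>" "lam \<alpha> \<zeta> \<noteq> lam \<gamma> \<zeta>" using distinct[of \<alpha> \<gamma>] st by (auto simp: S_def)
    then have "\<zeta> \<noteq> 0" using r0 by auto
    then have "T < norm (\<zeta> powr (1 / of_nat \<kappa>))" using branch(2)[of \<zeta> T] T z by (simp add: Tk)
    then show ?thesis using z lamLam st by metis
  qed

  \<comment> \<open>The coefficients and the polynomials of the difference equation\<close>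
  obtain T1 C where T1: "T1 \<ge> T" and C: "\<And>\<alpha> \<beta>. \<alpha> \<in> S \<Longrightarrow> \<beta> \<in> {1..m \<alpha>} \<Longrightarrow> \<exists>N h. inf_rep T1 N h (C \<alpha> \<beta>)"
      "\<And>\<alpha> \<beta>. \<alpha> \<in> S \<Longrightarrow> \<beta> \<in> {1..m \<alpha>} \<Longrightarrow> alg_on {\<omega>. T1 < norm \<omega>} (\<lambda>\<omega>. \<omega> ^ \<kappa>) (C \<alpha> \<beta>)"
    and q_eq: "\<And>n \<omega>. T1 < norm \<omega> \<Longrightarrow> poly (resolvent_poly P P0 n) (\<omega> ^ \<kappa>) =
      (\<Sum>\<alpha>\<in>S. \<Sum>\<beta>=1..m \<alpha>. C \<alpha> \<beta> \<omega> * fact_quot n \<beta> * Lam \<alpha> \<omega> ^ n)"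
    using resolvent_coefficients[OF P0 p T kappa(1) fS rep fac rts ne] by blast
  have T1p: "T1 > 0" using T T1 by simp
  define R where "R = T1 ^ \<kappa>"
  have R: "R \<ge> r0" unfolding R_def Tk[symmetric] using T T1 by (intro power_mono) auto
  have Rp: "R > 0" using R r0 by simp
  have outR: "R < norm \<omega> ^ \<kappa> \<longleftrightarrow> T1 < norm \<omega>" for \<omega> :: complex
    unfolding R_def by (rule power_less_iff_root[OF kappa(1)]) (use T1p in auto)
  define c where "c \<alpha> \<beta> \<zeta> = C \<alpha> \<beta> (\<zeta> powr (1 / of_nat \<kappa>))" for \<alpha> \<beta> \<zeta>
  have bR: "(\<zeta> powr (1 / of_nat \<kappa>)) ^ \<kappa> = \<zeta>" "T1 < norm (\<zeta> powr (1 / of_nat \<kappa>))" if "R < norm \<zeta>" for \<zeta> :: complex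
  proof -
    have "\<zeta> \<noteq> 0" using that Rp by auto
    then show "(\<zeta> powr (1 / of_nat \<kappa>)) ^ \<kappa> = \<zeta>" "T1 < norm (\<zeta> powr (1 / of_nat \<kappa>))"
      using branch[of \<zeta> T1] T1p that by (auto simp: R_def)
  qed
  define Q where "Q n = (if n < 0 then 0 else resolvent_poly P P0 (nat n))" for n :: int
  define s' where "s' = s / real \<kappa>"
  have s': "s' > 0" using s kappa(1) by (simp add: s'_def)
  define R1 where "R1 = root \<kappa> r"
  have R1: "R1 > 0" using r kappa(1) by (simp add: R1_def)
  have fE: "f n holomorphic_on ball 0 R1" "continuous_on (cball 0 R1) (f n)" for n
    using f E_spaceD[of "f n" \<kappa> r] by (auto simp: E_series_def R1_def)
  have alg: "algebraic_fun R (c \<alpha> \<beta>)" if st: "\<alpha> \<in> S" "\<beta> \<in> {1..m \<alpha>}" for \<alpha> \<beta>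
  proof -
    obtain A where "A \<noteq> 0" "\<And>\<omega>. T1 < norm \<omega> \<Longrightarrow> eval2 A (C \<alpha> \<beta> \<omega>) (\<omega> ^ \<kappa>) = 0"
      using C(2)[OF st] by (auto simp: alg_on_def)
    then show ?thesis unfolding algebraic_fun_def c_def using bR by metis
  qed
  have ram: "ramified_hol \<kappa> R (C \<alpha> \<beta>) (c \<alpha> \<beta>)" if st: "\<alpha> \<in> S" "\<beta> \<in> {1..m \<alpha>}" for \<alpha> \<beta>
  proof -
    obtain N h where h: "inf_rep T1 N h (C \<alpha> \<beta>)" using C(1)[OF st] by blast
    show ?thesis
      unfolding ramified_hol_def outR c_def using inf_rep_holomorphic[OF h T1p] inf_rep_bigo[OF h T1p] by blast
  qed
  have qc: "poly (Q (int n)) \<zeta> = (\<Sum>\<alpha>=1..l. \<Sum>\<beta>=1..m \<alpha>. c \<alpha> \<beta> \<zeta> * fact_quot n \<beta> * lam \<alpha> \<zeta> ^ n)" if z: "R < norm \<zeta>" for n \<zeta>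
    using q_eq[OF bR(2)[OF z], of n] lamLam z R unfolding bR(1)[OF z] by (simp add: Q_def c_def S_def)

  \<comment> \<open>Decomposition and Gevrey bounds for a given contour\<close>
  have main: "\<exists>r' X. 0 < r' \<and> r' \<le> r \<and> root \<kappa> r' < d \<and>
      (\<forall>\<alpha>\<in>{1..l}. \<forall>\<beta>\<in>{1..m \<alpha>}. X \<alpha> \<beta> \<in> E_series \<kappa> r' \<and>
         (\<forall>n. \<forall>w\<in>cball 0 (root \<kappa> r'). X \<alpha> \<beta> n w = q_op_coeff \<kappa> s \<rho> d t0 (C \<alpha> \<beta>) (Lam \<alpha>) \<beta> f n w)) \<and>
      (\<forall>n. \<forall>w\<in>cball 0 (root \<kappa> r'). x n w = (\<Sum>\<alpha>=1..l. \<Sum>\<beta>=1..m \<alpha>. X \<alpha> \<beta> n w)) \<and>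
      (\<forall>\<sigma>\<ge>0. f \<in> E_gevrey \<kappa> r \<sigma> \<longrightarrow>
         (\<forall>\<alpha>\<in>{1..l}. \<forall>\<beta>\<in>{1..m \<alpha>}. X \<alpha> \<beta> \<in> E_gevrey \<kappa> r' (max \<sigma> (of_rat (q \<alpha>) * s))))"
    if asm: "0 < \<rho> \<and> R < \<rho> ^ \<kappa> \<and> 0 < d \<and> d < root \<kappa> r" for \<rho> d t0 :: real
  proof -
    have \<rho>: "T1 < \<rho>" using asm power_less_iff_root[OF kappa(1), of T1 \<rho>] T1p by (simp add: R_def)
    have d: "0 < d" "d < R1" using asm by (auto simp: R1_def)
    \<comment> \<open>Half of the radius \<open>d / 4 powr s'\<close> within which the triple series
      converge. It is a radius in \<open>w\<close>, hence \<open>r' = z1 ^ \<kappa>\<close> in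
      \<open>z\<close>.\<close>
    define z1 where "z1 = d / (2 * 4 powr s')"
    have p4: "(1::real) \<le> 4 powr s'" using s' by (intro ge_one_powr_ge_zero) auto
    have z1: "z1 > 0" "4 powr s' * z1 < d" using d by (auto simp: z1_def)
    have "z1 \<le> d / 2" unfolding z1_def using d p4 by (intro divide_left_mono) auto
    then have z1d: "z1 < d" using d by simp
    define r' where "r' = z1 ^ \<kappa>"
    have rr': "root \<kappa> r' = z1" using z1 kappa(1) by (simp add: r'_def real_root_power_cancel)
    have r'p: "r' > 0" using z1 by (simp add: r'_def)
    have "r' \<le> R1 ^ \<kappa>" unfolding r'_def using z1 z1d d by (intro power_mono) auto
    then have r'r: "r' \<le> r" using r kappa(1) by (simp add: R1_def)
    have small: "4 powr s' * norm w < d" if "w \<in> cball 0 z1" for w :: complex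
    proof -
      have "4 powr s' * norm w \<le> 4 powr s' * z1" using that by (intro mult_left_mono) auto
      then show ?thesis using z1 by linarith
    qed
    define op where "op \<alpha> \<beta> n = psdo s' \<rho> d t0 (\<lambda>\<omega>. C \<alpha> \<beta> \<omega> * Lam \<alpha> \<omega> ^ n)" for \<alpha> \<beta> n
    define X where "X \<alpha> \<beta> = q_op_coeff \<kappa> s \<rho> d t0 (C \<alpha> \<beta>) (Lam \<alpha>) \<beta> f" for \<alpha> \<beta>
    have X_eq: "X \<alpha> \<beta> N = (\<lambda>w. \<Sum>n\<le>N. fact_quot n \<beta> * op \<alpha> \<beta> n (f (N - n)) w)" for \<alpha> \<beta> N
      by (simp add: X_def q_op_coeff_def op_def s'_def fun_eq_iff)
    have repL: "\<exists>N h. inf_rep T1 N h (\<lambda>\<omega>. C \<alpha> \<beta> \<omega> * Lam \<alpha> \<omega> ^ n)" if st: "\<alpha> \<in> S" "\<beta> \<in> {1..m \<alpha>}" for \<alpha> \<beta> n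
    proof -
      obtain N h where "inf_rep T1 N h (C \<alpha> \<beta>)" using C(1)[OF st] by blast
      moreover obtain N' h' where "inf_rep T1 N' h' (Lam \<alpha>)" using rep[OF st(1)] inf_rep_mono[OF _ T T1] by blast
      ultimately show ?thesis using inf_rep_mult inf_rep_power by blast
    qed
    have op_hol: "continuous_on (cball 0 z1) (op \<alpha> \<beta> n (f j))" "op \<alpha> \<beta> n (f j) holomorphic_on ball 0 z1"
      if st: "\<alpha> \<in> S" "\<beta> \<in> {1..m \<alpha>}" for \<alpha> \<beta> n j
    proof -
      obtain N h where rp: "inf_rep T1 N h (\<lambda>\<omega>. C \<alpha> \<beta> \<omega> * Lam \<alpha> \<omega> ^ n)" using repL[OF st] by blast
      show "continuous_on (cball 0 z1) (op \<alpha> \<beta> n (f j))" "op \<alpha> \<beta> n (f j) holomorphic_on ball 0 z1"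
        unfolding op_def using psdo_holomorphic[OF s' d T1p \<rho> rp fE(1) _ z1(2)] z1 by auto
    qed
    have XE: "X \<alpha> \<beta> \<in> E_series \<kappa> r'" if st: "\<alpha> \<in> S" "\<beta> \<in> {1..m \<alpha>}" for \<alpha> \<beta>
      unfolding E_series_def E_space_def rr' X_eq using op_hol[OF st]
      by (auto intro!: holomorphic_intros continuous_intros)
    have decomposition: "x N w = (\<Sum>\<alpha>=1..l. \<Sum>\<beta>=1..m \<alpha>. X \<alpha> \<beta> N w)" if w: "w \<in> cball 0 z1" for N w
    proof -
      have xE: "x N holomorphic_on ball 0 R1" using x E_spaceD[of "x N" \<kappa> r] by (auto simp: E_series_def R1_def)
      define rs where "rs = resolvent_poly P P0"
      \<comment> \<open>The coefficient of \<open>w ^ k\<close> in the operator attached to the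
        power \<open>n\<close> of \<open>\<omega>\<close>, applied to \<open>f j\<close>, as in
        \<open>psdo_power_sums\<close>.\<close>
      define cf where "cf n j k = (taylor (f j) (k + n) * of_real (Gamma (1 + real (k + n) * s') / Gamma (1 + real k * s')))" for n j k
      have rec: "borel_coeff s' (x N) k = (\<Sum>n\<le>N. shift_op \<kappa> (rs n) (borel_coeff s' (f (N - n))) k)" for k
      proof (rule solve_shift_equation)
        show "(\<Sum>j\<le>min N (degree P). shift_op \<kappa> (coeff P j) (borel_coeff s' (x (N - j))) k) = borel_coeff s' (f N) k" for N k
          unfolding s'_def by (rule formal_solution_borel[OF s kappa(1) r x f solution])
        show "(\<Sum>n\<le>M. rs n * coeff P (M - n)) = (if M = 0 then 1 else 0)" for M
        proof -
          have "(\<Sum>n\<le>M. rs n * coeff P (M - n)) = (\<Sum>i\<le>M. coeff P i * resolvent_poly P P0 (M - i))"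
            by (rule sum.reindex_bij_witness[of _ "\<lambda>i. M - i" "\<lambda>i. M - i"]) (auto simp: rs_def)
          then show ?thesis by (simp add: resolvent_poly_conv[OF P0])
        qed
      qed
      have Gp: "Gamma (1 + real k * s') > 0" for k by (rule Gamma_1_plus_pos) (use s' in simp)
      have tx: "taylor (x N) k = (\<Sum>n\<le>N. \<Sum>j\<le>degree (rs n). coeff (rs n) j * cf (\<kappa> * j) (N - n) k)" for k
      proof -
        have "taylor (x N) k = borel_coeff s' (x N) k / of_real (Gamma (1 + real k * s'))"
          using Gp[of k] by (simp add: borel_coeff_def Gamma_seq_def mult.commute)
        then show ?thesis unfolding rec
          by (simp add: shift_op_def borel_coeff_def Gamma_seq_def cf_def sum_divide_distrib mult_ac)
      qed
      have "(\<lambda>k. \<Sum>n\<le>N. \<Sum>j\<le>degree (rs n). coeff (rs n) j * (cf (\<kappa> * j) (N - n) k * w ^ k)) sums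
         (\<Sum>n\<le>N. \<Sum>j\<le>degree (rs n). coeff (rs n) j * psdo s' \<rho> d t0 (\<lambda>\<omega>. \<omega> ^ (\<kappa> * j)) (f (N - n)) w)"
        unfolding cf_def by (intro sums_sum sums_mult psdo_power_sums[OF s' d T1p \<rho> fE(1) small[OF w]])
      then have "(\<lambda>k. taylor (x N) k * w ^ k) sums
         (\<Sum>n\<le>N. \<Sum>j\<le>degree (rs n). coeff (rs n) j * psdo s' \<rho> d t0 (\<lambda>\<omega>. \<omega> ^ (\<kappa> * j)) (f (N - n)) w)"
        unfolding tx sum_distrib_right by (simp add: mult.assoc)
      moreover have "(\<lambda>k. taylor (x N) k * w ^ k) sums x N w"
        by (rule taylor_sums[OF xE]) (use w z1d d in auto)
      ultimately have xN: "x N w = (\<Sum>n\<le>N. \<Sum>j\<le>degree (rs n). coeff (rs n) j * psdo s' \<rho> d t0 (\<lambda>\<omega>. \<omega> ^ (\<kappa> * j)) (f (N - n)) w)"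
        using sums_unique2 by blast
      \<comment> \<open>The operator whose symbol is the polynomial \<open>rs n\<close> at
        \<open>\<omega> ^ \<kappa>\<close> is computed twice by linearity: from the monomials of the
        polynomial and from its partial fraction form.\<close>
      have "(\<Sum>j\<le>degree (rs n). coeff (rs n) j * psdo s' \<rho> d t0 (\<lambda>\<omega>. \<omega> ^ (\<kappa> * j)) \<phi> w) =
          (\<Sum>\<alpha>\<in>S. \<Sum>\<beta>=1..m \<alpha>. fact_quot n \<beta> * op \<alpha> \<beta> n \<phi> w)" if \<phi>: "\<phi> holomorphic_on ball 0 R1" for n \<phi>
      proof -
        have "psdo s' \<rho> d t0 (\<lambda>\<omega>. poly (rs n) (\<omega> ^ \<kappa>)) \<phi> w = (\<Sum>j\<le>degree (rs n). coeff (rs n) j * psdo s' \<rho> d t0 (\<lambda>\<omega>. \<omega> ^ (\<kappa> * j)) \<phi> w)"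
        proof (rule psdo_linear[OF s' d T1p \<rho> _ _ _ \<phi> small[OF w]])
          show "\<exists>N h. inf_rep T1 N h (\<lambda>\<omega>. \<omega> ^ (\<kappa> * j))" for j
            unfolding inf_rep_def by (intro exI[of _ "\<kappa> * j"] exI[of _ "\<lambda>_. 1"]) auto
        qed (auto simp: poly_altdef power_mult)
        moreover have "psdo s' \<rho> d t0 (\<lambda>\<omega>. poly (rs n) (\<omega> ^ \<kappa>)) \<phi> w =
           (\<Sum>a\<in>Sigma S (\<lambda>\<alpha>. {1..m \<alpha>}). fact_quot n (snd a) * psdo s' \<rho> d t0 (\<lambda>\<omega>. C (fst a) (snd a) \<omega> * Lam (fst a) \<omega> ^ n) \<phi> w)"
        proof (rule psdo_linear[OF s' d T1p \<rho> _ _ _ \<phi> small[OF w]])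
          show "finite (Sigma S (\<lambda>\<alpha>. {1..m \<alpha>}))" by (simp add: S_def)
          show "\<exists>N h. inf_rep T1 N h (\<lambda>\<omega>. C (fst a) (snd a) \<omega> * Lam (fst a) \<omega> ^ n)" if "a \<in> Sigma S (\<lambda>\<alpha>. {1..m \<alpha>})" for a
            using that by (intro repL) auto
          show "poly (rs n) (\<omega> ^ \<kappa>) = (\<Sum>a\<in>Sigma S (\<lambda>\<alpha>. {1..m \<alpha>}). fact_quot n (snd a) * (C (fst a) (snd a) \<omega> * Lam (fst a) \<omega> ^ n))"
            if "T1 < norm \<omega>" for \<omega>
            unfolding rs_def q_eq[OF that] by (subst sum.Sigma) (auto simp: S_def case_prod_unfold mult_ac)
        qed
        ultimately show ?thesis
          unfolding op_def by (subst sum.Sigma) (auto simp: S_def case_prod_unfold)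
      qed
      then have "x N w = (\<Sum>n\<le>N. \<Sum>\<alpha>\<in>S. \<Sum>\<beta>=1..m \<alpha>. fact_quot n \<beta> * op \<alpha> \<beta> n (f (N - n)) w)"
        unfolding xN using fE(1) by simp
      also have "\<dots> = (\<Sum>\<alpha>\<in>S. \<Sum>\<beta>=1..m \<alpha>. X \<alpha> \<beta> N w)"
        unfolding X_eq by (subst sum.swap) (intro sum.cong refl sum.swap)
      finally show ?thesis by (simp add: S_def)
    qed
    have gevrey: "X \<alpha> \<beta> \<in> E_gevrey \<kappa> r' (max \<sigma> (of_rat (q \<alpha>) * s))"
      if \<sigma>: "\<sigma> \<ge> 0" and fg: "f \<in> E_gevrey \<kappa> r \<sigma>" and st: "\<alpha> \<in> S" "\<beta> \<in> {1..m \<alpha>}" for \<sigma> \<alpha> \<beta>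
    proof -
      obtain A' B' where AB': "A' \<ge> 0" "B' \<ge> 0" "\<And>n. E_norm \<kappa> r (f n) \<le> A' * B' ^ n * fact n powr \<sigma>"
        using fg by (auto simp: E_gevrey_def)
      obtain Nc hc where c': "inf_rep T1 Nc hc (C \<alpha> \<beta>)" using C(1)[OF st] by blast
      obtain N0 h0 where L0: "inf_rep T N0 h0 (Lam \<alpha>)" using rep[OF st(1)] by blast
      have pq: "pole_order (lam \<alpha>) (q \<alpha>)" using pole_orders[of \<alpha>] st by (simp add: S_def)
      \<comment> \<open>Replaces the arbitrary exponent \<open>N0\<close> by one that the pole order
        controls; the Gevrey order depends on this exponent.\<close>
      obtain Nl hl where Nl: "inf_rep T Nl hl (Lam \<alpha>)" "real Nl \<le> real \<kappa> * max 0 (of_rat (q \<alpha>))"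
        using inf_rep_pole_order[OF L0 T T_def kappa(1) _ pq] lamLam[OF st(1)] by blast
      from inf_rep_mono[OF Nl(1) T T1] have l': "inf_rep T1 Nl hl (Lam \<alpha>)" .
      obtain A B where AB: "A \<ge> 0" "B \<ge> 0" and bd: "\<And>n \<phi> M z. \<phi> holomorphic_on ball 0 R1 \<Longrightarrow> continuous_on (cball 0 R1) \<phi> \<Longrightarrow>
          (\<forall>w\<in>cball 0 R1. norm (\<phi> w) \<le> M) \<Longrightarrow> norm z \<le> z1 \<Longrightarrow>
          norm (op \<alpha> \<beta> n \<phi> z) \<le> A * B ^ n * fact n powr (real Nl * s') * M"
        using psdo_gevrey_bound[OF s' d T1p \<rho> c' l' _ z1(2), of t0] z1 unfolding op_def by auto
      define \<nu> where "\<nu> = max \<sigma> (of_rat (q \<alpha>) * s)"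
      \<comment> \<open>The ramification cancels, since \<open>s'\<close> is
        \<open>s / \<kappa>\<close> and \<open>Nl\<close> is at most \<open>\<kappa>\<close> times
        the positive part of the pole order. Replacing that positive part by the pole order itself
        is possible because \<open>\<sigma> \<ge> 0\<close>.\<close>
      have "real Nl * s' \<le> (real \<kappa> * max 0 (of_rat (q \<alpha>))) * s'" using Nl(2) s' by (intro mult_right_mono) auto
      also have "\<dots> = max 0 (of_rat (q \<alpha>)) * s" using kappa(1) by (simp add: s'_def)
      also have "max 0 y * s \<le> max \<sigma> (y * s)" for y :: real
        using \<sigma> s by (cases "0 \<le> y") auto
      finally have \<tau>: "real Nl * s' \<le> \<nu>" unfolding \<nu>_def .
      define F where "F = (fact (\<beta> - 1) :: real)"
      have b: "norm (X \<alpha> \<beta> N w) \<le> \<bar>F\<bar> * A * A' * (4 * max 1 B * max 1 B') ^ N * fact N powr \<nu>" if w: "w \<in> cball 0 z1" for N w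
      proof -
        have "norm (X \<alpha> \<beta> N w) \<le> (\<Sum>n\<le>N. norm (fact_quot n \<beta> * op \<alpha> \<beta> n (f (N - n)) w))"
          unfolding X_eq by (rule norm_sum)
        also have "\<dots> \<le> (\<Sum>n\<le>N. F * 2 ^ n * (A * B ^ n * fact n powr (real Nl * s') * (A' * B' ^ (N - n) * fact (N - n) powr \<sigma>)))"
        proof (rule sum_mono)
          fix n
          have "\<forall>w\<in>cball 0 R1. norm (f (N - n) w) \<le> A' * B' ^ (N - n) * fact (N - n) powr \<sigma>"
          proof
            fix w assume "w \<in> cball (0::complex) R1"
            then have "norm (f (N - n) w) \<le> E_norm \<kappa> r (f (N - n))"
              using f by (intro norm_le_E_norm) (auto simp: R1_def E_series_def)
            then show "norm (f (N - n) w) \<le> A' * B' ^ (N - n) * fact (N - n) powr \<sigma>"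
              using AB'(3)[of "N - n"] by linarith
          qed
          from bd[OF fE this, of w n] w
          have "norm (op \<alpha> \<beta> n (f (N - n)) w) \<le> A * B ^ n * fact n powr (real Nl * s') * (A' * B' ^ (N - n) * fact (N - n) powr \<sigma>)" by simp
          then show "norm (fact_quot n \<beta> * op \<alpha> \<beta> n (f (N - n)) w) \<le>
              F * 2 ^ n * (A * B ^ n * fact n powr (real Nl * s') * (A' * B' ^ (N - n) * fact (N - n) powr \<sigma>))"
            unfolding norm_mult F_def using norm_fact_quot_le[of n \<beta>] by (intro mult_mono) auto
        qed
        also have "\<dots> \<le> \<bar>F\<bar> * A * A' * (4 * max 1 B * max 1 B') ^ N * fact N powr \<nu>"
          by (rule gevrey_convolution[OF AB AB'(1,2) \<tau>]) (use \<sigma> in \<open>auto simp: \<nu>_def\<close>)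
        finally show ?thesis .
      qed
      have "E_norm \<kappa> r' (X \<alpha> \<beta> N) \<le> (\<bar>F\<bar> * A * A') * (4 * max 1 B * max 1 B') ^ N * fact N powr \<nu>" for N
        unfolding E_norm_def rr' using z1 b by (intro cSUP_least) auto
      moreover have "\<bar>F\<bar> * A * A' \<ge> 0" "4 * max 1 B * max 1 B' \<ge> 0" using AB AB' by auto
      ultimately show ?thesis unfolding E_gevrey_def \<nu>_def[symmetric] using XE[OF st] by blast
    qed
    show ?thesis
      using r'p r'r z1d XE decomposition gevrey unfolding S_def
      by (intro exI[of _ r'] exI[of _ X]) (auto simp: rr' X_def)
  qed
  show ?thesis
  proof (intro exI[of _ Q] conjI)
    show "difference_solution P P0 Q" unfolding Q_def[abs_def] by (rule difference_solution_resolvent[OF P0])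
    then show "\<forall>Q'. difference_solution P P0 Q' \<longrightarrow> (\<forall>n\<ge>1 - int (degree P). Q' n = Q n)"
      using difference_solution_unique[OF P0] by blast
    show "\<exists>R\<ge>r0. \<exists>c C. (\<forall>\<alpha>\<in>{1..l}. \<forall>\<beta>\<in>{1..m \<alpha>}. algebraic_fun R (c \<alpha> \<beta>) \<and> ramified_hol \<kappa> R (C \<alpha> \<beta>) (c \<alpha> \<beta>)) \<and>
        (\<forall>n \<zeta>. R < norm \<zeta> \<longrightarrow> poly (Q (int n)) \<zeta> = (\<Sum>\<alpha>=1..l. \<Sum>\<beta>=1..m \<alpha>. c \<alpha> \<beta> \<zeta> * fact_quot n \<beta> * lam \<alpha> \<zeta> ^ n)) \<and>
        (\<forall>\<rho> d t0. 0 < \<rho> \<and> R < \<rho> ^ \<kappa> \<and> 0 < d \<and> d < root \<kappa> r \<longrightarrow>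
          (\<exists>r' X. 0 < r' \<and> r' \<le> r \<and> root \<kappa> r' < d \<and>
            (\<forall>\<alpha>\<in>{1..l}. \<forall>\<beta>\<in>{1..m \<alpha>}. X \<alpha> \<beta> \<in> E_series \<kappa> r' \<and>
               (\<forall>n. \<forall>w\<in>cball 0 (root \<kappa> r'). X \<alpha> \<beta> n w = q_op_coeff \<kappa> s \<rho> d t0 (C \<alpha> \<beta>) (Lam \<alpha>) \<beta> f n w)) \<and>
            (\<forall>n. \<forall>w\<in>cball 0 (root \<kappa> r'). x n w = (\<Sum>\<alpha>=1..l. \<Sum>\<beta>=1..m \<alpha>. X \<alpha> \<beta> n w)) \<and>
            (\<forall>\<sigma>\<ge>0. f \<in> E_gevrey \<kappa> r \<sigma> \<longrightarrow>
               (\<forall>\<alpha>\<in>{1..l}. \<forall>\<beta>\<in>{1..m \<alpha>}. X \<alpha> \<beta> \<in> E_gevrey \<kappa> r' (max \<sigma> (of_rat (q \<alpha>) * s))))))"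
      by (rule exI[of _ R], rule conjI[OF R], rule exI[of _ c], rule exI[of _ C])
        (use alg ram qc main in \<open>simp add: S_def\<close>)
  qed
qed

end
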